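(* Let $n\ge2$ and $k>2$, and let $\mathcal{H}$ be a codimension one, homogeneous holomorphic foliation germ at $\mathbf{0}\in\mathbb{C}^n$, defined by the fibres of a homogeneous polynomial $h$ of degree $k$ in $n$ complex variables with a unique critical point at $\mathbf{0}$. Then $\mathcal{H}$ is isotopic to the foliation $\mathcal{H}_k$ defined by the fibres of the Fermat polynomial $H^n_k=z_1^k+\dots+z_n^k$, and therefore $\mathcal{H}$ carries a Morse structure compatible with a Morse function isotopic to the quadratic form $Q=|z_1|^2+|z_2|^2+\dots+|z_n|^2$.
   Context: The leaves of the foliation defined by a polynomial $h$ are the connected components of the fibres of $h$ in $\mathbb{C}^n\setminus\{\mathbf{0}\}$. "$\mathcal{H}$ is isotopic to $\mathcal{H}_k$" means that there is an isotopy of $\mathbb{C}^n$ starting at the identity and fixing the origin $\mathbf{0}$, whose end map $\varphi$ carries the leaves of $\mathcal{H}$ to the leaves of $\mathcal{H}_k$. Here an isotopy is a continuous family of homeomorphisms of $\mathbb{C}^n$ fixing $\mathbf{0}$ that restrict to diffeomorphisms of $\mathbb{C}^n\setminus\{\mathbf{0}\}$ there. A function is isotopic to $Q$ if it is of the form $Q\circ\varphi$ with $\varphi$ the end map of such an isotopy. A foliation carries a Morse structure compatible with a function $g$ if for each leaf $\mathcal{L}$ (away from $\mathbf{0}$) the restriction $g|_{\mathcal{L}}$ is a Morse function, i.e. all its critical points are non-degenerate. *)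

theory Defs
  imports "HOL-Analysis.Analysis"
begin

section \<open>Smooth maps, diffeomorphisms, isotopies\<close>

text \<open>Class \<open>C\<^sup>k\<close> over the reals on an open set \<open>S\<close>, for maps with finite-dimensional
  domain, by iterated directional derivatives.\<close>

primrec Ck_on :: "nat \<Rightarrow> 'a::euclidean_space set \<Rightarrow> ('a \<Rightarrow> 'b::real_normed_vector) \<Rightarrow> bool"
  where
    "Ck_on 0 S f \<longleftrightarrow> continuous_on S f"
  | "Ck_on (Suc k) S f \<longleftrightarrow>
       (\<forall>x\<in>S. f differentiable (at x)) \<and>
       (\<forall>v. Ck_on k S (\<lambda>x. frechet_derivative f (at x) v))"

definition smooth_on :: "'a::euclidean_space set \<Rightarrow> ('a \<Rightarrow> 'b::real_normed_vector) \<Rightarrow> bool"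
  where "smooth_on S f \<longleftrightarrow> (\<forall>k. Ck_on k S f)"

definition diffeomorphism ::
    "'a::euclidean_space set \<Rightarrow> 'b::euclidean_space set \<Rightarrow> ('a \<Rightarrow> 'b) \<Rightarrow> ('b \<Rightarrow> 'a) \<Rightarrow> bool"
  where "diffeomorphism S T f g \<longleftrightarrow>
    open S \<and> open T \<and> homeomorphism S T f g \<and> smooth_on S f \<and> smooth_on T g"

text \<open>No differentiability is required at the origin, nor in the time parameter.\<close>

definition isotopy :: "(real \<Rightarrow> 'a::euclidean_space \<Rightarrow> 'a) \<Rightarrow> bool"
  where "isotopy F \<longleftrightarrow>
    continuous_on ({0..1} \<times> UNIV) (\<lambda>(t, z). F t z) \<and>
    (\<forall>z. F 0 z = z) \<and>
    (\<forall>t\<in>{0..1}. F t 0 = 0 \<and>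
       (\<exists>G. homeomorphism UNIV UNIV (F t) G \<and> diffeomorphism (- {0}) (- {0}) (F t) G))"

definition isotopy_end :: "('a::euclidean_space \<Rightarrow> 'a) \<Rightarrow> bool"
  where "isotopy_end \<phi> \<longleftrightarrow> (\<exists>F. isotopy F \<and> F 1 = \<phi>)"

definition isotopic_function :: "('a::euclidean_space \<Rightarrow> 'b) \<Rightarrow> ('a \<Rightarrow> 'b) \<Rightarrow> bool"
  where "isotopic_function g q \<longleftrightarrow> (\<exists>\<phi>. isotopy_end \<phi> \<and> g = q \<circ> \<phi>)"

section \<open>Homogeneous polynomials and their foliations\<close>

definition multidegree :: "nat \<Rightarrow> ('n::finite \<Rightarrow> nat) set"
  where "multidegree k = {\<alpha>. (\<Sum>i\<in>UNIV. \<alpha> i) = k}"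

lemma finite_multidegree: "finite (multidegree k :: ('n::finite \<Rightarrow> nat) set)"
proof (rule finite_subset)
  show "multidegree k \<subseteq> PiE (UNIV :: 'n set) (\<lambda>_. {..k})"
    by (auto simp: multidegree_def PiE_def intro: member_le_sum)
qed (simp add: finite_PiE)

text \<open>The zero polynomial is included, for every \<open>k\<close>; all its points are critical.\<close>

definition homogeneous_polynomial :: "nat \<Rightarrow> (complex ^ 'n::finite \<Rightarrow> complex) \<Rightarrow> bool"
  where "homogeneous_polynomial k h \<longleftrightarrow>
    (\<exists>c. \<forall>z. h z = (\<Sum>\<alpha>\<in>multidegree k. c \<alpha> * (\<Prod>i\<in>UNIV. (z $ i) ^ \<alpha> i)))"

definition fermat :: "nat \<Rightarrow> complex ^ 'n::finite \<Rightarrow> complex"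
  where "fermat k z = (\<Sum>i\<in>UNIV. (z $ i) ^ k)"

definition quadQ :: "complex ^ 'n::finite \<Rightarrow> real"
  where "quadQ z = (\<Sum>i\<in>UNIV. (cmod (z $ i))\<^sup>2)"

text \<open>For a holomorphic function, the real derivative, which is used here, is the complex one.\<close>

definition critical_point :: "('a::real_normed_vector \<Rightarrow> 'b::real_normed_vector) \<Rightarrow> 'a \<Rightarrow> bool"
  where "critical_point f p \<longleftrightarrow> (f has_derivative (\<lambda>_. 0)) (at p)"

text \<open>A foliation is represented by its set of leaves.\<close>

definition leaves :: "(complex ^ 'n::finite \<Rightarrow> complex) \<Rightarrow> (complex ^ 'n) set set"
  where "leaves h = (\<Union>c. components {z. z \<noteq> 0 \<and> h z = c})"

definition isotopic_foliations :: "'a::euclidean_space set set \<Rightarrow> 'a set set \<Rightarrow> bool"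
  where "isotopic_foliations A B \<longleftrightarrow> (\<exists>\<phi>. isotopy_end \<phi> \<and> (\<lambda>L. \<phi> ` L) ` A = B)"

section \<open>Morse functions on submanifolds\<close>

text \<open>Slice chart of \<open>L\<close> centred at \<open>p\<close>, with inverse \<open>\<Psi>\<close>: it identifies \<open>L\<close> near \<open>p\<close> with a
  neighbourhood of \<open>0\<close> in the linear subspace \<open>V\<close>. Such a \<open>V\<close> takes the place of
  a Euclidean space whose dimension, that of \<open>L\<close>, would have to be a type.\<close>

definition slice_chart ::
    "'a::euclidean_space set \<Rightarrow> 'a \<Rightarrow> ('a \<Rightarrow> 'a) \<Rightarrow> ('a \<Rightarrow> 'a) \<Rightarrow> 'a set \<Rightarrow> bool"
  where "slice_chart L p \<Phi> \<Psi> V \<longleftrightarrow>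
    subspace V \<and>
    (\<exists>U W. diffeomorphism U W \<Phi> \<Psi> \<and> p \<in> U \<and> \<Phi> p = 0 \<and> \<Phi> ` (L \<inter> U) = V \<inter> W)"

definition embedded_submanifold :: "'a::euclidean_space set \<Rightarrow> bool"
  where "embedded_submanifold L \<longleftrightarrow> (\<forall>p\<in>L. \<exists>\<Phi> \<Psi> V. slice_chart L p \<Phi> \<Psi> V)"

text \<open>Critical points of the restriction of \<open>g\<close> to \<open>L\<close>, and their Hessians, are read off in
  the coordinates \<open>V\<close>: derivatives of \<open>g \<circ> \<Psi>\<close> at \<open>0\<close> are taken
  only in directions in \<open>V\<close>, so they depend only on \<open>g\<close> restricted to \<open>L\<close>.
  Vanishing of the first derivative does not depend on the slice chart and,
  at a critical point, neither does non-degeneracy of the Hessian.\<close>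

definition critical_in_chart ::
    "('a::euclidean_space \<Rightarrow> real) \<Rightarrow> ('a \<Rightarrow> 'a) \<Rightarrow> 'a set \<Rightarrow> bool"
  where "critical_in_chart g \<Psi> V \<longleftrightarrow> (\<forall>v\<in>V. frechet_derivative (g \<circ> \<Psi>) (at 0) v = 0)"

definition hessian :: "('a::euclidean_space \<Rightarrow> real) \<Rightarrow> 'a \<Rightarrow> 'a \<Rightarrow> 'a \<Rightarrow> real"
  where "hessian f x v w =
    frechet_derivative (\<lambda>y. frechet_derivative f (at y) w) (at x) v"

definition critical_point_on ::
    "'a::euclidean_space set \<Rightarrow> ('a \<Rightarrow> real) \<Rightarrow> 'a \<Rightarrow> bool"
  where "critical_point_on L g p \<longleftrightarrow>
    p \<in> L \<and> (\<exists>\<Phi> \<Psi> V. slice_chart L p \<Phi> \<Psi> V \<and> critical_in_chart g \<Psi> V)"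

definition nondegenerate_critical_point_on ::
    "'a::euclidean_space set \<Rightarrow> ('a \<Rightarrow> real) \<Rightarrow> 'a \<Rightarrow> bool"
  where "nondegenerate_critical_point_on L g p \<longleftrightarrow>
    p \<in> L \<and> (\<exists>\<Phi> \<Psi> V. slice_chart L p \<Phi> \<Psi> V \<and> critical_in_chart g \<Psi> V \<and>
      (\<forall>v\<in>V. (\<forall>w\<in>V. hessian (g \<circ> \<Psi>) 0 v w = 0) \<longrightarrow> v = 0))"

definition morse_function_on :: "'a::euclidean_space set \<Rightarrow> ('a \<Rightarrow> real) \<Rightarrow> bool"
  where "morse_function_on L g \<longleftrightarrow>
    embedded_submanifold L \<and>
    (\<exists>S. open S \<and> L \<subseteq> S \<and> smooth_on S g) \<and>
    (\<forall>p. critical_point_on L g p \<longrightarrow> nondegenerate_critical_point_on L g p)"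

definition carries_morse_structure ::
    "'a::euclidean_space set set \<Rightarrow> ('a \<Rightarrow> real) \<Rightarrow> bool"
  where "carries_morse_structure A g \<longleftrightarrow> (\<forall>L\<in>A. morse_function_on L g)"

end

theory Submission
  imports Defs "Jordan_Normal_Form.Char_Poly"
begin

text \<open>
  The polynomial \<open>h\<close> is joined to the Fermat polynomial by the pencil
  \<open>h\<^sub>t = (1 - t) h + t H\<^sub>k\<close>, with \<open>t\<close> complex. Only finitely many members have a critical point outside the
  origin. Indeed, let \<open>N = n (k - 2) + 1\<close>. Every monomial of degree \<open>N\<close> contains a factor \<open>z\<^sub>i\<^sup>k\<^sup>-\<^sup>1\<close>, which is up to
  the factor \<open>k\<close> a partial derivative of \<open>H\<^sub>k\<close>. Replacing this factor by \<open>\<partial>\<^sub>i h\<close> defines a linear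
  operator on the forms of degree \<open>N\<close>, and a critical point \<open>z \<noteq> 0\<close> of \<open>h\<^sub>t\<close> makes the vector of values of the monomials at \<open>z\<close> an
  eigenvector with eigenvalue \<open>- t k / (1 - t)\<close> (\<open>finite_singular_pencil\<close>). So the regular
  parameters form a connected set, which contains \<open>0\<close> and \<open>1\<close>, and it is enough to move
  \<open>h\<^sub>a\<close> to \<open>h\<^sub>b\<close> when \<open>a\<close> and \<open>b\<close> are near one regular parameter \<open>t\<^sub>0\<close>.

  This is done without integrating a vector field. Let \<open>v\<close> be the gradient of \<open>h\<close> at the parameter \<open>t\<^sub>0\<close>, divided
  by its squared norm, and let \<open>u (z)\<close> be the small root of \<open>h\<^sub>b (z + u v (z)) = h\<^sub>a (z)\<close>. The map
  \<open>\<phi> (z) = z + u (z) v (z)\<close> satisfies \<open>h\<^sub>b \<circ> \<phi> = h\<^sub>a\<close>. It is homogeneous of degree one, so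
  estimates on the unit sphere, where compactness applies, hold everywhere:
  \<open>\<phi>\<close> is the identity plus a contraction, hence a homeomorphism, and it is smooth with smooth
  inverse outside the origin by the implicit function theorem. Letting \<open>b\<close> run along a segment that starts at \<open>a\<close>
  gives an isotopy (\<open>local_isotopy\<close>), and composing finitely many of these gives
  \<open>\<phi>\<close> with \<open>H\<^sub>k \<circ> \<phi> = h\<close> (\<open>isotopic_to_fermat\<close>). Such a map carries fibres to fibres, and so leaves to leaves.

  The Morse function is \<open>Q \<circ> \<phi>\<close>. In the coordinates of slice charts its restriction to a leaf of \<open>h\<close> is the
  restriction of \<open>Q\<close> to a leaf of \<open>H\<^sub>k\<close> (\<open>morse_function_on_pullback\<close>), and there the critical points
  are found by Lagrange multipliers. At a critical point \<open>p\<close> a vector \<open>\<xi>\<close> in the kernel of the Hessian of the Lagrange function restricted to the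
  tangent space has \<open>\<xi>\<^sub>i = 0\<close> when \<open>p\<^sub>i = 0\<close>, because \<open>k > 2\<close>, and \<open>\<xi>\<^sub>i = x p\<^sub>i\<close> with the same \<open>x\<close> for the other \<open>i\<close>.
  Tangency to the fibre then gives \<open>x Q (p) = 0\<close>, so \<open>\<xi> = 0\<close> (\<open>fermat_critical_point_nondegenerate\<close>).
\<close>

text \<open>Throughout, \<open>$\<close>, \<open>\<bullet>\<close> and \<open>inv\<close> are the component, the inner product and the inverse function.\<close>

no_notation Matrix.vec_index (infixl "$" 100)
no_notation Matrix.scalar_prod (infix "\<bullet>" 70)
unbundle no m_inv_syntax

section \<open>Calculus of \<open>C\<^sup>k\<close> maps\<close>

lemma Ck_on_cong:
  assumes "open S" and "\<And>x. x \<in> S \<Longrightarrow> f x = g x" and "Ck_on k S f"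
  shows "Ck_on k S g"
  using assms(2,3)
proof (induction k arbitrary: f g)
  case 0
  then show ?case by (simp cong: continuous_on_cong)
next
  case (Suc k)
  have der: "(g has_derivative frechet_derivative f (at x)) (at x)" if "x \<in> S" for x
    using Suc.prems that \<open>open S\<close>
    by (intro has_derivative_transform_within_open[of f _ x UNIV S g])
       (auto simp: frechet_derivative_works)
  have "frechet_derivative f (at x) = frechet_derivative g (at x)" if "x \<in> S" for x
    using frechet_derivative_at[OF der[OF that]] .
  then have "Ck_on k S (\<lambda>x. frechet_derivative g (at x) v)" for v
    using Suc.IH[of "\<lambda>x. frechet_derivative f (at x) v"] Suc.prems(2) by simp
  then show ?case
    using der by (auto simp: differentiable_def)
qed

lemma Ck_on_has_derivative:
  "Ck_on (Suc k) S f \<Longrightarrow> x \<in> S \<Longrightarrow> (f has_derivative frechet_derivative f (at x)) (at x)"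
  by (simp add: frechet_derivative_works)

lemma Ck_on_SucI:
  assumes "open S" and der: "\<And>x. x \<in> S \<Longrightarrow> (f has_derivative f' x) (at x)"
    and "\<And>v. Ck_on k S (\<lambda>x. f' x v)"
  shows "Ck_on (Suc k) S f"
proof -
  have "Ck_on k S (\<lambda>x. frechet_derivative f (at x) v)" for v
    by (rule Ck_on_cong[OF \<open>open S\<close> _ assms(3)[of v]]) (simp add: frechet_derivative_at[OF der, symmetric])
  then show ?thesis using der by (auto simp: differentiable_def)
qed

lemma Ck_on_Suc_imp: "Ck_on (Suc k) S f \<Longrightarrow> Ck_on k S f"
proof (induction k arbitrary: f)
  case 0
  then show ?case
    by (auto intro!: continuous_at_imp_continuous_on differentiable_imp_continuous_within)
next
  case (Suc k)
  from Suc.prems have 1: "\<forall>x\<in>S. f differentiable at x"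
    and 2: "\<And>v. Ck_on (Suc k) S (\<lambda>x. frechet_derivative f (at x) v)" by auto
  show ?case using 1 Suc.IH[OF 2] by simp
qed

lemma Ck_on_subset: "Ck_on k S f \<Longrightarrow> T \<subseteq> S \<Longrightarrow> Ck_on k T f"
  by (induction k arbitrary: f) (auto intro: continuous_on_subset)

lemma Ck_on_local:
  assumes "\<And>x. x \<in> S \<Longrightarrow> \<exists>U. open U \<and> x \<in> U \<and> Ck_on k U f"
  shows "Ck_on k S f"
  using assms
proof (induction k arbitrary: f)
  case 0
  have "isCont f x" if "x \<in> S" for x
    using 0[OF that] by (auto simp: continuous_on_eq_continuous_at)
  then show ?case by (simp add: continuous_at_imp_continuous_on)
next
  case (Suc k)
  have "f differentiable at x" if "x \<in> S" for x
    using Suc.prems[OF that] by auto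
  moreover have "Ck_on k S (\<lambda>x. frechet_derivative f (at x) v)" for v
    using Suc.prems by (intro Suc.IH) fastforce
  ultimately show ?case by simp
qed

lemma Ck_on_const: "Ck_on k S (\<lambda>_. c)"
  by (induction k arbitrary: c) auto

lemma Ck_on_bounded_linear:
  assumes "bounded_linear L" and "open S" shows "Ck_on k S L"
proof (cases k)
  case 0
  then show ?thesis using assms by (simp add: bounded_linear.linear linear_continuous_on)
next
  case (Suc m)
  show ?thesis unfolding Suc
    by (rule Ck_on_SucI[where f' = "\<lambda>_. L"])
      (use assms in \<open>auto intro: bounded_linear_imp_has_derivative Ck_on_const\<close>)
qed

lemma Ck_on_add:
  assumes "open S" "Ck_on k S f" "Ck_on k S g"
  shows "Ck_on k S (\<lambda>x. f x + g x)"
  using assms(2,3)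
proof (induction k arbitrary: f g)
  case 0 then show ?case by (auto intro: continuous_intros)
next
  case (Suc k)
  show ?case
    by (rule Ck_on_SucI[OF \<open>open S\<close> has_derivative_add[OF Ck_on_has_derivative[OF Suc.prems(1)] Ck_on_has_derivative[OF Suc.prems(2)]]])
      (use Suc in \<open>auto intro: Suc.IH\<close>)
qed

lemma Ck_on_sum:
  assumes "open S" "\<And>i. i \<in> I \<Longrightarrow> Ck_on k S (f i)"
  shows "Ck_on k S (\<lambda>x. \<Sum>i\<in>I. f i x)"
  using assms(2)
  by (induction I rule: infinite_finite_induct) (auto intro: Ck_on_add \<open>open S\<close> Ck_on_const)

text \<open>The one product rule behind all products below: scalar multiplication, real and complex
  products, and complex scalar multiplication of vectors.\<close>

lemma Ck_on_bilinear:
  assumes "bounded_bilinear B" and "open S" "Ck_on k S f" "Ck_on k S g"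
  shows "Ck_on k S (\<lambda>x. B (f x) (g x))"
  using assms(3,4)
proof (induction k arbitrary: f g)
  case 0 then show ?case by (auto intro: bounded_bilinear.continuous_on[OF assms(1)])
next
  case (Suc k)
  show ?case
    by (rule Ck_on_SucI[OF \<open>open S\<close> bounded_bilinear.FDERIV[OF assms(1)
          Ck_on_has_derivative[OF Suc.prems(1)] Ck_on_has_derivative[OF Suc.prems(2)]]])
      (use Suc in \<open>auto intro!: Ck_on_add Suc.IH assms(2) intro: Ck_on_Suc_imp\<close>)
qed

lemmas Ck_on_scaleR = Ck_on_bilinear[OF bounded_bilinear_scaleR]
lemmas Ck_on_mult = Ck_on_bilinear[OF bounded_bilinear_mult]
lemmas Ck_on_inner = Ck_on_bilinear[OF bounded_bilinear_inner]

lemma linear_sum_Basis: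
  fixes L :: "'a::euclidean_space \<Rightarrow> 'b::real_vector"
  assumes "linear L" shows "L x = (\<Sum>b\<in>Basis. (x \<bullet> b) *\<^sub>R L b)"
proof -
  have "L x = L (\<Sum>b\<in>Basis. (x \<bullet> b) *\<^sub>R b)" by (simp add: euclidean_representation)
  also have "\<dots> = (\<Sum>b\<in>Basis. (x \<bullet> b) *\<^sub>R L b)"
    by (simp add: linear_sum[OF assms] linear_cmul[OF assms])
  finally show ?thesis .
qed

lemma linear_frechet: "f differentiable at x \<Longrightarrow> linear (frechet_derivative f (at x))"
  by (metis bounded_linear.linear frechet_derivative_works has_derivative_bounded_linear)

text \<open>Expanding the inner derivative in a basis turns the chain rule into a sum of products,
  so that induction on the order of differentiability applies to each factor.\<close>

lemma Ck_on_compose: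
  fixes f :: "'a::euclidean_space \<Rightarrow> 'b::euclidean_space" and h :: "'b \<Rightarrow> 'c::real_normed_vector"
  assumes "open S" "open T" "f ` S \<subseteq> T" "Ck_on k S f" "Ck_on k T h"
  shows "Ck_on k S (\<lambda>x. h (f x))"
  using assms(4,5)
proof (induction k arbitrary: h)
  case 0 then show ?case using assms(3) by (auto intro: continuous_on_compose2)
next
  case (Suc k)
  let ?f' = "\<lambda>x. frechet_derivative f (at x)" and ?h' = "\<lambda>y. frechet_derivative h (at y)"
  have lin: "linear (?h' (f x))" if "x \<in> S" for x
    using Suc.prems assms(3) that by (intro linear_frechet) auto
  have bl: "bounded_linear (\<lambda>x::'b. x \<bullet> b)" for b by (rule bounded_linear_inner_left)
  show ?case
  proof (rule Ck_on_SucI[OF \<open>open S\<close>])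
    show "((\<lambda>x. h (f x)) has_derivative (\<lambda>v. ?h' (f x) (?f' x v))) (at x)" if "x \<in> S" for x
      by (rule has_derivative_compose[OF Ck_on_has_derivative[OF Suc.prems(1) that]
            Ck_on_has_derivative[OF Suc.prems(2)]]) (use that assms(3) in auto)
    have "Ck_on k S (\<lambda>x. \<Sum>b\<in>Basis. (?f' x v \<bullet> b) *\<^sub>R ?h' (f x) b)" for v
      using Suc.prems assms(1)
      by (intro Ck_on_sum Ck_on_scaleR Ck_on_inner Ck_on_const Suc.IH Ck_on_Suc_imp[OF Suc.prems(1)]) auto
    then show "Ck_on k S (\<lambda>x. ?h' (f x) (?f' x v))" for v
      by (rule Ck_on_cong[OF \<open>open S\<close>, rotated]) (use linear_sum_Basis[OF lin] in simp)
  qed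
qed

lemma Ck_on_linear_compose:
  fixes f :: "'a::euclidean_space \<Rightarrow> 'b::euclidean_space"
  assumes "bounded_linear L" "open S" "Ck_on k S f"
  shows "Ck_on k S (\<lambda>x. L (f x))"
  using Ck_on_compose[OF assms(2) open_UNIV _ assms(3) Ck_on_bounded_linear[OF assms(1) open_UNIV]] by simp

lemma Ck_on_inverse:
  fixes f :: "'a::euclidean_space \<Rightarrow> real"
  assumes "open S" "\<And>x. x \<in> S \<Longrightarrow> f x \<noteq> 0" "Ck_on k S f"
  shows "Ck_on k S (\<lambda>x. inverse (f x))"
  using assms(3)
proof (induction k)
  case 0 then show ?case using assms(2) by (auto intro: continuous_on_inverse)
next
  case (Suc k)
  have "Ck_on k S (\<lambda>x. - 1 * (inverse (f x) * frechet_derivative f (at x) v * inverse (f x)))" for v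
    using Suc assms(1) Ck_on_Suc_imp[OF Suc.prems] by (intro Ck_on_mult Ck_on_const) auto
  then show ?case
    by (intro Ck_on_SucI[OF \<open>open S\<close> Deriv.has_derivative_inverse[OF assms(2) Ck_on_has_derivative[OF Suc.prems]]]) auto
qed

section \<open>Smooth maps\<close>

lemma smooth_onI: "(\<And>k. Ck_on k S f) \<Longrightarrow> smooth_on S f" by (simp add: smooth_on_def)
lemma smooth_onD: "smooth_on S f \<Longrightarrow> Ck_on k S f" by (simp add: smooth_on_def)

lemma smooth_on_cong: "open S \<Longrightarrow> (\<And>x. x \<in> S \<Longrightarrow> f x = g x) \<Longrightarrow> smooth_on S f \<Longrightarrow> smooth_on S g"
  by (metis smooth_on_def Ck_on_cong)
lemma smooth_on_subset: "smooth_on S f \<Longrightarrow> T \<subseteq> S \<Longrightarrow> smooth_on T f"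
  by (metis smooth_on_def Ck_on_subset)
lemma smooth_on_local:
  "(\<And>x. x \<in> S \<Longrightarrow> \<exists>U. open U \<and> x \<in> U \<and> smooth_on U f) \<Longrightarrow> smooth_on S f"
  unfolding smooth_on_def by (metis Ck_on_local)
lemma smooth_on_const: "smooth_on S (\<lambda>_. c)" by (simp add: smooth_on_def Ck_on_const)
lemma smooth_on_bounded_linear: "bounded_linear L \<Longrightarrow> open S \<Longrightarrow> smooth_on S L"
  by (simp add: smooth_on_def Ck_on_bounded_linear)
lemma smooth_on_add: "open S \<Longrightarrow> smooth_on S f \<Longrightarrow> smooth_on S g \<Longrightarrow> smooth_on S (\<lambda>x. f x + g x)"
  by (simp add: smooth_on_def Ck_on_add)
lemma smooth_on_bilinear:
  "bounded_bilinear B \<Longrightarrow> open S \<Longrightarrow> smooth_on S f \<Longrightarrow> smooth_on S g \<Longrightarrow> smooth_on S (\<lambda>x. B (f x) (g x))"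
  by (simp add: smooth_on_def Ck_on_bilinear)
lemmas smooth_on_scaleR = smooth_on_bilinear[OF bounded_bilinear_scaleR]
lemmas smooth_on_mult = smooth_on_bilinear[OF bounded_bilinear_mult]
lemmas smooth_on_inner = smooth_on_bilinear[OF bounded_bilinear_inner]
lemma smooth_on_sum: "open S \<Longrightarrow> (\<And>i. i \<in> I \<Longrightarrow> smooth_on S (f i)) \<Longrightarrow> smooth_on S (\<lambda>x. \<Sum>i\<in>I. f i x)"
  by (simp add: smooth_on_def Ck_on_sum)
lemma smooth_on_compose:
  fixes f :: "'a::euclidean_space \<Rightarrow> 'b::euclidean_space" and h :: "'b \<Rightarrow> 'c::real_normed_vector"
  shows "open S \<Longrightarrow> open T \<Longrightarrow> f ` S \<subseteq> T \<Longrightarrow> smooth_on S f \<Longrightarrow> smooth_on T h \<Longrightarrow> smooth_on S (\<lambda>x. h (f x))"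
  unfolding smooth_on_def by (metis Ck_on_compose)
lemma smooth_on_linear_compose:
  fixes f :: "'a::euclidean_space \<Rightarrow> 'b::euclidean_space"
  shows "bounded_linear L \<Longrightarrow> open S \<Longrightarrow> smooth_on S f \<Longrightarrow> smooth_on S (\<lambda>x. L (f x))"
  by (simp add: smooth_on_def Ck_on_linear_compose)
lemma smooth_on_inverse:
  fixes f :: "'a::euclidean_space \<Rightarrow> real"
  shows "open S \<Longrightarrow> (\<And>x. x \<in> S \<Longrightarrow> f x \<noteq> 0) \<Longrightarrow> smooth_on S f \<Longrightarrow> smooth_on S (\<lambda>x. inverse (f x))"
  by (simp add: smooth_on_def Ck_on_inverse)
lemma smooth_on_minus:
  assumes "open S" "smooth_on S f" "smooth_on S g"
  shows "smooth_on S (\<lambda>x. f x - g x)"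
  using smooth_on_add[OF assms(1,2) smooth_on_scaleR[OF assms(1) smooth_on_const[of _ "-1"] assms(3)]] by simp
lemma smooth_on_prod:
  fixes f :: "'i \<Rightarrow> 'a::euclidean_space \<Rightarrow> 'b::{real_normed_algebra,comm_ring_1}"
  shows "open S \<Longrightarrow> (\<And>i. i \<in> I \<Longrightarrow> smooth_on S (f i)) \<Longrightarrow> smooth_on S (\<lambda>x. \<Prod>i\<in>I. f i x)"
  by (induction I rule: infinite_finite_induct) (auto intro: smooth_on_mult smooth_on_const)
lemma smooth_on_power:
  fixes f :: "'a::euclidean_space \<Rightarrow> 'b::{real_normed_algebra,comm_ring_1}"
  shows "open S \<Longrightarrow> smooth_on S f \<Longrightarrow> smooth_on S (\<lambda>x. f x ^ m)"
  by (induction m) (auto intro: smooth_on_mult smooth_on_const)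

lemma smooth_on_has_derivative:
  "smooth_on S f \<Longrightarrow> x \<in> S \<Longrightarrow> (f has_derivative frechet_derivative f (at x)) (at x)"
  by (meson Ck_on_has_derivative smooth_on_def)
lemma smooth_on_differentiable: "smooth_on S f \<Longrightarrow> x \<in> S \<Longrightarrow> f differentiable at x"
  using smooth_on_has_derivative by (auto simp: differentiable_def)
lemma smooth_on_frechet: "smooth_on S f \<Longrightarrow> smooth_on S (\<lambda>x. frechet_derivative f (at x) v)"
  by (metis Ck_on.simps(2) smooth_on_def)
lemma smooth_on_continuous: "smooth_on S f \<Longrightarrow> continuous_on S f"
  by (metis Ck_on.simps(1) smooth_on_def)

section \<open>Inverse operators, inverse maps and implicit functions\<close>

text \<open>Since \<open>f\<close> vanishes at \<open>x\<close>, mere continuity of \<open>g\<close> suffices for the product rule. Below, \<open>g\<close> is built from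
  an inverse operator whose differentiability is yet to be shown.\<close>

lemma has_derivative_mult_vanishing:
  fixes f :: "'a::real_normed_vector \<Rightarrow> real" and g :: "'a \<Rightarrow> 'b::real_normed_vector"
  assumes f: "(f has_derivative f') (at x)" and "f x = 0" and g: "isCont g x"
  shows "((\<lambda>y. f y *\<^sub>R g y) has_derivative (\<lambda>v. f' v *\<^sub>R g x)) (at x)"
proof -
  interpret bounded_linear f' using f by (rule has_derivative_bounded_linear)
  obtain K where K: "\<And>v. norm (f' v) \<le> norm v * K" using bounded by blast
  have lim: "((\<lambda>y. (f y - f x - f' (y - x)) /\<^sub>R norm (y - x)) \<longlongrightarrow> 0) (at x)"
    using f by (simp add: has_derivative_at_within)
  have 1: "((\<lambda>y. ((f y - f x - f' (y - x)) /\<^sub>R norm (y - x)) *\<^sub>R g y) \<longlongrightarrow> 0 *\<^sub>R g x) (at x)"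
    by (rule tendsto_scaleR[OF lim]) (use g in \<open>simp add: isCont_def\<close>)
  have "((\<lambda>y. K * norm (g y - g x)) \<longlongrightarrow> K * norm (g x - g x)) (at x)"
    by (intro tendsto_mult tendsto_const tendsto_norm tendsto_diff g[unfolded isCont_def])
  then have lim0: "((\<lambda>y. K * norm (g y - g x)) \<longlongrightarrow> 0) (at x)" by simp
  have 2: "((\<lambda>y. (f' (y - x) / norm (y - x)) *\<^sub>R (g y - g x)) \<longlongrightarrow> 0) (at x)"
  proof (rule Lim_null_comparison[where g = "\<lambda>y. K * norm (g y - g x)"])
    have "norm ((f' (y - x) / norm (y - x)) *\<^sub>R (g y - g x)) \<le> K * norm (g y - g x)" for y
    proof (cases "y = x")
      case False
      then have "\<bar>f' (y - x) / norm (y - x)\<bar> \<le> K"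
        using K[of "y - x"] by (simp add: abs_divide pos_divide_le_eq mult.commute)
      then show ?thesis by (metis norm_scaleR norm_ge_zero mult_right_mono)
    qed simp
    then show "\<forall>\<^sub>F y in at x. norm ((f' (y - x) / norm (y - x)) *\<^sub>R (g y - g x)) \<le> K * norm (g y - g x)"
      by (intro always_eventually allI)
  qed (rule lim0)
  have eq: "((f y *\<^sub>R g y) - (f x *\<^sub>R g x) - (f' (y - x) *\<^sub>R g x)) /\<^sub>R norm (y - x)
      = ((f y - f x - f' (y - x)) /\<^sub>R norm (y - x)) *\<^sub>R g y + (f' (y - x) / norm (y - x)) *\<^sub>R (g y - g x)" for y
    using assms(2) by (simp add: algebra_simps divide_inverse)
  have "bounded_linear (\<lambda>v. f' v *\<^sub>R g x)"
    by (intro bounded_linear_scaleR_const bounded_linear_axioms)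
  then show ?thesis unfolding has_derivative_at_within
    unfolding eq using tendsto_add[OF 1 2] by simp
qed

lemma linear_inv_of_inj:
  fixes A :: "'b::euclidean_space \<Rightarrow> 'b"
  assumes "linear A" "inj A"
  shows "linear (inv A)" "A (inv A v) = v" "inv A (A w) = w"
proof -
  have "surj A" by (rule linear_injective_imp_surjective[OF assms]) simp
  then show s: "A (inv A v) = v" for v by (rule surj_f_inv_f)
  show i: "inv A (A w) = w" for w using \<open>inj A\<close> by (rule inv_f_f)
  show "linear (inv A)"
  proof (rule linearI)
    show "inv A (x + y) = inv A x + inv A y" for x y
      using i[of "inv A x + inv A y"] by (simp add: linear_add[OF assms(1)] s)
    show "inv A (r *\<^sub>R x) = r *\<^sub>R inv A x" for r x
      using i[of "r *\<^sub>R inv A x"] by (simp add: linear_cmul[OF assms(1)] s)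
  qed
qed

lemma norm_linear_le_Basis:
  fixes L :: "'a::euclidean_space \<Rightarrow> 'b::real_normed_vector"
  assumes "linear L" shows "norm (L w) \<le> norm w * (\<Sum>b\<in>Basis. norm (L b))"
proof -
  have "norm (L w) \<le> (\<Sum>b\<in>Basis. norm ((w \<bullet> b) *\<^sub>R L b))"
    by (subst linear_sum_Basis[OF assms]) (rule norm_sum)
  also have "\<dots> \<le> (\<Sum>b\<in>Basis. norm w * norm (L b))"
    by (intro sum_mono) (auto intro: mult_right_mono Basis_le_norm)
  finally show ?thesis by (simp add: sum_distrib_left)
qed

text \<open>A lower bound \<open>c |w| \<le> |A\<^sub>z w|\<close> persists with \<open>c / 2\<close> for \<open>y\<close> near \<open>z\<close>, because \<open>A\<^sub>y - A\<^sub>z\<close> is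
  controlled by its values on a basis. Applied to the difference of the two inverses at \<open>v\<close>, it reduces the
  claim to the convergence of \<open>A\<^sub>y w\<close> for one fixed \<open>w\<close>.\<close>

lemma continuous_on_inverse_operator:
  fixes A :: "'a::euclidean_space \<Rightarrow> 'b::euclidean_space \<Rightarrow> 'b"
  assumes "open S" and lin: "\<And>y. y \<in> S \<Longrightarrow> linear (A y)" and inj: "\<And>y. y \<in> S \<Longrightarrow> inj (A y)"
    and cont: "\<And>w. continuous_on S (\<lambda>y. A y w)"
  shows "continuous_on S (\<lambda>y. inv (A y) v)"
proof (rule continuous_at_imp_continuous_on, rule ballI)
  fix y0 assume y0: "y0 \<in> S"
  obtain c where c: "c > 0" "\<And>w. c * norm w \<le> norm (A y0 w)"
    using linear_inj_bounded_below_pos[OF lin[OF y0] inj[OF y0]] by blast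
  have At: "((\<lambda>y. A y w) \<longlongrightarrow> A y0 w) (at y0)" for w
    using cont y0 \<open>open S\<close> by (metis continuous_on_eq_continuous_at isCont_def)
  let ?w = "inv (A y0) v"
  have "((\<lambda>y. \<Sum>b\<in>Basis. norm (A y b - A y0 b)) \<longlongrightarrow> (\<Sum>b\<in>Basis. norm (A y0 b - A y0 b))) (at y0)"
    by (intro tendsto_sum tendsto_norm tendsto_diff At tendsto_const)
  then have small: "\<forall>\<^sub>F y in at y0. (\<Sum>b\<in>Basis. norm (A y b - A y0 b)) < c / 2"
    by (rule order_tendstoD) (use c in simp)
  have inS: "\<forall>\<^sub>F y in at y0. y \<in> S" using y0 \<open>open S\<close> by (simp add: eventually_at_in_open')
  have bound: "\<forall>\<^sub>F y in at y0. norm (inv (A y) v - ?w) \<le> (2 / c) * norm (A y0 ?w - A y ?w)"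
    using small inS
  proof eventually_elim
    case (elim y)
    let ?d = "inv (A y) v - ?w"
    have "norm ((\<lambda>w. A y w - A y0 w) ?d) \<le> norm ?d * (\<Sum>b\<in>Basis. norm (A y b - A y0 b))"
      by (rule norm_linear_le_Basis) (intro linear_compose_sub lin elim y0)
    also have "\<dots> \<le> norm ?d * (c / 2)" using elim by (intro mult_left_mono) auto
    finally have "norm (A y ?d - A y0 ?d) \<le> norm ?d * (c / 2)" .
    moreover have "norm (A y0 ?d) \<le> norm (A y ?d) + norm (A y ?d - A y0 ?d)"
      by (metis add.commute norm_minus_commute norm_triangle_sub)
    ultimately have "(c / 2) * norm ?d \<le> norm (A y ?d)" using c(2)[of ?d] by (simp add: algebra_simps)
    also have "A y ?d = A y0 ?w - A y ?w"
      using linear_inv_of_inj[OF lin inj] elim y0 by (simp add: linear_diff[OF lin])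
    finally show ?case using c by (simp add: field_simps)
  qed
  have "((\<lambda>y. (2 / c) * norm (A y0 ?w - A y ?w)) \<longlongrightarrow> (2 / c) * norm (A y0 ?w - A y0 ?w)) (at y0)"
    by (intro tendsto_mult tendsto_norm tendsto_diff At tendsto_const)
  then have "((\<lambda>y. (2 / c) * norm (A y0 ?w - A y ?w)) \<longlongrightarrow> 0) (at y0)" by simp
  from Lim_null_comparison[OF bound this] show "isCont (\<lambda>y. inv (A y) v) y0"
    by (simp add: isCont_def LIM_zero_iff)
qed

lemma Ck_on_continuous: "Ck_on k S f \<Longrightarrow> continuous_on S f"
proof (induction k)
  case 0 then show ?case by simp
next
  case (Suc k)
  show ?case by (rule Suc.IH[OF Ck_on_Suc_imp[OF Suc.prems]])
qed

text \<open>Writing \<open>B = A\<^sup>-\<^sup>1\<close>, the identity \<open>B\<^sub>y v = w - B\<^sub>y (A\<^sub>y w - v)\<close> with \<open>w = B\<^sub>z v\<close> exhibits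
  \<open>B\<^sub>y v\<close> near \<open>z\<close> as an affine function of products of a differentiable factor that vanishes at \<open>z\<close> and a
  continuous one. Hence \<open>B\<close> is differentiable, and its derivative \<open>- B A' B\<close> is one order less
  regular than \<open>A\<close>.\<close>

lemma Ck_on_inverse_operator:
  fixes A :: "'a::euclidean_space \<Rightarrow> 'b::euclidean_space \<Rightarrow> 'b"
  assumes "open S" and lin: "\<And>y. y \<in> S \<Longrightarrow> linear (A y)" and inj: "\<And>y. y \<in> S \<Longrightarrow> inj (A y)"
    and "\<And>w. Ck_on k S (\<lambda>y. A y w)"
  shows "Ck_on k S (\<lambda>y. inv (A y) v)"
  using assms(4)
proof (induction k arbitrary: v)
  case 0 then show ?case using continuous_on_inverse_operator[OF assms(1-3)] by simp
next
  case (Suc k)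
  define A' where "A' w y = frechet_derivative (\<lambda>y. A y w) (at y)" for w y
  note inv = linear_inv_of_inj[OF lin inj]
  have A'[derivative_intros]: "((\<lambda>y. A y w) has_derivative A' w y) (at y)" if "y \<in> S" for y w
    unfolding A'_def by (rule Ck_on_has_derivative[OF Suc.prems that])
  have ck: "Ck_on k S (\<lambda>y. A y w)" for w by (rule Ck_on_Suc_imp[OF Suc.prems])
  have ckB: "Ck_on k S (\<lambda>y. inv (A y) w)" for w by (rule Suc.IH[OF ck])
  have contB: "isCont (\<lambda>y. inv (A y) w) z" if "z \<in> S" for w z
    using continuous_on_inverse_operator[OF assms(1-3) Ck_on_continuous[OF ck]] that \<open>open S\<close>
    by (simp add: continuous_on_eq_continuous_at)
  have der: "((\<lambda>y. inv (A y) v) has_derivative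
      (\<lambda>u. - (\<Sum>c\<in>Basis. ((\<Sum>b\<in>Basis. (inv (A z) v \<bullet> b) *\<^sub>R A' b z u) \<bullet> c) *\<^sub>R inv (A z) c))) (at z)"
    if z: "z \<in> S" for z
  proof -
    let ?w = "inv (A z) v"
    have AS: "A y ?w = (\<Sum>b\<in>Basis. (?w \<bullet> b) *\<^sub>R A y b)" if "y \<in> S" for y
      by (rule linear_sum_Basis[OF lin[OF that]])
    have 0: "(\<Sum>b\<in>Basis. (?w \<bullet> b) *\<^sub>R A z b) = v"
      using AS[OF z] inv(2)[OF z z, of v] by simp
    have p: "((\<lambda>y. (((\<Sum>b\<in>Basis. (?w \<bullet> b) *\<^sub>R A y b) - v) \<bullet> c) *\<^sub>R inv (A y) c) has_derivative
        (\<lambda>u. ((\<Sum>b\<in>Basis. (?w \<bullet> b) *\<^sub>R A' b z u) \<bullet> c) *\<^sub>R inv (A z) c)) (at z)" for c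
    proof (rule has_derivative_mult_vanishing[OF _ _ contB[OF z]])
      have "((\<lambda>y. ((\<Sum>b\<in>Basis. (?w \<bullet> b) *\<^sub>R A y b) - v)) has_derivative
          (\<lambda>u. (\<Sum>b\<in>Basis. (?w \<bullet> b) *\<^sub>R A' b z u) - 0)) (at z)"
        by (intro has_derivative_diff has_derivative_sum has_derivative_scaleR_right A'[OF z] has_derivative_const)
      then show "((\<lambda>y. ((\<Sum>b\<in>Basis. (?w \<bullet> b) *\<^sub>R A y b) - v) \<bullet> c) has_derivative
          (\<lambda>u. (\<Sum>b\<in>Basis. (?w \<bullet> b) *\<^sub>R A' b z u) \<bullet> c)) (at z)"
        using bounded_linear.has_derivative[OF bounded_linear_inner_left] by fastforce
    qed (simp add: 0)
    have "((\<lambda>y. ?w - (\<Sum>c\<in>Basis. (((\<Sum>b\<in>Basis. (?w \<bullet> b) *\<^sub>R A y b) - v) \<bullet> c) *\<^sub>R inv (A y) c)) has_derivative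
        (\<lambda>u. 0 - (\<Sum>c\<in>Basis. ((\<Sum>b\<in>Basis. (?w \<bullet> b) *\<^sub>R A' b z u) \<bullet> c) *\<^sub>R inv (A z) c))) (at z)"
      by (intro has_derivative_diff has_derivative_sum p has_derivative_const)
    then have d: "((\<lambda>y. ?w - (\<Sum>c\<in>Basis. (((\<Sum>b\<in>Basis. (?w \<bullet> b) *\<^sub>R A y b) - v) \<bullet> c) *\<^sub>R inv (A y) c)) has_derivative
        (\<lambda>u. - (\<Sum>c\<in>Basis. ((\<Sum>b\<in>Basis. (?w \<bullet> b) *\<^sub>R A' b z u) \<bullet> c) *\<^sub>R inv (A z) c))) (at z)"
      by simp
    show ?thesis
    proof (rule has_derivative_transform_within_open[OF d \<open>open S\<close> z])
      fix y assume y: "y \<in> S"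
      have "(\<Sum>c\<in>Basis. (((\<Sum>b\<in>Basis. (?w \<bullet> b) *\<^sub>R A y b) - v) \<bullet> c) *\<^sub>R inv (A y) c) = inv (A y) (A y ?w - v)"
        unfolding AS[OF y, symmetric] by (rule linear_sum_Basis[symmetric]) (rule inv(1)[OF y y])
      also have "\<dots> = ?w - inv (A y) v" using inv[OF y y] by (simp add: linear_diff)
      finally show "?w - (\<Sum>c\<in>Basis. (((\<Sum>b\<in>Basis. (?w \<bullet> b) *\<^sub>R A y b) - v) \<bullet> c) *\<^sub>R inv (A y) c) = inv (A y) v"
        by simp
    qed
  qed
  have "Ck_on k S (\<lambda>z. (-1) *\<^sub>R (\<Sum>c\<in>Basis. ((\<Sum>b\<in>Basis. (inv (A z) v \<bullet> b) *\<^sub>R A' b z u) \<bullet> c) *\<^sub>R inv (A z) c))" for u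
    using Suc.prems unfolding A'_def
    by (intro Ck_on_sum Ck_on_scaleR Ck_on_inner Ck_on_const \<open>open S\<close> ckB) auto
  then show ?case
    by (intro Ck_on_SucI[OF \<open>open S\<close> der]) auto
qed

text \<open>The derivative of \<open>g\<close> at \<open>y\<close> is the inverse of the derivative of \<open>f\<close> at \<open>g y\<close>, hence as
  regular as \<open>g\<close> itself; each order of differentiability of \<open>g\<close> yields the next one.\<close>

lemma smooth_on_inverse_map:
  fixes f g :: "'a::euclidean_space \<Rightarrow> 'a"
  assumes "open S" "open T" and f: "smooth_on S f" and g: "continuous_on T g" "g ` T \<subseteq> S"
    and fg: "\<And>y. y \<in> T \<Longrightarrow> f (g y) = y"
    and inj: "\<And>x. x \<in> S \<Longrightarrow> inj (frechet_derivative f (at x))"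
  shows "smooth_on T g"
proof (rule smooth_onI)
  let ?A = "\<lambda>y. frechet_derivative f (at (g y))"
  have lin: "linear (?A y)" and inj': "inj (?A y)" if "y \<in> T" for y
    using that f g(2) inj by (auto intro!: linear_frechet smooth_on_differentiable)
  have der: "(g has_derivative inv (?A y)) (at y)" if y: "y \<in> T" for y
  proof (rule has_derivative_inverse_basic)
    show "(f has_derivative ?A y) (at (g y))" using f g(2) y by (auto intro: smooth_on_has_derivative)
    show "bounded_linear (inv (?A y))"
      using linear_inv_of_inj(1)[OF lin inj'] y by (simp add: linear_conv_bounded_linear)
    show "inv (?A y) \<circ> ?A y = id" using linear_inv_of_inj(3)[OF lin inj'] y by auto
    show "continuous (at y) g" using g(1) y \<open>open T\<close> by (simp add: continuous_on_eq_continuous_at)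
    show "open T" "y \<in> T" by fact+
  qed (simp add: fg)
  show "Ck_on k T g" for k
  proof (induction k)
    case 0 show ?case using g by simp
  next
    case (Suc k)
    have "Ck_on k T (\<lambda>y. ?A y w)" for w
      by (rule Ck_on_compose[OF \<open>open T\<close> \<open>open S\<close> g(2) Suc smooth_onD[OF smooth_on_frechet[OF f]]])
    then show ?case
      by (intro Ck_on_SucI[OF \<open>open T\<close> der] Ck_on_inverse_operator \<open>open T\<close> lin inj')
  qed
qed

text \<open>The \<open>C\<^sup>1\<close> inverse function theorem provides \<open>U\<close>, \<open>V\<close> and \<open>g\<close>, with the derivative
  of \<open>f\<close> injective on all of \<open>U\<close>, so that the preceding lemma applies there.\<close>

lemma smooth_inverse_function:
  fixes f :: "'a::euclidean_space \<Rightarrow> 'a"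
  assumes "open S" and f: "smooth_on S f" and "x0 \<in> S" and inj: "inj (frechet_derivative f (at x0))"
  obtains U V g where "x0 \<in> U" "U \<subseteq> S" "diffeomorphism U V f g"
proof -
  define f' where "f' x = Blinfun (frechet_derivative f (at x))" for x
  have f': "blinfun_apply (f' x) = frechet_derivative f (at x)" if "x \<in> S" for x
    unfolding f'_def
    by (rule bounded_linear_Blinfun_apply) (rule has_derivative_bounded_linear[OF smooth_on_has_derivative[OF f that]])
  have lin0: "linear (frechet_derivative f (at x0))"
    using f \<open>x0 \<in> S\<close> by (intro linear_frechet smooth_on_differentiable)
  note inv0 = linear_inv_of_inj[OF lin0 inj]
  define B where "B = Blinfun (inv (frechet_derivative f (at x0)))"
  have B: "blinfun_apply B = inv (frechet_derivative f (at x0))"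
    unfolding B_def by (rule bounded_linear_Blinfun_apply) (use inv0(1) in \<open>simp add: linear_conv_bounded_linear\<close>)
  obtain U V g g' where *: "open U" "U \<subseteq> S" "x0 \<in> U" "open V" "f x0 \<in> V" "homeomorphism U V f g"
    "\<And>y. y \<in> V \<Longrightarrow> bij (blinfun_apply (f'(g y)))"
  proof (rule inverse_function_theorem[of S f f' x0 B])
    show "(f has_derivative blinfun_apply (f' x)) (at x)" if "x \<in> S" for x
      using smooth_on_has_derivative[OF f that] f'[OF that] by simp
    show "continuous_on S f'"
    proof (rule continuous_on_blinfun_componentwise)
      show "continuous_on S (\<lambda>x. blinfun_apply (f' x) i)" for i
        using smooth_on_continuous[OF smooth_on_frechet[OF f, of i]] f' by (simp cong: continuous_on_cong)
    qed
    show "B o\<^sub>L f' x0 = id_blinfun"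
      using inv0(3) by (intro blinfun_eqI) (simp add: B f'[OF \<open>x0 \<in> S\<close>])
  qed (use assms in auto)
  have injU: "inj (frechet_derivative f (at x))" if "x \<in> U" for x
  proof -
    have "f x \<in> V" "g (f x) = x" using *(6) that by (auto simp: homeomorphism_def)
    then show ?thesis using *(7)[of "f x"] f'[of x] *(2) that by (auto simp: bij_def)
  qed
  have "smooth_on V g"
    by (rule smooth_on_inverse_map[OF *(1,4) smooth_on_subset[OF f *(2)]])
      (use *(6) injU in \<open>auto simp: homeomorphism_def\<close>)
  then have "diffeomorphism U V f g"
    unfolding diffeomorphism_def using * smooth_on_subset[OF f *(2)] by auto
  then show thesis using that[of U V g] * by simp
qed

lemma smooth_on_Pair:
  fixes f :: "'a::euclidean_space \<Rightarrow> 'b::euclidean_space" and g :: "'a \<Rightarrow> 'c::euclidean_space"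
  assumes "open S" "smooth_on S f" "smooth_on S g"
  shows "smooth_on S (\<lambda>x. (f x, g x))"
proof -
  have "smooth_on S (\<lambda>x. (f x, 0::'c) + (0::'b, g x))"
    by (intro smooth_on_add smooth_on_linear_compose[of "\<lambda>y. (y, 0)"] smooth_on_linear_compose[of "\<lambda>y. (0, y)"]
        bounded_linear_Pair bounded_linear_ident bounded_linear_zero assms)
  then show ?thesis by simp
qed

text \<open>Inverting \<open>(p, w) \<mapsto> (p, G (p, w))\<close> locally gives the smoothness of a continuous implicit
  function. Its existence is left to the application, where it is global.\<close>

lemma smooth_on_implicit:
  fixes G :: "'a::euclidean_space \<times> 'b::euclidean_space \<Rightarrow> 'b"
  assumes "open D" and G: "smooth_on D G" and "open Z" and u: "continuous_on Z u"
    and uD: "\<And>p. p \<in> Z \<Longrightarrow> (p, u p) \<in> D" and Gu: "\<And>p. p \<in> Z \<Longrightarrow> G (p, u p) = 0"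
    and inj: "\<And>p. p \<in> Z \<Longrightarrow> inj (\<lambda>w. frechet_derivative G (at (p, u p)) (0, w))"
  shows "smooth_on Z u"
proof (rule smooth_on_local)
  fix p0 assume p0: "p0 \<in> Z"
  let ?X = "\<lambda>x. (fst x, G x)" and ?G' = "frechet_derivative G (at (p0, u p0))"
  have X: "smooth_on D ?X"
    by (intro smooth_on_Pair G smooth_on_bounded_linear bounded_linear_fst \<open>open D\<close>)
  have G': "(G has_derivative ?G') (at (p0, u p0))" by (rule smooth_on_has_derivative[OF G uD[OF p0]])
  have "(?X has_derivative (\<lambda>h. (fst h, ?G' h))) (at (p0, u p0))"
    by (intro has_derivative_Pair G' has_derivative_fst has_derivative_ident)
  then have X': "frechet_derivative ?X (at (p0, u p0)) = (\<lambda>h. (fst h, ?G' h))"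
    by (simp add: frechet_derivative_at[symmetric])
  have "linear ?G'" using G' by (simp add: has_derivative_linear)
  have injX: "inj (frechet_derivative ?X (at (p0, u p0)))"
    unfolding X'
  proof (rule injI)
    fix x y :: "'a \<times> 'b" assume "(fst x, ?G' x) = (fst y, ?G' y)"
    then have 1: "fst x = fst y" and "?G' x - ?G' y = 0" by auto
    then have "?G' (x - y) = 0" by (simp add: linear_diff[OF \<open>linear ?G'\<close>])
    moreover have "x - y = (0, snd x - snd y)" using 1 by (simp add: prod_eq_iff)
    ultimately have "?G' (0, snd x - snd y) = ?G' (0, 0)"
      using linear_0[OF \<open>linear ?G'\<close>] by (simp add: zero_prod_def)
    then have "snd x - snd y = 0" using injD[OF inj[OF p0]] by blast
    then show "x = y" using 1 by (simp add: prod_eq_iff)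
  qed
  obtain U V g where U: "(p0, u p0) \<in> U" "U \<subseteq> D" "diffeomorphism U V ?X g"
    by (rule smooth_inverse_function[OF \<open>open D\<close> X uD[OF p0] injX]) (rule that)
  have cu: "continuous_on Z (\<lambda>p. (p, u p))" by (intro continuous_intros u)
  define N where "N = Z \<inter> (\<lambda>p. (p, u p)) -` U"
  have "open N" unfolding N_def
    using continuous_open_preimage[OF cu \<open>open Z\<close>] U(3) by (simp add: diffeomorphism_def)
  have gX: "(p, 0) \<in> V" "g (p, 0) = (p, u p)" if "p \<in> N" for p
  proof -
    have "(p, u p) \<in> U" "?X (p, u p) = (p, 0)" using that Gu by (auto simp: N_def)
    then show "(p, 0) \<in> V" "g (p, 0) = (p, u p)"
      using U(3) unfolding diffeomorphism_def homeomorphism_def by (metis imageI)+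
  qed
  have "smooth_on N (\<lambda>p. g (p, 0))"
  proof (rule smooth_on_compose[where f = "\<lambda>p. (p, 0)" and h = g and T = V, OF \<open>open N\<close>])
    show "open V" "smooth_on V g" using U(3) by (auto simp: diffeomorphism_def)
    show "smooth_on N (\<lambda>p. (p, 0::'b))"
      by (intro smooth_on_bounded_linear bounded_linear_Pair bounded_linear_ident bounded_linear_zero \<open>open N\<close>)
  qed (use gX in auto)
  from smooth_on_linear_compose[OF bounded_linear_snd \<open>open N\<close> this]
  have "smooth_on N (\<lambda>p. snd (g (p, 0)))" .
  from smooth_on_cong[OF \<open>open N\<close> _ this] have "smooth_on N u"
    using gX by simp
  then show "\<exists>U. open U \<and> p0 \<in> U \<and> smooth_on U u"
    using \<open>open N\<close> p0 U(1) by (auto simp: N_def)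
qed


section \<open>Homogeneous polynomials\<close>

definition monomial :: "('n::finite \<Rightarrow> nat) \<Rightarrow> complex ^ 'n \<Rightarrow> complex"
  where "monomial \<alpha> z = (\<Prod>i\<in>UNIV. (z $ i) ^ \<alpha> i)"

lemma monomial_mult: "monomial \<alpha> z * monomial \<beta> z = monomial (\<lambda>i. \<alpha> i + \<beta> i) z"
  by (simp add: monomial_def power_add prod.distrib)

lemma monomial_single: "monomial (\<lambda>j. if j = i then m else 0) z = (z $ i) ^ m"
proof -
  have "monomial (\<lambda>j. if j = i then m else 0) z = (\<Prod>j\<in>UNIV. if j = i then (z $ i) ^ m else 1)"
    unfolding monomial_def by (intro prod.cong) auto
  then show ?thesis by simp
qed

lemma multidegree_single: "(\<lambda>j. if j = i then m else 0) \<in> multidegree m"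
  by (simp add: multidegree_def)

lemma homogeneous_polynomial_iff:
  "homogeneous_polynomial k h \<longleftrightarrow> (\<exists>c. \<forall>z. h z = (\<Sum>\<alpha>\<in>multidegree k. c \<alpha> * monomial \<alpha> z))"
  by (simp add: homogeneous_polynomial_def monomial_def)

lemma homogeneous_polynomial_monomial:
  assumes "\<alpha> \<in> multidegree k" shows "homogeneous_polynomial k (\<lambda>z. c * monomial \<alpha> z)"
proof -
  have "(\<Sum>\<beta>\<in>multidegree k. (if \<beta> = \<alpha> then c else 0) * monomial \<beta> z)
      = (\<Sum>\<beta>\<in>multidegree k. if \<beta> = \<alpha> then c * monomial \<alpha> z else 0)" for z :: "complex ^ 'a"
    by (intro sum.cong) auto
  then have "c * monomial \<alpha> z = (\<Sum>\<beta>\<in>multidegree k. (if \<beta> = \<alpha> then c else 0) * monomial \<beta> z)" for z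
    using assms by (simp add: finite_multidegree)
  then show ?thesis unfolding homogeneous_polynomial_iff
    by (intro exI[of _ "\<lambda>\<beta>. if \<beta> = \<alpha> then c else 0"]) blast
qed

lemma homogeneous_polynomial_zero: "homogeneous_polynomial k (\<lambda>_. 0)"
  unfolding homogeneous_polynomial_iff by (intro exI[of _ "\<lambda>_. 0"]) simp

lemma homogeneous_polynomial_add:
  assumes "homogeneous_polynomial k f" "homogeneous_polynomial k g"
  shows "homogeneous_polynomial k (\<lambda>z. f z + g z)"
proof -
  obtain c d where "\<forall>z. f z = (\<Sum>\<alpha>\<in>multidegree k. c \<alpha> * monomial \<alpha> z)"
    "\<forall>z. g z = (\<Sum>\<alpha>\<in>multidegree k. d \<alpha> * monomial \<alpha> z)"
    using assms unfolding homogeneous_polynomial_iff by auto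
  then show ?thesis unfolding homogeneous_polynomial_iff
    by (intro exI[of _ "\<lambda>\<alpha>. c \<alpha> + d \<alpha>"]) (simp add: distrib_right sum.distrib)
qed

lemma homogeneous_polynomial_sum:
  assumes "\<And>i. i \<in> I \<Longrightarrow> homogeneous_polynomial k (f i)"
  shows "homogeneous_polynomial k (\<lambda>z. \<Sum>i\<in>I. f i z)"
  using assms
  by (induction I rule: infinite_finite_induct)
    (auto intro: homogeneous_polynomial_add homogeneous_polynomial_zero)

lemma homogeneous_polynomial_times_monomial:
  assumes "homogeneous_polynomial k f" "\<beta> \<in> multidegree m"
  shows "homogeneous_polynomial (m + k) (\<lambda>z. monomial \<beta> z * f z)"
proof -
  obtain c where c: "\<And>z. f z = (\<Sum>\<alpha>\<in>multidegree k. c \<alpha> * monomial \<alpha> z)"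
    using assms(1) unfolding homogeneous_polynomial_iff by auto
  have "monomial \<beta> z * f z = (\<Sum>\<alpha>\<in>multidegree k. c \<alpha> * monomial (\<lambda>i. \<beta> i + \<alpha> i) z)" for z
    unfolding c sum_distrib_left by (intro sum.cong) (simp_all add: monomial_mult[symmetric])
  moreover have "homogeneous_polynomial (m + k) (\<lambda>z. c \<alpha> * monomial (\<lambda>i. \<beta> i + \<alpha> i) z)"
    if "\<alpha> \<in> multidegree k" for \<alpha>
    by (rule homogeneous_polynomial_monomial)
      (use that assms(2) in \<open>simp add: multidegree_def sum.distrib\<close>)
  ultimately show ?thesis by (simp add: homogeneous_polynomial_sum)
qed

lemma bounded_linear_component: "bounded_linear (\<lambda>z::complex ^ 'n::finite. z $ i)"
  by (rule bounded_linear_vec_nth)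

lemma smooth_on_homogeneous_polynomial:
  assumes "homogeneous_polynomial k f" shows "smooth_on UNIV f"
proof -
  obtain c where c: "\<And>z. f z = (\<Sum>\<alpha>\<in>multidegree k. c \<alpha> * (\<Prod>i\<in>UNIV. (z $ i) ^ \<alpha> i))"
    using assms unfolding homogeneous_polynomial_def by auto
  have "smooth_on UNIV (\<lambda>z. \<Sum>\<alpha>\<in>multidegree k. c \<alpha> * (\<Prod>i\<in>UNIV. (z $ i) ^ \<alpha> i))"
    by (intro smooth_on_sum smooth_on_mult smooth_on_const smooth_on_prod smooth_on_power
        smooth_on_bounded_linear bounded_linear_component open_UNIV)
  then show ?thesis by (simp add: c[symmetric] cong: if_cong)
qed

lemma homogeneous_polynomial_scale:
  assumes "homogeneous_polynomial k f" shows "f (l *s z) = l ^ k * f z"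
proof -
  obtain c where c: "\<And>z. f z = (\<Sum>\<alpha>\<in>multidegree k. c \<alpha> * (\<Prod>i\<in>UNIV. (z $ i) ^ \<alpha> i))"
    using assms unfolding homogeneous_polynomial_def by auto
  show ?thesis unfolding c sum_distrib_left
  proof (rule sum.cong)
    fix \<alpha> :: "'a \<Rightarrow> nat" assume "\<alpha> \<in> multidegree k"
    then have "(\<Prod>i\<in>UNIV. l ^ \<alpha> i) = l ^ k" by (simp add: multidegree_def power_sum[symmetric])
    then show "c \<alpha> * (\<Prod>i\<in>UNIV. ((l *s z) $ i) ^ \<alpha> i) = l ^ k * (c \<alpha> * (\<Prod>i\<in>UNIV. (z $ i) ^ \<alpha> i))"
      by (simp add: power_mult_distrib prod.distrib)
  qed simp
qed

lemma has_derivative_monomial: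
  "(monomial \<alpha> has_derivative (\<lambda>w. \<Sum>i\<in>UNIV. of_nat (\<alpha> i) * monomial (\<alpha>(i := \<alpha> i - 1)) z * w $ i)) (at z)"
proof -
  have pow: "((\<lambda>z::complex^'a. (z $ i) ^ \<alpha> i) has_derivative (\<lambda>w. of_nat (\<alpha> i) * w $ i * (z $ i) ^ (\<alpha> i - 1))) (at z)" for i
    by (rule has_derivative_power[OF bounded_linear_imp_has_derivative[OF bounded_linear_component]])
  have m: "(z $ i) ^ (\<alpha> i - 1) * (\<Prod>j\<in>UNIV - {i}. (z $ j) ^ \<alpha> j) = monomial (\<alpha>(i := \<alpha> i - 1)) z" for i
    unfolding monomial_def by (subst prod.remove[of UNIV i]) (auto intro!: prod.cong)
  have "((\<lambda>z. \<Prod>i\<in>UNIV. (z $ i) ^ \<alpha> i) has_derivative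
      (\<lambda>w. \<Sum>i\<in>UNIV. (of_nat (\<alpha> i) * w $ i * (z $ i) ^ (\<alpha> i - 1)) * (\<Prod>j\<in>UNIV - {i}. (z $ j) ^ \<alpha> j))) (at z)"
    by (rule has_derivative_prod[OF pow])
  moreover have eq: "(of_nat (\<alpha> i) * w $ i * (z $ i) ^ (\<alpha> i - 1)) * (\<Prod>j\<in>UNIV - {i}. (z $ j) ^ \<alpha> j)
      = of_nat (\<alpha> i) * monomial (\<alpha>(i := \<alpha> i - 1)) z * w $ i" for i w
    unfolding m[symmetric] by (simp add: mult_ac)
  moreover have "monomial \<alpha> = (\<lambda>z. \<Prod>i\<in>UNIV. (z $ i) ^ \<alpha> i)" by (simp add: monomial_def fun_eq_iff)
  ultimately show ?thesis by (simp only:)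
qed

lemma homogeneous_polynomial_partials:
  assumes "homogeneous_polynomial k f"
  obtains D where "\<And>i. homogeneous_polynomial (k - 1) (D i)"
    "\<And>z. (f has_derivative (\<lambda>w. \<Sum>i\<in>UNIV. D i z * w $ i)) (at z)"
proof -
  obtain c where c: "\<And>z. f z = (\<Sum>\<alpha>\<in>multidegree k. c \<alpha> * monomial \<alpha> z)"
    using assms unfolding homogeneous_polynomial_iff by auto
  let ?d = "\<lambda>i \<alpha> z. (c \<alpha> * of_nat (\<alpha> i)) * monomial (\<alpha>(i := \<alpha> i - 1)) z"
  define D where "D i z = (\<Sum>\<alpha>\<in>multidegree k. ?d i \<alpha> z)" for i z
  have hp: "homogeneous_polynomial (k - 1) (D i)" for i
    unfolding D_def
  proof (rule homogeneous_polynomial_sum)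
    fix \<alpha> :: "'a \<Rightarrow> nat" assume \<alpha>: "\<alpha> \<in> multidegree k"
    show "homogeneous_polynomial (k - 1) (?d i \<alpha>)"
    proof (cases "\<alpha> i = 0")
      case True
      then show ?thesis by (simp add: homogeneous_polynomial_zero)
    next
      case False
      have "(\<Sum>j\<in>UNIV. (\<alpha>(i := \<alpha> i - 1)) j) = (\<alpha> i - 1) + (\<Sum>j\<in>UNIV - {i}. \<alpha> j)"
        by (subst sum.remove[of UNIV i]) (auto intro!: sum.cong)
      moreover have "k = \<alpha> i + (\<Sum>j\<in>UNIV - {i}. \<alpha> j)"
        using \<alpha> sum.remove[of UNIV i \<alpha>] by (simp add: multidegree_def)
      ultimately have "\<alpha>(i := \<alpha> i - 1) \<in> multidegree (k - 1)"
        using False by (simp add: multidegree_def)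
      then show ?thesis by (rule homogeneous_polynomial_monomial)
    qed
  qed
  have "(f has_derivative (\<lambda>w. \<Sum>i\<in>UNIV. D i z * w $ i)) (at z)" for z
  proof -
    have "((\<lambda>z. \<Sum>\<alpha>\<in>multidegree k. c \<alpha> * monomial \<alpha> z) has_derivative
      (\<lambda>w. \<Sum>\<alpha>\<in>multidegree k. c \<alpha> * (\<Sum>i\<in>UNIV. of_nat (\<alpha> i) * monomial (\<alpha>(i := \<alpha> i - 1)) z * w $ i))) (at z)"
      by (intro has_derivative_sum has_derivative_mult_right has_derivative_monomial)
    moreover have "(\<Sum>\<alpha>\<in>multidegree k. c \<alpha> * (\<Sum>i\<in>UNIV. of_nat (\<alpha> i) * monomial (\<alpha>(i := \<alpha> i - 1)) z * w $ i))
        = (\<Sum>i\<in>UNIV. D i z * w $ i)" for w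
      unfolding D_def sum_distrib_left sum_distrib_right
      by (subst sum.swap) (simp add: mult_ac)
    ultimately show ?thesis by (simp add: c[symmetric])
  qed
  with hp that show thesis by blast
qed

lemma homogeneous_polynomial_fermat: "homogeneous_polynomial k (fermat k)"
proof -
  have "homogeneous_polynomial k (\<lambda>z::complex^'a. \<Sum>i\<in>UNIV. 1 * monomial (\<lambda>j. if j = i then k else 0) z)"
    by (intro homogeneous_polynomial_sum homogeneous_polynomial_monomial multidegree_single)
  then show ?thesis by (simp add: monomial_single fermat_def[abs_def])
qed

lemma has_derivative_fermat:
  "(fermat k has_derivative (\<lambda>w. \<Sum>i\<in>UNIV. of_nat k * (z $ i) ^ (k - 1) * w $ i)) (at z)"
proof -
  have "((\<lambda>z::complex^'a. \<Sum>i\<in>UNIV. (z $ i) ^ k) has_derivative (\<lambda>w. \<Sum>i\<in>UNIV. of_nat k * w $ i * (z $ i) ^ (k - 1))) (at z)"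
    by (intro has_derivative_sum has_derivative_power bounded_linear_imp_has_derivative bounded_linear_component)
  then show ?thesis by (simp add: fermat_def[abs_def] mult_ac)
qed

section \<open>Singular members of the pencil spanned by a polynomial and the Fermat polynomial\<close>

text \<open>The index set of the matrix is an arbitrary finite set: it will be a set of exponents of
  monomials, whose size depends on the degree.\<close>

lemma finite_eigenvalues:
  fixes a :: "'i \<Rightarrow> 'i \<Rightarrow> complex"
  assumes "finite S"
  shows "finite {l. \<exists>v. (\<exists>x\<in>S. v x \<noteq> 0) \<and> (\<forall>x\<in>S. (\<Sum>y\<in>S. a x y * v y) = l * v x)}"
proof -
  define m where "m = card S"
  obtain e where e: "bij_betw e {0..<m} S"
    using ex_bij_betw_nat_finite[OF \<open>finite S\<close>] m_def by blast
  define A where "A = Matrix.mat m m (\<lambda>(i, j). a (e i) (e j))"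
  have A: "A \<in> carrier_mat m m" by (simp add: A_def)
  have "char_poly A \<noteq> 0"
    using degree_monic_char_poly[OF A] by auto
  then have fin: "finite {l. poly (char_poly A) l = 0}" by (rule poly_roots_finite)
  have "poly (char_poly A) l = 0"
    if x: "x \<in> S" "v x \<noteq> 0" and ev: "\<And>x. x \<in> S \<Longrightarrow> (\<Sum>y\<in>S. a x y * v y) = l * v x" for l v x
  proof -
    define w where "w = Matrix.vec m (\<lambda>i. v (e i))"
    obtain i where i: "i < m" "e i = x"
      using e x(1) unfolding bij_betw_def by auto
    have "w \<noteq> 0\<^sub>v m"
      using i x(2) by (metis w_def index_vec index_zero_vec(1))
    moreover have "A *\<^sub>v w = l \<cdot>\<^sub>v w"
    proof (rule eq_vecI)
      fix i assume "i < dim_vec (l \<cdot>\<^sub>v w)"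
      then have i: "i < m" by (simp add: w_def)
      then have ei: "e i \<in> S" using e by (auto simp: bij_betw_def)
      have "vec_index (A *\<^sub>v w) i = (\<Sum>j = 0..<m. a (e i) (e j) * v (e j))"
        using i by (simp add: A_def w_def scalar_prod_def)
      also have "\<dots> = (\<Sum>y\<in>S. a (e i) y * v y)"
        by (rule sum.reindex_bij_betw[OF e])
      also have "\<dots> = vec_index (l \<cdot>\<^sub>v w) i" using ev[OF ei] i by (simp add: w_def)
      finally show "vec_index (A *\<^sub>v w) i = vec_index (l \<cdot>\<^sub>v w) i" .
    qed (simp add: A_def w_def)
    ultimately have "eigenvector A w l"
      using A unfolding eigenvector_def by (simp add: w_def)
    then show ?thesis
      using eigenvalue_root_char_poly[OF A] unfolding eigenvalue_def by blast
  qed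
  then show ?thesis by (intro finite_subset[OF _ fin]) blast
qed

text \<open>The functions \<open>D i\<close> stand for the partial derivatives of \<open>h\<close>, so the set consists of the parameters of
  the members of the pencil with a critical point \<open>z \<noteq> 0\<close>. By the pigeonhole principle each exponent \<open>\<beta>\<close> of
  total degree \<open>N\<close> has an entry \<open>\<iota> \<beta>\<close> of size at least \<open>k - 1\<close>; \<open>\<rho> \<beta>\<close> is what remains of \<open>\<beta>\<close> after
  lowering that entry by \<open>k - 1\<close>. Expanding \<open>z\<^sup>\<rho>\<^sup>\<beta> D (\<iota> \<beta>)\<close> in monomials gives the row \<open>\<beta>\<close> of a matrix
  that depends on \<open>h\<close> only, and at a critical point the vector of monomials is an eigenvector of it. The
  eigenvalue determines \<open>t\<close>.\<close>

lemma finite_singular_pencil: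
  fixes D :: "'n::finite \<Rightarrow> complex ^ 'n \<Rightarrow> complex"
  assumes "k > 2" and D: "\<And>i. homogeneous_polynomial (k - 1) (D i)"
  shows "finite {t. \<exists>z. z \<noteq> 0 \<and> (\<forall>i. (1 - t) * D i z + t * (of_nat k * (z $ i) ^ (k - 1)) = 0)}"
    (is "finite ?B")
proof -
  define N where "N = CARD('n) * (k - 2) + 1"
  define S :: "('n \<Rightarrow> nat) set" where "S = multidegree N"
  have "\<exists>i. \<beta> i \<ge> k - 1" if "\<beta> \<in> S" for \<beta>
  proof (rule ccontr)
    assume "\<nexists>i. k - 1 \<le> \<beta> i"
    then have "\<beta> i \<le> k - 2" for i using \<open>k > 2\<close> by (auto simp: not_le less_Suc_eq_le dest!: spec[of _ i])
    then have "(\<Sum>i\<in>UNIV. \<beta> i) \<le> CARD('n) * (k - 2)"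
      using sum_bounded_above[of UNIV \<beta> "k - 2"] by simp
    then show False using that by (simp add: S_def multidegree_def N_def)
  qed
  then obtain \<iota> where \<iota>: "\<And>\<beta>. \<beta> \<in> S \<Longrightarrow> \<beta> (\<iota> \<beta>) \<ge> k - 1" by metis
  define \<rho> where "\<rho> \<beta> = \<beta>(\<iota> \<beta> := \<beta> (\<iota> \<beta>) - (k - 1))" for \<beta>
  have \<rho>eq: "\<beta> = (\<lambda>j. \<rho> \<beta> j + (if j = \<iota> \<beta> then k - 1 else 0))" if "\<beta> \<in> S" for \<beta>
    using \<iota>[OF that] by (auto simp: \<rho>_def fun_eq_iff)
  have \<rho>: "\<rho> \<beta> \<in> multidegree (N - (k - 1))" "k - 1 \<le> N" if "\<beta> \<in> S" for \<beta>
  proof -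
    have "N = sum \<beta> UNIV" using that by (simp add: S_def multidegree_def)
    also have "\<dots> = (\<Sum>j\<in>UNIV. \<rho> \<beta> j + (if j = \<iota> \<beta> then k - 1 else 0))"
      by (rule arg_cong[OF \<rho>eq[OF that]])
    finally have "N = (\<Sum>j\<in>UNIV. \<rho> \<beta> j + (if j = \<iota> \<beta> then k - 1 else 0))" .
    then have "N = (\<Sum>j\<in>UNIV. \<rho> \<beta> j) + (k - 1)" by (simp add: sum.distrib)
    then show "\<rho> \<beta> \<in> multidegree (N - (k - 1))" "k - 1 \<le> N" by (simp_all add: multidegree_def)
  qed
  have "\<exists>c. \<forall>z. monomial (\<rho> \<beta>) z * D (\<iota> \<beta>) z = (\<Sum>\<gamma>\<in>S. c \<gamma> * monomial \<gamma> z)" if "\<beta> \<in> S" for \<beta>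
    using homogeneous_polynomial_times_monomial[OF D \<rho>(1)[OF that], of "\<iota> \<beta>"] \<rho>(2)[OF that]
    by (simp add: homogeneous_polynomial_iff S_def)
  then obtain a where a: "\<And>\<beta> z. \<beta> \<in> S \<Longrightarrow> monomial (\<rho> \<beta>) z * D (\<iota> \<beta>) z = (\<Sum>\<gamma>\<in>S. a \<beta> \<gamma> * monomial \<gamma> z)"
    by metis
  define E where "E = {l. \<exists>v. (\<exists>x\<in>S. v x \<noteq> 0) \<and> (\<forall>x\<in>S. (\<Sum>y\<in>S. a x y * v y) = l * v x)}"
  have "finite E" unfolding E_def by (rule finite_eigenvalues) (simp add: S_def finite_multidegree)
  have ev: "t \<noteq> 1 \<and> - (t * of_nat k) / (1 - t) \<in> E" if "t \<in> ?B" for t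
  proof -
    from that have "\<exists>z. z \<noteq> 0 \<and> (\<forall>i. (1 - t) * D i z + t * (of_nat k * (z $ i) ^ (k - 1)) = 0)"
      by (rule CollectD)
    then obtain z where z: "z \<noteq> 0" and "\<forall>i. (1 - t) * D i z + t * (of_nat k * (z $ i) ^ (k - 1)) = 0"
      by (elim exE conjE)
    then have crit: "(1 - t) * D i z + t * (of_nat k * (z $ i) ^ (k - 1)) = 0" for i by (rule_tac spec)
    have rel: "(1 - t) * (\<Sum>\<gamma>\<in>S. a \<beta> \<gamma> * monomial \<gamma> z) + t * of_nat k * monomial \<beta> z = 0" if \<beta>: "\<beta> \<in> S" for \<beta>
    proof -
      have "monomial \<beta> z = monomial (\<rho> \<beta>) z * (z $ \<iota> \<beta>) ^ (k - 1)"
        by (subst \<rho>eq[OF \<beta>]) (simp add: monomial_mult[symmetric] monomial_single)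
      then have "(1 - t) * (\<Sum>\<gamma>\<in>S. a \<beta> \<gamma> * monomial \<gamma> z) + t * of_nat k * monomial \<beta> z
          = monomial (\<rho> \<beta>) z * ((1 - t) * D (\<iota> \<beta>) z + t * (of_nat k * (z $ \<iota> \<beta>) ^ (k - 1)))"
        unfolding a[OF \<beta>, symmetric] by (simp add: algebra_simps)
      then show ?thesis unfolding crit by simp
    qed
    obtain i where i: "z $ i \<noteq> 0" using z by (auto simp: Finite_Cartesian_Product.vec_eq_iff)
    let ?\<beta> = "\<lambda>j. if j = i then N else 0"
    have \<beta>: "?\<beta> \<in> S" "monomial ?\<beta> z \<noteq> 0"
      using i by (simp_all add: S_def multidegree_single monomial_single)
    have "t \<noteq> 1" using rel[OF \<beta>(1)] \<beta>(2) \<open>k > 2\<close> by auto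
    have ev: "(\<Sum>\<gamma>\<in>S. a \<beta> \<gamma> * monomial \<gamma> z) = - (t * of_nat k) / (1 - t) * monomial \<beta> z" if "\<beta> \<in> S" for \<beta>
      using rel[OF that] \<open>t \<noteq> 1\<close> by (simp add: field_simps eq_neg_iff_add_eq_0)
    have "- (t * of_nat k) / (1 - t) \<in> E"
      unfolding E_def
      by (intro CollectI exI[of _ "\<lambda>\<gamma>. monomial \<gamma> z"] conjI bexI[of _ ?\<beta>] \<beta> ballI ev)
    with \<open>t \<noteq> 1\<close> show ?thesis by (rule conjI)
  qed
  have "inj_on (\<lambda>t. - (t * of_nat k) / (1 - t)) ?B"
  proof (rule inj_onI)
    fix s t assume s: "s \<in> ?B" and t: "t \<in> ?B" and eq: "- (s * of_nat k) / (1 - s) = - (t * of_nat k) / (1 - t :: complex)"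
    have "s \<noteq> 1" "t \<noteq> 1" using ev[OF s] ev[OF t] by simp_all
    with eq have "s * of_nat k * (1 - t) = t * of_nat k * (1 - s)"
      by (simp add: frac_eq_eq)
    then have "of_nat k * (s - t) = (0::complex)" by (simp add: algebra_simps)
    then show "s = t" using \<open>k > 2\<close> by simp
  qed
  moreover have "(\<lambda>t. - (t * of_nat k) / (1 - t)) ` ?B \<subseteq> E"
    by (rule image_subsetI) (use ev in simp)
  ultimately show ?thesis
    using inj_on_finite[OF _ _ \<open>finite E\<close>] by simp
qed

section \<open>Isotopies from identity plus contraction\<close>

text \<open>Solving \<open>x + f x = y\<close> means finding a fixed point of the contraction \<open>x \<mapsto> y - f x\<close>; the inverse is
  Lipschitz with constant \<open>2\<close>.\<close>

lemma homeomorphism_identity_plus_contraction: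
  fixes f :: "'a::euclidean_space \<Rightarrow> 'a"
  assumes lip: "\<And>x y. norm (f x - f y) \<le> norm (x - y) / 2"
  obtains g where "homeomorphism UNIV UNIV (\<lambda>x. x + f x) g"
proof -
  have low: "norm (x - y) \<le> 2 * norm ((x + f x) - (y + f y))" for x y
  proof -
    have "x - y = ((x + f x) - (y + f y)) - (f x - f y)" by simp
    then have "norm (x - y) \<le> norm ((x + f x) - (y + f y)) + norm (f x - f y)"
      by (metis norm_triangle_ineq4)
    then show ?thesis using lip[of x y] by simp
  qed
  have ex: "\<exists>x. x + f x = y" for y
  proof -
    have "dist (y - f x) (y - f x') \<le> 1 / 2 * dist x x'" for x x'
      using lip[of x' x] by (simp add: dist_norm norm_minus_commute)
    then have "\<exists>!x\<in>UNIV. y - f x = x"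
      by (intro Banach_fix[of UNIV "1 / 2"]) (auto simp: complete_UNIV)
    then obtain x where "y - f x = x" by auto
    then show ?thesis by (metis diff_add_cancel)
  qed
  then obtain g where g: "\<And>y. g y + f (g y) = y" by metis
  have gl: "g (x + f x) = x" for x
    using low[of "g (x + f x)" x] by (simp add: g)
  have "dist (g y) (g y') \<le> 2 * dist y y'" for y y'
    using low[of "g y" "g y'"] by (simp add: g dist_norm)
  then have "continuous_on UNIV g"
    by (intro lipschitz_on_continuous_on[of 2] lipschitz_onI) auto
  moreover have "dist (f x) (f y) \<le> 1 * dist x y" for x y
    using lip[of x y] norm_ge_zero[of "x - y"] unfolding dist_norm by linarith
  then have "continuous_on UNIV f"
    by (intro lipschitz_on_continuous_on[of 1] lipschitz_onI) auto
  ultimately have "homeomorphism UNIV UNIV (\<lambda>x. x + f x) g"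
    by (intro homeomorphismI continuous_on_add continuous_on_id) (auto simp: g gl)
  then show thesis using that by blast
qed

lemma linear_contraction_inj:
  fixes L :: "'a::real_normed_vector \<Rightarrow> 'a"
  assumes "linear L" "\<And>v. norm (L v - v) \<le> norm v / 2"
  shows "inj L"
proof (rule linear_injective_0[OF \<open>linear L\<close>, THEN iffD2], intro allI impI)
  fix v assume "L v = 0"
  then show "v = 0" using assms(2)[of v] by simp
qed

lemma tube_lemma_less:
  fixes f :: "'p::metric_space \<Rightarrow> 'k::metric_space \<Rightarrow> real"
  assumes "compact K" "open D" "continuous_on D (\<lambda>y. f (fst y) (snd y))"
    and "\<And>x. x \<in> K \<Longrightarrow> (p, x) \<in> D" and "\<And>x. x \<in> K \<Longrightarrow> f p x < c"
  shows "\<exists>\<delta>>0. \<forall>q x. dist q p \<le> \<delta> \<longrightarrow> x \<in> K \<longrightarrow> f q x < c"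
proof -
  let ?W = "D \<inter> (\<lambda>y. f (fst y) (snd y)) -` {..<c}"
  have "open ?W" using assms(2,3) by (intro continuous_open_preimage) auto
  moreover have "{p} \<times> K \<subseteq> ?W" using assms(4,5) by auto
  ultimately obtain X where X: "p \<in> X" "open X" "X \<times> K \<subseteq> ?W"
    using Elementary_Topology.tube_lemma[OF \<open>compact K\<close>, of ?W p] by blast
  then obtain e where "e > 0" "cball p e \<subseteq> X" using open_contains_cball by blast
  then have "\<forall>q x. dist q p \<le> e \<longrightarrow> x \<in> K \<longrightarrow> f q x < c"
    using X(3) by (auto simp: dist_commute subset_iff)
  with \<open>e > 0\<close> show ?thesis by blast
qed

lemma differentiable_bound_Basis:
  fixes f :: "'a::euclidean_space \<Rightarrow> 'b::real_normed_vector"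
  assumes "convex S" and der: "\<And>x. x \<in> S \<Longrightarrow> (f has_derivative f' x) (at x)"
    and bound: "\<And>x. x \<in> S \<Longrightarrow> (\<Sum>b\<in>Basis. norm (f' x b)) \<le> B" and "x \<in> S" "y \<in> S"
  shows "norm (f x - f y) \<le> B * norm (x - y)"
proof (rule differentiable_bound[OF \<open>convex S\<close> has_derivative_at_withinI[OF der] _ \<open>x \<in> S\<close> \<open>y \<in> S\<close>])
  fix z assume z: "z \<in> S"
  show "onorm (f' z) \<le> B"
  proof (rule onorm_le)
    fix w
    have "norm (f' z w) \<le> norm w * (\<Sum>b\<in>Basis. norm (f' z b))"
      by (rule norm_linear_le_Basis[OF has_derivative_linear[OF der[OF z]]])
    also have "\<dots> \<le> norm w * B" by (rule mult_left_mono[OF bound[OF z]]) simp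
    finally show "norm (f' z w) \<le> B * norm w" by (simp add: mult.commute)
  qed
qed

lemma norm_cscale: "norm (c *s (v :: complex ^ 'n::finite)) = cmod c * norm v"
  by (simp add: norm_vec_def norm_mult L2_set_right_distrib)

lemma bounded_bilinear_cscale: "bounded_bilinear (\<lambda>c (v :: complex ^ 'n::finite). c *s v)"
proof
  show "\<exists>K. \<forall>a (b :: complex ^ 'n). norm (a *s b) \<le> norm a * norm b * K"
    by (intro exI[of _ 1]) (simp add: norm_cscale)
qed (simp_all add: Finite_Cartesian_Product.vec_eq_iff algebra_simps)

lemmas smooth_on_cscale = smooth_on_bilinear[OF bounded_bilinear_cscale]

lemma scaleR_cscale: "(r *\<^sub>R c) *s v = r *\<^sub>R (c *s (v :: complex ^ 'n::finite))"
  "c *s (r *\<^sub>R v) = r *\<^sub>R (c *s v)"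
  by (simp_all add: Finite_Cartesian_Product.vec_eq_iff)

lemma smooth_on_fst: "open S \<Longrightarrow> smooth_on S fst"
  and smooth_on_snd: "open S \<Longrightarrow> smooth_on S snd"
  by (simp_all add: smooth_on_bounded_linear bounded_linear_fst bounded_linear_snd)

text \<open>A family \<open>H\<close> of homogeneous functions of degree \<open>k\<close>, with parameter \<open>t\<close>, and a vector field \<open>v\<close>, homogeneous of degree
  \<open>1 - k\<close> outside the origin, which is dual to the derivative of the member at \<open>t0\<close>: along the complex
  line spanned by \<open>v z\<close> this derivative is the identity of \<open>\<complex>\<close>. For a polynomial member without critical points
  outside the origin, the gradient divided by its squared norm is such a field.\<close>

locale homogeneous_family =
  fixes H :: "complex \<times> (complex ^ 'n::finite) \<Rightarrow> complex" and k :: nat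
    and v :: "complex ^ 'n \<Rightarrow> complex ^ 'n" and t0 :: complex
  assumes k: "k > 0"
    and smooth_H: "smooth_on UNIV H"
    and H_scale: "\<And>r t z. H (t, r *\<^sub>R z) = r ^ k *\<^sub>R H (t, z)"
    and smooth_v: "smooth_on (- {0}) v"
    and v_scale: "\<And>r z. r > 0 \<Longrightarrow> z \<noteq> 0 \<Longrightarrow> r ^ k *\<^sub>R v (r *\<^sub>R z) = r *\<^sub>R v z"
    and H_v: "\<And>z c. z \<noteq> 0 \<Longrightarrow> frechet_derivative H (at (t0, z)) (0, c *s v z) = c"
begin

text \<open>A zero \<open>u\<close> of \<open>G\<close> puts \<open>z + u v (z)\<close> on the fibre of the member at \<open>b\<close> whose value is the one
  that the member at \<open>a\<close> takes at \<open>z\<close>. The pair \<open>(a, b)\<close> is treated as a single parameter, so that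
  smoothness of the solution covers the dependence on it.\<close>

definition G :: "((complex \<times> complex) \<times> (complex ^ 'n)) \<times> complex \<Rightarrow> complex"
  where "G x = (case x of (((a, b), z), u) \<Rightarrow> H (b, z + u *s v z) - H (a, z))"

definition G_domain :: "(((complex \<times> complex) \<times> (complex ^ 'n)) \<times> complex) set"
  where "G_domain = (UNIV \<times> (- {0})) \<times> UNIV"

lemma open_G_domain: "open G_domain"
  by (simp add: G_domain_def open_Times open_Compl)

lemma smooth_G: "smooth_on G_domain G"
proof -
  have z: "smooth_on G_domain (\<lambda>x. snd (fst x))" and a: "smooth_on G_domain (\<lambda>x. fst (fst (fst x)))"
    and b: "smooth_on G_domain (\<lambda>x. snd (fst (fst x)))" and u: "smooth_on G_domain snd"
    by (intro smooth_on_bounded_linear open_G_domain bounded_linear_compose[OF bounded_linear_fst]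
        bounded_linear_compose[OF bounded_linear_snd] bounded_linear_fst bounded_linear_snd)+
  have "(\<lambda>x. snd (fst x)) ` G_domain \<subseteq> - {0}" by (auto simp: G_domain_def)
  from smooth_on_compose[OF open_G_domain _ this z smooth_v] have v: "smooth_on G_domain (\<lambda>x. v (snd (fst x)))"
    by auto
  have "smooth_on G_domain (\<lambda>x. (snd (fst (fst x)), snd (fst x) + snd x *s v (snd (fst x))))"
    by (intro smooth_on_Pair smooth_on_add smooth_on_cscale open_G_domain a b z u v)
  from smooth_on_compose[OF open_G_domain open_UNIV _ this smooth_H]
  have 1: "smooth_on G_domain (\<lambda>x. H (snd (fst (fst x)), snd (fst x) + snd x *s v (snd (fst x))))" by simp
  have "smooth_on G_domain (\<lambda>x. (fst (fst (fst x)), snd (fst x)))"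
    by (intro smooth_on_Pair open_G_domain a z)
  from smooth_on_compose[OF open_G_domain open_UNIV _ this smooth_H]
  have 2: "smooth_on G_domain (\<lambda>x. H (fst (fst (fst x)), snd (fst x)))" by simp
  have "G = (\<lambda>x. H (snd (fst (fst x)), snd (fst x) + snd x *s v (snd (fst x))) - H (fst (fst (fst x)), snd (fst x)))"
    by (auto simp: G_def fun_eq_iff)
  then show ?thesis using smooth_on_minus[OF open_G_domain 1 2] by simp
qed

definition dG where "dG x = frechet_derivative G (at x)"

lemma dG: "x \<in> G_domain \<Longrightarrow> (G has_derivative dG x) (at x)"
  unfolding dG_def by (rule smooth_on_has_derivative[OF smooth_G])

lemma dG_u: "((p, z), u) \<in> G_domain \<Longrightarrow> ((\<lambda>u. G ((p, z), u)) has_derivative (\<lambda>c. dG ((p, z), u) (0, c))) (at u)"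
  by (rule has_derivative_compose[of "\<lambda>u. ((p, z), u)" "\<lambda>c. (0, c)" u UNIV G, OF _ dG])
    (auto intro!: derivative_eq_intros simp: zero_prod_def)

text \<open>Giving \<open>z\<close> weight \<open>1\<close> and \<open>u\<close> weight \<open>k\<close>, the function \<open>G\<close> is homogeneous of weight \<open>k\<close>, and its
  derivative in \<open>u\<close> has weight \<open>0\<close>. This reduces everything to \<open>|z| = 1\<close>.\<close>

lemma G_scale:
  assumes "r > 0" "z \<noteq> 0"
  shows "G ((p, r *\<^sub>R z), r ^ k *\<^sub>R u) = r ^ k *\<^sub>R G ((p, z), u)"
proof -
  obtain a b where p: "p = (a, b)" by (cases p)
  have "(r ^ k *\<^sub>R u) *s v (r *\<^sub>R z) = r *\<^sub>R (u *s v z)"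
    using v_scale[OF assms] by (metis scaleR_cscale)
  then have "r *\<^sub>R z + (r ^ k *\<^sub>R u) *s v (r *\<^sub>R z) = r *\<^sub>R (z + u *s v z)"
    by (simp add: scaleR_add_right)
  then show ?thesis by (simp add: G_def p H_scale scaleR_diff_right)
qed

lemma dG_scale:
  assumes "r > 0" "z \<noteq> 0"
  shows "dG ((p, r *\<^sub>R z), r ^ k *\<^sub>R u) (0, c) = dG ((p, z), u) (0, c)"
proof -
  have d: "((p, r *\<^sub>R z), r ^ k *\<^sub>R u) \<in> G_domain" "((p, z), u) \<in> G_domain" using assms by (auto simp: G_domain_def)
  have "((\<lambda>u. G ((p, r *\<^sub>R z), r ^ k *\<^sub>R u)) has_derivative (\<lambda>c. dG ((p, r *\<^sub>R z), r ^ k *\<^sub>R u) (0, r ^ k *\<^sub>R c))) (at u)"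
    by (rule has_derivative_compose[where f = "\<lambda>u. r ^ k *\<^sub>R u" and f' = "\<lambda>c. r ^ k *\<^sub>R c", OF _ dG_u[OF d(1)]])
      (intro has_derivative_scaleR_right has_derivative_ident)
  moreover have "((\<lambda>u. r ^ k *\<^sub>R G ((p, z), u)) has_derivative (\<lambda>c. r ^ k *\<^sub>R dG ((p, z), u) (0, c))) (at u)"
    by (intro has_derivative_scaleR_right dG_u d)
  ultimately have "(\<lambda>c. dG ((p, r *\<^sub>R z), r ^ k *\<^sub>R u) (0, r ^ k *\<^sub>R c)) = (\<lambda>c. r ^ k *\<^sub>R dG ((p, z), u) (0, c))"
    unfolding G_scale[OF assms] by (rule has_derivative_unique)
  then have eq: "dG ((p, r *\<^sub>R z), r ^ k *\<^sub>R u) (0, r ^ k *\<^sub>R c) = r ^ k *\<^sub>R dG ((p, z), u) (0, c)" for c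
    by (rule fun_cong)
  have "linear (dG ((p, r *\<^sub>R z), r ^ k *\<^sub>R u))" by (rule has_derivative_linear[OF dG[OF d(1)]])
  from linear_cmul[OF this, of "r ^ k" "(0, c)"] have
    "dG ((p, r *\<^sub>R z), r ^ k *\<^sub>R u) (0, r ^ k *\<^sub>R c) = r ^ k *\<^sub>R dG ((p, r *\<^sub>R z), r ^ k *\<^sub>R u) (0, c)"
    by simp
  then show ?thesis using eq[of c] \<open>r > 0\<close> by simp
qed

lemma dG_center: "z \<noteq> 0 \<Longrightarrow> dG (((t0, t0), z), 0) (0, c) = c"
proof -
  assume z: "z \<noteq> 0"
  have d: "(((t0, t0), z), 0) \<in> G_domain" using z by (auto simp: G_domain_def)
  have H: "(H has_derivative frechet_derivative H (at (t0, z))) (at (t0, z))"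
    by (rule smooth_on_has_derivative[OF smooth_H]) simp
  have lin: "bounded_linear (\<lambda>c. c *s v z)" by (rule bounded_bilinear.bounded_linear_left[OF bounded_bilinear_cscale])
  have inner: "((\<lambda>u. (t0, z + u *s v z)) has_derivative (\<lambda>c. (0, 0 + c *s v z))) (at 0)"
    by (intro has_derivative_Pair has_derivative_add has_derivative_const bounded_linear_imp_has_derivative lin)
  have "((\<lambda>u. H (t0, z + u *s v z)) has_derivative (\<lambda>c. frechet_derivative H (at (t0, z)) (0, 0 + c *s v z))) (at 0)"
    by (rule has_derivative_compose[OF inner]) (use H in simp)
  then have "((\<lambda>u. H (t0, z + u *s v z) - H (t0, z)) has_derivative (\<lambda>c. c - 0)) (at 0)"
    using H_v[OF z] by (intro has_derivative_diff has_derivative_const) simp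
  then have "((\<lambda>u. G (((t0, t0), z), u)) has_derivative (\<lambda>c. c)) (at 0)" by (simp add: G_def)
  from has_derivative_unique[OF this dG_u[OF d]] show ?thesis by metis
qed

text \<open>At \<open>a = b = t0\<close> and \<open>u = 0\<close> the function \<open>G\<close> vanishes and its derivative in \<open>u\<close> is the identity.
  Compactness of the unit sphere makes both statements approximately true, uniformly in \<open>z\<close>, nearby. The bound
  \<open>\<delta> / 4\<close> lets the contraction \<open>u \<mapsto> u - G\<close> map the disc of radius \<open>\<delta>\<close> into itself.\<close>

lemma uniform_bounds:
  obtains \<delta> \<eta> where "\<delta> > 0" "\<eta> > 0"
    "\<And>p z u. dist p (t0, t0) \<le> \<eta> \<Longrightarrow> norm z = 1 \<Longrightarrow> norm u \<le> \<delta> \<Longrightarrow>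
        (\<Sum>c\<in>Basis. norm (dG ((p, z), u) (0, c) - c)) \<le> 1 / 2"
    "\<And>p z. dist p (t0, t0) \<le> \<eta> \<Longrightarrow> norm z = 1 \<Longrightarrow> norm (G ((p, z), 0)) \<le> \<delta> / 4"
proof -
  let ?S = "sphere (0 :: complex ^ 'n) 1"
  have cS: "compact ?S" by (rule compact_sphere)
  let ?D = "UNIV \<times> (- {0}) :: (((complex \<times> complex) \<times> complex) \<times> (complex ^ 'n)) set"
  let ?N = "\<lambda>q z. \<Sum>c\<in>Basis. norm (dG ((fst q, z), snd q) (0, c) - c)"
  have oD: "open ?D" by (simp add: open_Times open_Compl)
  have cdG: "continuous_on G_domain (\<lambda>x. dG x w)" for w
    unfolding dG_def by (rule smooth_on_continuous[OF smooth_on_frechet[OF smooth_G]])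
  have "continuous_on ?D (\<lambda>y. dG ((fst (fst y), snd y), snd (fst y)) (0, c))" for c
    by (rule continuous_on_compose2[OF cdG]) (auto intro!: continuous_intros simp: G_domain_def)
  then have "continuous_on ?D (\<lambda>y. \<Sum>c\<in>Basis. norm (dG ((fst (fst y), snd y), snd (fst y)) (0, c) - c))"
    by (intro continuous_on_sum continuous_on_norm continuous_on_diff continuous_on_const)
  then have cont: "continuous_on ?D (\<lambda>y. ?N (fst y) (snd y))" by simp
  have S0: "z \<noteq> 0" if "z \<in> ?S" for z using that by auto
  have "?N ((t0, t0), 0) z < 1 / 2" if "z \<in> ?S" for z
    by (simp add: dG_center[OF S0[OF that]])
  then have "\<exists>e>0. \<forall>q z. dist q ((t0, t0), 0) \<le> e \<longrightarrow> z \<in> ?S \<longrightarrow> ?N q z < 1 / 2"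
    by (intro tube_lemma_less[OF cS oD cont]) (use S0 in auto)
  then obtain e where e: "e > 0" and eb: "\<And>q z. dist q ((t0, t0), 0) \<le> e \<Longrightarrow> z \<in> ?S \<Longrightarrow> ?N q z < 1 / 2"
    by auto
  define \<delta> where "\<delta> = e / 2"
  let ?D2 = "UNIV \<times> (- {0}) :: ((complex \<times> complex) \<times> (complex ^ 'n)) set"
  have oD2: "open ?D2" by (simp add: open_Times open_Compl)
  have "continuous_on ?D2 (\<lambda>y. norm (G (y, 0)))"
    by (intro continuous_on_norm continuous_on_compose2[OF smooth_on_continuous[OF smooth_G]] continuous_intros)
      (auto simp: G_domain_def)
  then have cont2: "continuous_on ?D2 (\<lambda>y. norm (G ((fst y, snd y), 0)))" by simp
  have "norm (G (((t0, t0), z), 0)) < \<delta> / 4" for z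
    using e by (simp add: G_def \<delta>_def)
  then have "\<exists>e>0. \<forall>q z. dist q (t0, t0) \<le> e \<longrightarrow> z \<in> ?S \<longrightarrow> norm (G ((q, z), 0)) < \<delta> / 4"
    by (intro tube_lemma_less[OF cS oD2 cont2]) (use S0 in auto)
  then obtain e2 where e2: "e2 > 0" "\<And>q z. dist q (t0, t0) \<le> e2 \<Longrightarrow> z \<in> ?S \<Longrightarrow> norm (G ((q, z), 0)) < \<delta> / 4"
    by auto
  show thesis
  proof (rule that[of \<delta> "min (e / 2) e2"])
    fix p :: "complex \<times> complex" and z :: "complex ^ 'n" and u :: complex
    assume *: "dist p (t0, t0) \<le> min (e / 2) e2" "norm z = 1" "norm u \<le> \<delta>"
    have "dist (p, u) ((t0, t0), 0) \<le> dist p (t0, t0) + dist u 0"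
      unfolding dist_Pair_Pair by (rule sqrt_sum_squares_le_sum) simp_all
    also have "\<dots> \<le> e" using * by (simp add: \<delta>_def)
    finally show "(\<Sum>c\<in>Basis. norm (dG ((p, z), u) (0, c) - c)) \<le> 1 / 2"
      using eb[of "(p, u)" z] * by (simp add: less_imp_le)
  next
    fix p :: "complex \<times> complex" and z :: "complex ^ 'n"
    assume "dist p (t0, t0) \<le> min (e / 2) e2" "norm z = 1"
    then show "norm (G ((p, z), 0)) \<le> \<delta> / 4" using e2(2)[of p z] by (simp add: less_imp_le)
  qed (use e e2 in \<open>simp_all add: \<delta>_def\<close>)
qed


text \<open>On the unit sphere \<open>u \<mapsto> G (\<dots>, u)\<close> is the identity plus a contraction, so it has exactly one zero \<open>s\<close> in
  the disc of radius \<open>\<delta>\<close>, which depends continuously on the other variables. The weights extend \<open>s\<close> from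
  the sphere to \<open>z \<noteq> 0\<close> by \<open>u (z) = |z|\<^sup>k s (z / |z|)\<close>. Smoothness is obtained from the implicit equation and not
  from this formula. For \<open>a = b\<close> the zero is \<open>0\<close>, which will make the isotopy start at the identity.\<close>

lemma implicit_displacement:
  obtains \<eta> and u :: "(complex \<times> complex) \<times> (complex ^ 'n) \<Rightarrow> complex"
  where "\<eta> > 0" "smooth_on (ball (t0, t0) \<eta> \<times> (- {0})) u"
    "\<And>p z. p \<in> ball (t0, t0) \<eta> \<Longrightarrow> z \<noteq> 0 \<Longrightarrow> G ((p, z), u (p, z)) = 0"
    "\<And>p z r. r > 0 \<Longrightarrow> u (p, r *\<^sub>R z) = r ^ k *\<^sub>R u (p, z)"
    "\<And>t z. (t, t) \<in> ball (t0, t0) \<eta> \<Longrightarrow> u ((t, t), z) = 0"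
    "\<And>p. u (p, 0) = 0"
proof -
  obtain \<delta> \<eta> where \<delta>: "\<delta> > 0" and \<eta>: "\<eta> > 0"
    and b1: "\<And>p z u. dist p (t0, t0) \<le> \<eta> \<Longrightarrow> norm z = 1 \<Longrightarrow> norm u \<le> \<delta> \<Longrightarrow>
        (\<Sum>c\<in>Basis. norm (dG ((p, z), u) (0, c) - c)) \<le> 1 / 2"
    and b2: "\<And>p z. dist p (t0, t0) \<le> \<eta> \<Longrightarrow> norm z = 1 \<Longrightarrow> norm (G ((p, z), 0)) \<le> \<delta> / 4"
    using uniform_bounds by blast
  define X where "X = ball (t0, t0) \<eta>"
  define S where "S = sphere (0 :: complex ^ 'n) 1"
  have X: "dist p (t0, t0) \<le> \<eta>" if "p \<in> X" for p using that by (simp add: X_def dist_commute)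
  have Sd: "((p, z), u) \<in> G_domain" if "z \<in> S" for p z u using that by (auto simp: S_def G_domain_def)
  have contr: "norm ((G ((p, z), u) - u) - (G ((p, z), u') - u')) \<le> 1 / 2 * norm (u - u')"
    if "p \<in> X" "z \<in> S" "norm u \<le> \<delta>" "norm u' \<le> \<delta>" for p z u u'
  proof (rule differentiable_bound_Basis[of "cball 0 \<delta>" "\<lambda>u. G ((p, z), u) - u" "\<lambda>u c. dG ((p, z), u) (0, c) - c"])
    show "((\<lambda>u. G ((p, z), u) - u) has_derivative (\<lambda>c. dG ((p, z), u) (0, c) - c)) (at u)" for u
      by (intro has_derivative_diff has_derivative_ident dG_u Sd that)
    show "(\<Sum>c\<in>Basis. norm (dG ((p, z), u) (0, c) - c)) \<le> 1 / 2" if "u \<in> cball 0 \<delta>" for u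
      using b1[OF X[OF \<open>p \<in> X\<close>], of z u] \<open>z \<in> S\<close> that by (simp add: S_def)
  qed (use that in auto)
  have uniq: "norm (u - u') \<le> 2 * norm (G ((p, z), u) - G ((p, z), u'))"
    if "p \<in> X" "z \<in> S" "norm u \<le> \<delta>" "norm u' \<le> \<delta>" for p z u u'
  proof -
    have "u - u' = (G ((p, z), u) - G ((p, z), u')) - ((G ((p, z), u) - u) - (G ((p, z), u') - u'))" by simp
    then have "norm (u - u') \<le> norm (G ((p, z), u) - G ((p, z), u')) + norm ((G ((p, z), u) - u) - (G ((p, z), u') - u'))"
      by (metis norm_triangle_ineq4)
    then show ?thesis using contr[OF that] by linarith
  qed
  have ex: "\<exists>u. norm u \<le> \<delta> \<and> G ((p, z), u) = 0" if "p \<in> X" "z \<in> S" for p z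
  proof -
    have "\<exists>!u\<in>cball 0 \<delta>. u - G ((p, z), u) = u"
    proof (rule Banach_fix[of "cball 0 \<delta>" "1 / 2"])
      show "(\<lambda>u. u - G ((p, z), u)) ` cball 0 \<delta> \<subseteq> cball 0 \<delta>"
      proof (rule image_subsetI)
        fix u :: complex assume u: "u \<in> cball 0 \<delta>"
        have "norm ((G ((p, z), u) - u) - (G ((p, z), 0) - 0)) \<le> 1 / 2 * norm (u - 0)"
          using u \<delta> by (intro contr that) auto
        moreover have "norm (G ((p, z), 0)) \<le> \<delta> / 4"
          using b2[OF X[OF that(1)]] that(2) by (simp add: S_def)
        moreover have "u - G ((p, z), u) = - (((G ((p, z), u) - u) - (G ((p, z), 0) - 0)) + G ((p, z), 0))" by simp
        then have "norm (u - G ((p, z), u)) \<le> norm ((G ((p, z), u) - u) - (G ((p, z), 0) - 0)) + norm (G ((p, z), 0))"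
          by (metis norm_minus_cancel norm_triangle_ineq)
        ultimately show "u - G ((p, z), u) \<in> cball 0 \<delta>" using u \<delta> by simp
      qed
      show "dist (u - G ((p, z), u)) (u' - G ((p, z), u')) \<le> 1 / 2 * dist u u'"
        if "u \<in> cball 0 \<delta>" "u' \<in> cball 0 \<delta>" for u u'
        using contr[OF \<open>p \<in> X\<close> \<open>z \<in> S\<close>, of u u'] that by (simp add: dist_norm norm_minus_commute algebra_simps)
    qed (use \<delta> in \<open>auto simp: compact_imp_complete\<close>)
    then show ?thesis by auto
  qed
  define s where "s x = (SOME u. norm u \<le> \<delta> \<and> G (x, u) = 0)" for x
  have s: "norm (s (p, z)) \<le> \<delta>" "G ((p, z), s (p, z)) = 0" if "p \<in> X" "z \<in> S" for p z
    using someI_ex[OF ex[OF that]] by (simp_all add: s_def)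
  define u where "u x = norm (snd x) ^ k *\<^sub>R (if fst x \<in> X then s (fst x, sgn (snd x)) else 0)" for x
  have sgnS: "sgn z \<in> S" if "z \<noteq> 0" for z using that by (simp add: S_def norm_sgn)
  have polar: "norm z *\<^sub>R sgn z = z" for z :: "complex ^ 'n"
    by (cases "z = 0") (simp_all add: sgn_div_norm)
  have Gu: "G ((p, z), u (p, z)) = 0" if "p \<in> X" "z \<noteq> 0" for p z
  proof -
    have "G ((p, norm z *\<^sub>R sgn z), norm z ^ k *\<^sub>R s (p, sgn z)) = norm z ^ k *\<^sub>R G ((p, sgn z), s (p, sgn z))"
      using that by (intro G_scale) (auto simp: sgn_zero_iff)
    then show ?thesis using s(2)[OF that(1) sgnS[OF that(2)]] that(1) by (simp add: polar u_def)
  qed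
  have conts: "continuous_on (X \<times> S) s"
    unfolding continuous_on_def
  proof (rule ballI)
    fix x0 assume x0: "x0 \<in> X \<times> S"
    then have "(x0, s x0) \<in> G_domain" using Sd by (cases x0) auto
    then have "isCont G (x0, s x0)"
      using smooth_on_continuous[OF smooth_G] open_G_domain by (simp add: continuous_on_eq_continuous_at)
    then have "((\<lambda>x. G (x, s x0)) \<longlongrightarrow> G (x0, s x0)) (at x0 within X \<times> S)"
      by (intro isCont_tendsto_compose[where g = G] tendsto_Pair tendsto_const tendsto_ident_at)
    then have "((\<lambda>x. 2 * norm (G (x, s x0))) \<longlongrightarrow> 2 * norm (G (x0, s x0))) (at x0 within X \<times> S)"
      by (intro tendsto_mult tendsto_const tendsto_norm)
    moreover have "G (x0, s x0) = 0" using x0 s(2) by (cases x0) auto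
    ultimately have lim: "((\<lambda>x. 2 * norm (G (x, s x0))) \<longlongrightarrow> 0) (at x0 within X \<times> S)" by simp
    have "norm (s x - s x0) \<le> 2 * norm (G (x, s x0))" if x: "x \<in> X \<times> S" for x
    proof -
      obtain p z p0 z0 where [simp]: "x = (p, z)" "x0 = (p0, z0)" by (cases x, cases x0)
      show ?thesis
        using uniq[of p z "s (p, z)" "s (p0, z0)"] s[of p z] s[of p0 z0] x x0 by simp
    qed
    then have "\<forall>\<^sub>F x in at x0 within X \<times> S. norm (s x - s x0) \<le> 2 * norm (G (x, s x0))"
      by (simp add: eventually_at_filter)
    from Lim_null_comparison[OF this lim] show "(s \<longlongrightarrow> s x0) (at x0 within X \<times> S)"
      by (simp add: LIM_zero_iff)
  qed
  have "continuous_on (X \<times> - {0}) (\<lambda>x. norm (snd x) ^ k *\<^sub>R s (fst x, sgn (snd x)))"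
    by (intro continuous_on_scaleR continuous_on_power continuous_on_norm continuous_on_snd continuous_on_id
        continuous_on_compose2[OF conts] continuous_on_Pair continuous_on_fst continuous_on_sgn)
      (use sgnS in auto)
  then have contu: "continuous_on (X \<times> - {0}) u"
    by (rule continuous_on_eq) (auto simp: u_def)
  have oZ: "open (X \<times> (- {0} :: (complex ^ 'n) set))" by (simp add: X_def open_Times open_Compl)
  have "smooth_on (X \<times> - {0}) u"
  proof (rule smooth_on_implicit[OF open_G_domain smooth_G oZ contu])
    fix x assume x: "x \<in> X \<times> (- {0} :: (complex ^ 'n) set)"
    then obtain p z where [simp]: "x = (p, z)" and pz: "p \<in> X" "z \<noteq> 0" by auto
    show "(x, u x) \<in> G_domain" using pz by (auto simp: G_domain_def)
    show "G (x, u x) = 0" using Gu[OF pz] by simp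
    let ?L = "dG ((p, sgn z), s (p, sgn z))"
    have "dG ((p, norm z *\<^sub>R sgn z), norm z ^ k *\<^sub>R s (p, sgn z)) (0, c) = ?L (0, c)" for c
      using pz by (intro dG_scale) (auto simp: sgn_zero_iff)
    then have eq: "frechet_derivative G (at (x, u x)) (0, c) = ?L (0, c)" for c
      using pz by (simp add: polar u_def dG_def)
    have "((\<lambda>u. G ((p, sgn z), u)) has_derivative (\<lambda>c. ?L (0, c))) (at (s (p, sgn z)))"
      by (rule dG_u[OF Sd[OF sgnS[OF pz(2)]]])
    then have lin: "linear (\<lambda>c. ?L (0, c))" by (rule has_derivative_linear)
    have "norm (?L (0, c) - c) \<le> norm c / 2" for c
    proof -
      have "norm (?L (0, c) - c) \<le> norm c * (\<Sum>b\<in>Basis. norm (?L (0, b) - b))"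
        by (rule norm_linear_le_Basis[of "\<lambda>c. ?L (0, c) - c"]) (intro linear_compose_sub lin linear_ident)
      also have "\<dots> \<le> norm c * (1 / 2)"
        using b1[OF X[OF pz(1)], of "sgn z" "s (p, sgn z)"] s(1)[OF pz(1) sgnS[OF pz(2)]] sgnS[OF pz(2)]
        by (intro mult_left_mono) (auto simp: S_def)
      finally show ?thesis by simp
    qed
    then show "inj (\<lambda>c. frechet_derivative G (at (x, u x)) (0, c))"
      unfolding eq by (rule linear_contraction_inj[OF lin])
  qed
  moreover have "u ((t, t), z) = 0" if "(t, t) \<in> X" for t z
  proof (cases "z = 0")
    case False
    note s' = s[OF that sgnS[OF False]]
    have "G (((t, t), sgn z), 0) = 0" by (simp add: G_def)
    then have "norm (s ((t, t), sgn z) - 0) \<le> 0"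
      using uniq[OF that sgnS[OF False] s'(1), of 0] s'(2) \<delta> by simp
    then show ?thesis by (simp add: u_def)
  qed (use k in \<open>simp add: u_def\<close>)
  moreover have "u (p, r *\<^sub>R z) = r ^ k *\<^sub>R u (p, z)" if "r > 0" for p z r
    using that by (simp add: u_def sgn_scaleR power_mult_distrib)
  moreover have "u (p, 0) = 0" for p using k by (simp add: u_def)
  ultimately show thesis using that[of \<eta> u] \<eta> Gu unfolding X_def by blast
qed


text \<open>The displacement \<open>P = u v\<close> is homogeneous of degree one in \<open>z\<close> and vanishes for \<open>a = b = t0\<close>, so its
  derivative in \<open>z\<close> has degree zero and is small, uniformly in \<open>z \<noteq> 0\<close>, for \<open>a\<close> and \<open>b\<close> near \<open>t0\<close>. Hence \<open>P\<close> is
  a contraction and the identity plus \<open>P\<close> is a homeomorphism. The statement is symmetric in \<open>a\<close> and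
  \<open>b\<close>, which spares inverting isotopies later.\<close>

lemma local_isotopy:
  "\<exists>\<rho>>0. \<forall>a b. dist a t0 < \<rho> \<longrightarrow> dist b t0 < \<rho> \<longrightarrow> (\<exists>\<phi>. isotopy_end \<phi> \<and> (\<forall>z. H (b, \<phi> z) = H (a, z)))"
proof -
  obtain \<eta> and u :: "(complex \<times> complex) \<times> (complex ^ 'n) \<Rightarrow> complex"
    where \<eta>: "\<eta> > 0" and u: "smooth_on (ball (t0, t0) \<eta> \<times> (- {0})) u"
    and Gu: "\<And>p z. p \<in> ball (t0, t0) \<eta> \<Longrightarrow> z \<noteq> 0 \<Longrightarrow> G ((p, z), u (p, z)) = 0"
    and u_scale: "\<And>p z r. r > 0 \<Longrightarrow> u (p, r *\<^sub>R z) = r ^ k *\<^sub>R u (p, z)"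
    and u_diag: "\<And>t z. (t, t) \<in> ball (t0, t0) \<eta> \<Longrightarrow> u ((t, t), z) = 0"
    and u_0: "\<And>p. u (p, 0) = 0"
    using implicit_displacement by blast
  define X where "X = ball (t0, t0) \<eta>"
  let ?Z = "X \<times> (- {0 :: complex ^ 'n})"
  have oZ: "open ?Z" by (simp add: X_def open_Times open_Compl)
  define P where "P x = u x *s v (snd x)" for x
  have "smooth_on ?Z (\<lambda>x. v (snd x))"
    by (rule smooth_on_compose[where f = snd and h = v and T = "- {0}", OF oZ _ _ smooth_on_snd[OF oZ] smooth_v]) (auto simp: open_Compl)
  then have smooth_P: "smooth_on ?Z P"
    using smooth_on_cscale[OF oZ u[folded X_def]] by (simp add: P_def[abs_def])
  have P_0: "P (p, 0) = 0" for p by (simp add: P_def u_0)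
  have P_scale: "P (p, r *\<^sub>R z) = r *\<^sub>R P (p, z)" if "r > 0" for p r z
  proof (cases "z = 0")
    case False
    have "P (p, r *\<^sub>R z) = u (p, z) *s (r ^ k *\<^sub>R v (r *\<^sub>R z))"
      by (simp add: P_def u_scale[OF that] scaleR_cscale)
    then show ?thesis by (simp add: v_scale[OF that False] P_def scaleR_cscale)
  qed (simp add: P_0)
  have P_diag: "P ((t, t), z) = 0" if "(t, t) \<in> X" for t z
    using u_diag that by (simp add: P_def X_def)
  define dP where "dP p z w = frechet_derivative P (at (p, z)) (0, w)" for p z w
  have dP: "((\<lambda>z. P (p, z)) has_derivative dP p z) (at z)" if "p \<in> X" "z \<noteq> 0" for p z
  proof -
    have "((\<lambda>z. (p, z)) has_derivative (\<lambda>w. (0, w))) (at z)"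
      by (intro has_derivative_Pair has_derivative_const has_derivative_ident)
    from has_derivative_compose[OF this smooth_on_has_derivative[OF smooth_P]] that
    show ?thesis by (simp add: dP_def[abs_def])
  qed
  have dP_scale: "dP p (r *\<^sub>R z) w = dP p z w" if "r > 0" "p \<in> X" "z \<noteq> 0" for p r z w
  proof -
    have "((\<lambda>z. P (p, r *\<^sub>R z)) has_derivative (\<lambda>w. dP p (r *\<^sub>R z) (r *\<^sub>R w))) (at z)"
      by (rule has_derivative_compose[where f = "\<lambda>z. r *\<^sub>R z" and f' = "\<lambda>z. r *\<^sub>R z", OF _ dP])
        (use that in \<open>auto intro: has_derivative_scaleR_right has_derivative_ident\<close>)
    moreover have "((\<lambda>z. r *\<^sub>R P (p, z)) has_derivative (\<lambda>w. r *\<^sub>R dP p z w)) (at z)"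
      by (intro has_derivative_scaleR_right dP that)
    ultimately have "(\<lambda>w. dP p (r *\<^sub>R z) (r *\<^sub>R w)) = (\<lambda>w. r *\<^sub>R dP p z w)"
      unfolding P_scale[OF \<open>r > 0\<close>] by (rule has_derivative_unique)
    then have "dP p (r *\<^sub>R z) (r *\<^sub>R w) = r *\<^sub>R dP p z w" by (rule fun_cong)
    moreover have "linear (dP p (r *\<^sub>R z))" by (rule has_derivative_linear[OF dP]) (use that in auto)
    ultimately show ?thesis using \<open>r > 0\<close> by (simp add: linear_cmul)
  qed
  let ?N = "\<lambda>p z. \<Sum>b\<in>Basis. norm (dP p z b)"
  have "\<exists>\<rho>>0. \<forall>p z. dist p (t0, t0) \<le> \<rho> \<longrightarrow> z \<in> sphere (0 :: complex ^ 'n) 1 \<longrightarrow> ?N p z < 1 / 2"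
  proof (rule tube_lemma_less[OF compact_sphere oZ])
    have "continuous_on ?Z (\<lambda>x. \<Sum>b\<in>Basis. norm (frechet_derivative P (at x) (0, b)))"
      by (intro continuous_on_sum continuous_on_norm smooth_on_continuous[OF smooth_on_frechet[OF smooth_P]])
    then show "continuous_on ?Z (\<lambda>x. ?N (fst x) (snd x))" by (simp add: dP_def)
    show "((t0, t0), z) \<in> ?Z" if "z \<in> sphere 0 1" for z using that \<eta> by (auto simp: X_def)
    show "?N (t0, t0) z < 1 / 2" if "z \<in> sphere 0 1" for z
    proof -
      have "((\<lambda>z. P ((t0, t0), z)) has_derivative (\<lambda>_. 0)) (at z)"
        using P_diag[of t0] \<eta> by (simp add: X_def)
      moreover have "((\<lambda>z. P ((t0, t0), z)) has_derivative dP (t0, t0) z) (at z)"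
        by (rule dP) (use that \<eta> in \<open>auto simp: X_def\<close>)
      ultimately have "dP (t0, t0) z = (\<lambda>_. 0)" by (metis has_derivative_unique)
      then show ?thesis by simp
    qed
  qed
  then obtain \<rho>' where \<rho>': "\<rho>' > 0"
    "\<And>p z. dist p (t0, t0) \<le> \<rho>' \<Longrightarrow> z \<in> sphere (0 :: complex ^ 'n) 1 \<Longrightarrow> ?N p z < 1 / 2" by auto
  define \<rho> where "\<rho> = min \<rho>' \<eta> / 2"
  define Y where "Y = ball t0 \<rho> \<times> ball t0 \<rho>"
  have YX: "p \<in> X" "dist p (t0, t0) \<le> \<rho>'" if "p \<in> Y" for p
  proof -
    have "dist p (t0, t0) \<le> dist (fst p) t0 + dist (snd p) t0"
      by (cases p) (simp add: dist_Pair_Pair sqrt_sum_squares_le_sum)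
    also have "\<dots> < \<rho> + \<rho>" using that by (auto simp: Y_def dist_commute intro!: add_strict_mono)
    also have "\<dots> = min \<rho>' \<eta>" by (simp add: \<rho>_def)
    finally show "p \<in> X" "dist p (t0, t0) \<le> \<rho>'" by (auto simp: X_def dist_commute)
  qed
  have N: "?N p z \<le> 1 / 2" if "p \<in> Y" "z \<noteq> 0" for p z
  proof -
    have "?N p (norm z *\<^sub>R sgn z) = ?N p (sgn z)"
      using that YX by (intro sum.cong refl arg_cong[where f = norm] dP_scale) (auto simp: sgn_zero_iff)
    moreover have "norm z *\<^sub>R sgn z = z" using that by (simp add: sgn_div_norm)
    ultimately show ?thesis using \<rho>'(2)[OF YX(2)[OF that(1)], of "sgn z"] that by (simp add: norm_sgn)
  qed
  \<comment> \<open>\<open>P\<close> need not be differentiable at the origin, so segments through the origin are treated separately.\<close>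
  have lip_away: "norm (P (p, x) - P (p, y)) \<le> 1 / 2 * norm (x - y)"
    if "p \<in> Y" "0 \<notin> closed_segment x y" for p x y
  proof (rule differentiable_bound_Basis[of "closed_segment x y" "\<lambda>z. P (p, z)" "dP p"])
    fix z assume "z \<in> closed_segment x y"
    then have "z \<noteq> 0" using that by auto
    then show "((\<lambda>z. P (p, z)) has_derivative dP p z) (at z)" "?N p z \<le> 1 / 2"
      using dP[OF YX(1)] N that by auto
  qed auto
  \<comment> \<open>Compare \<open>z\<close> with \<open>z / 2\<close>: by homogeneity both sides of the Lipschitz estimate are halved.\<close>
  have bound: "norm (P (p, z)) \<le> 1 / 2 * norm z" if "p \<in> Y" for p z
  proof (cases "z = 0")
    case False
    have "0 \<notin> closed_segment z ((1/2) *\<^sub>R z)"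
    proof
      assume "0 \<in> closed_segment z ((1/2) *\<^sub>R z)"
      then obtain s where "0 \<le> s" "s \<le> 1" "(1 - s) *\<^sub>R z + s *\<^sub>R ((1/2) *\<^sub>R z) = 0"
        by (auto simp: in_segment)
      moreover have "(1 - s / 2) *\<^sub>R z = (1 - s) *\<^sub>R z + s *\<^sub>R ((1/2) *\<^sub>R z)"
        by (simp add: scaleR_left_distrib[symmetric])
      ultimately have "(1 - s / 2) *\<^sub>R z = 0" by simp
      then show False using \<open>s \<le> 1\<close> False by simp
    qed
    from lip_away[OF that this] have "norm (P (p, z) - (1/2) *\<^sub>R P (p, z)) \<le> 1 / 2 * norm (z - (1/2) *\<^sub>R z)"
      by (simp add: P_scale)
    moreover have "x - (1/2) *\<^sub>R x = (1/2) *\<^sub>R x" for x :: "complex ^ 'n"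
      using scaleR_left_diff_distrib[of 1 "1/2" x] by simp
    ultimately show ?thesis by simp
  qed (simp add: P_0)
  have lip: "norm (P (p, x) - P (p, y)) \<le> norm (x - y) / 2" if "p \<in> Y" for p x y
  proof (cases "0 \<in> closed_segment x y")
    case True
    then have "dist x y = dist x 0 + dist 0 y"
      using between_mem_segment[of x y 0] by (simp add: between)
    moreover have "norm (P (p, x) - P (p, y)) \<le> norm (P (p, x)) + norm (P (p, y))" by (rule norm_triangle_ineq4)
    ultimately show ?thesis using bound[OF that, of x] bound[OF that, of y] by (simp add: dist_norm)
  next
    case False
    then show ?thesis using lip_away[OF that] by simp
  qed
  have diffeo: "\<exists>g. homeomorphism UNIV UNIV (\<lambda>z. z + P (p, z)) g \<and> diffeomorphism (- {0}) (- {0}) (\<lambda>z. z + P (p, z)) g"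
    if p: "p \<in> Y" for p
  proof -
    let ?f = "\<lambda>z. z + P (p, z)"
    obtain g where g: "homeomorphism UNIV UNIV ?f g"
      using homeomorphism_identity_plus_contraction[of "\<lambda>z. P (p, z)"] lip[OF p] by blast
    have fg: "?f (g y) = y" "g (?f z) = z" for y z using g by (auto simp: homeomorphism_def)
    have f0: "?f 0 = 0" by (simp add: P_0)
    then have g0: "g 0 = 0" using fg(2)[of 0] by simp
    have ne: "?f z \<noteq> 0" "g z \<noteq> 0" if "z \<noteq> 0" for z
      using fg(2)[of z] fg(1)[of z] that g0 f0 by metis+
    have o: "open (- {0 :: complex ^ 'n})" by (simp add: open_Compl)
    have "smooth_on (- {0}) (\<lambda>z. P (p, z))"
    proof (rule smooth_on_compose[where f = "\<lambda>z. (p, z)" and h = P, OF o oZ _ _ smooth_P])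
      show "smooth_on (- {0}) (\<lambda>z. (p, z :: complex ^ 'n))"
        by (intro smooth_on_Pair o smooth_on_const smooth_on_bounded_linear bounded_linear_ident)
    qed (use YX[OF p] in auto)
    then have f: "smooth_on (- {0}) ?f"
      by (intro smooth_on_add o smooth_on_bounded_linear[OF bounded_linear_ident])
    have inj: "inj (frechet_derivative ?f (at z))" if "z \<in> - {0}" for z
    proof -
      have z: "z \<noteq> 0" using that by simp
      have d: "(?f has_derivative (\<lambda>w. w + dP p z w)) (at z)"
        by (intro has_derivative_add has_derivative_ident dP YX p z)
      have "inj (\<lambda>w. w + dP p z w)"
      proof (rule linear_contraction_inj[OF has_derivative_linear[OF d]])
        fix w
        have "norm (dP p z w) \<le> norm w * ?N p z"
          by (rule norm_linear_le_Basis[OF has_derivative_linear[OF dP[OF YX(1)[OF p] z]]])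
        also have "\<dots> \<le> norm w * (1 / 2)" by (intro mult_left_mono N p z) simp
        finally show "norm (w + dP p z w - w) \<le> norm w / 2" by simp
      qed
      then show ?thesis using frechet_derivative_at[OF d] by simp
    qed
    have "continuous_on UNIV ?f" "continuous_on UNIV g" using g by (simp_all add: homeomorphism_def)
    then have cont: "continuous_on (- {0}) ?f" "continuous_on (- {0}) g"
      by (blast intro: continuous_on_subset)+
    have m: "?f z \<in> - {0}" "g z \<in> - {0}" if "z \<in> - {0}" for z using ne[of z] that by simp_all
    have img: "?f ` (- {0}) \<subseteq> - {0}" "g ` (- {0}) \<subseteq> - {0}"
      by (rule image_subsetI, erule m)+
    have "smooth_on (- {0}) g"
      by (rule smooth_on_inverse_map[OF o o f cont(2) img(2) fg(1) inj])
    moreover have "homeomorphism (- {0}) (- {0}) ?f g"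
      by (rule homeomorphismI[OF cont img]) (simp_all only: fg)
    ultimately show ?thesis using g o f unfolding diffeomorphism_def by blast
  qed
  have level: "H (b, z + P ((a, b), z)) = H (a, z)" if "(a, b) \<in> Y" for a b z
  proof (cases "z = 0")
    case True
    have "H (t, 0 *\<^sub>R 0) = 0" for t
      unfolding H_scale by (simp add: zero_power[OF k])
    then have "H (t, 0) = 0" for t by simp
    then show ?thesis using True by (simp add: P_0)
  next
    case False
    then show ?thesis using Gu[of "(a, b)" z] YX(1)[OF that] by (simp add: G_def P_def X_def)
  qed
  have cont: "continuous_on (Y \<times> UNIV) P"
    unfolding continuous_on_def
  proof (rule ballI)
    fix x assume x: "x \<in> Y \<times> (UNIV :: (complex ^ 'n) set)"
    obtain p z where [simp]: "x = (p, z)" by (cases x)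
    show "(P \<longlongrightarrow> P x) (at x within Y \<times> UNIV)"
    proof (cases "z = 0")
      case False
      then have "isCont P x" using smooth_on_continuous[OF smooth_P] oZ x YX(1)
        by (auto simp: continuous_on_eq_continuous_at)
      then show ?thesis unfolding isCont_def by (rule tendsto_within_subset) simp
    next
      case True
      have "((\<lambda>x. 1 / 2 * norm (snd x)) \<longlongrightarrow> 1 / 2 * norm (snd x)) (at x within Y \<times> UNIV)"
        by (intro tendsto_mult tendsto_const tendsto_norm tendsto_snd tendsto_ident_at)
      then have "((\<lambda>x. 1 / 2 * norm (snd x)) \<longlongrightarrow> 0) (at x within Y \<times> UNIV)" using True by simp
      moreover have "\<forall>\<^sub>F x in at x within Y \<times> UNIV. norm (P x) \<le> 1 / 2 * norm (snd x)"
        unfolding eventually_at_filter using bound by (intro always_eventually) (auto simp: mem_Times_iff)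
      ultimately have "(P \<longlongrightarrow> 0) (at x within Y \<times> UNIV)" by (rule Lim_null_comparison[rotated])
      then show ?thesis using True by (simp add: P_0)
    qed
  qed
  have "\<exists>\<phi>. isotopy_end \<phi> \<and> (\<forall>z. H (b, \<phi> z) = H (a, z))" if "dist a t0 < \<rho>" "dist b t0 < \<rho>" for a b
  proof -
    let ?p = "\<lambda>t. (a, a + t *\<^sub>R (b - a))"
    define F where "F t z = z + P (?p t, z)" for t z
    have pY: "?p t \<in> Y" if "t \<in> {0..1}" for t
    proof -
      have "a + t *\<^sub>R (b - a) = (1 - t) *\<^sub>R a + t *\<^sub>R b" by (simp add: algebra_simps)
      also have "\<dots> \<in> ball t0 \<rho>"
        using that \<open>dist a t0 < \<rho>\<close> \<open>dist b t0 < \<rho>\<close> by (intro convexD[OF convex_ball]) (auto simp: dist_commute)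
      finally show ?thesis using \<open>dist a t0 < \<rho>\<close> by (simp add: Y_def dist_commute)
    qed
    have "continuous_on ({0..1} \<times> UNIV) (\<lambda>x. snd x + P (?p (fst x), snd x))"
      by (intro continuous_on_add continuous_on_snd continuous_on_id continuous_on_compose2[OF cont]
          continuous_on_Pair continuous_on_const continuous_on_scaleR continuous_on_fst) (use pY in auto)
    moreover have "F 0 z = z" for z
      using P_diag[OF YX(1)] pY[of 0] by (simp add: F_def)
    moreover have "F t 0 = 0" for t by (simp add: F_def P_0)
    ultimately have "isotopy F"
      unfolding isotopy_def using diffeo[OF pY] by (auto simp: F_def[abs_def] case_prod_unfold)
    moreover have "H (b, F 1 z) = H (a, z)" for z
      using level[of a b z] pY[of 1] by (simp add: F_def)
    ultimately show ?thesis unfolding isotopy_end_def by blast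
  qed
  moreover have "\<rho> > 0" using \<rho>'(1) \<eta> by (simp add: \<rho>_def)
  ultimately show ?thesis by blast
qed

end


lemma diffeomorphism_compose:
  fixes f g :: "'a::euclidean_space \<Rightarrow> 'a"
  assumes "diffeomorphism S T f f'" "diffeomorphism T U g g'"
  shows "diffeomorphism S U (g \<circ> f) (f' \<circ> g')"
proof -
  have hom: "homeomorphism S T f f'" "homeomorphism T U g g'" and op: "open S" "open T" "open U"
    and sm: "smooth_on S f" "smooth_on T f'" "smooth_on T g" "smooth_on U g'"
    using assms by (simp_all add: diffeomorphism_def)
  have "smooth_on S (\<lambda>x. g (f x))"
    by (rule smooth_on_compose[OF op(1,2) _ sm(1,3)]) (simp add: homeomorphism_image1[OF hom(1)])
  moreover have "smooth_on U (\<lambda>x. f' (g' x))"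
    by (rule smooth_on_compose[OF op(3,2) _ sm(4,2)]) (simp add: homeomorphism_image2[OF hom(2)])
  ultimately show ?thesis
    using op homeomorphism_compose[OF hom] by (simp add: diffeomorphism_def o_def)
qed

lemma isotopy_homeomorphism:
  "isotopy F \<Longrightarrow> t \<in> {0..1} \<Longrightarrow> \<exists>G. homeomorphism UNIV UNIV (F t) G \<and> diffeomorphism (- {0}) (- {0}) (F t) G"
  by (simp add: isotopy_def)

lemma isotopy_end_compose:
  fixes \<phi> \<psi> :: "'a::euclidean_space \<Rightarrow> 'a"
  assumes "isotopy_end \<phi>" "isotopy_end \<psi>"
  shows "isotopy_end (\<psi> \<circ> \<phi>)"
proof -
  obtain E F where E: "isotopy E" "E 1 = \<phi>" and F: "isotopy F" "F 1 = \<psi>"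
    using assms unfolding isotopy_end_def by auto
  have cE: "continuous_on ({0..1} \<times> UNIV) (\<lambda>x. E (fst x) (snd x))"
    and cF: "continuous_on ({0..1} \<times> UNIV) (\<lambda>x. F (fst x) (snd x))"
    using E(1) F(1) by (simp_all add: isotopy_def case_prod_unfold)
  have "continuous_on ({0..1} \<times> UNIV) (\<lambda>x. (fst x, E (fst x) (snd x)))"
    by (intro continuous_on_Pair continuous_on_fst continuous_on_id cE)
  moreover have "(\<lambda>x. (fst x, E (fst x) (snd x))) ` ({0..1} \<times> UNIV) \<subseteq> {0..1} \<times> UNIV" by auto
  ultimately have "continuous_on ({0..1} \<times> UNIV) (\<lambda>x. F (fst x) (E (fst x) (snd x)))"
    using continuous_on_compose2[OF cF] by fastforce
  moreover have "\<exists>G. homeomorphism UNIV UNIV (F t \<circ> E t) G \<and> diffeomorphism (- {0}) (- {0}) (F t \<circ> E t) G"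
    if t: "t \<in> {0..1}" for t
  proof -
    obtain G G' where 1: "homeomorphism UNIV UNIV (E t) G" and 2: "diffeomorphism (- {0}) (- {0}) (E t) G"
      and 3: "homeomorphism UNIV UNIV (F t) G'" and 4: "diffeomorphism (- {0}) (- {0}) (F t) G'"
      using isotopy_homeomorphism[OF E(1) t] isotopy_homeomorphism[OF F(1) t] by (elim exE conjE)
    show ?thesis
      using homeomorphism_compose[OF 1 3] diffeomorphism_compose[OF 2 4] by (intro exI conjI)
  qed
  ultimately have "isotopy (\<lambda>t. F t \<circ> E t)"
    using E(1) F(1) by (simp add: isotopy_def case_prod_unfold)
  then show ?thesis using E(2) F(2) unfolding isotopy_end_def by auto
qed

lemma smooth_on_vec_lambda:
  fixes f :: "'n::finite \<Rightarrow> 'a::euclidean_space \<Rightarrow> complex"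
  assumes "open S" "\<And>i. smooth_on S (f i)"
  shows "smooth_on S (\<lambda>x. \<chi> i. f i x)"
proof -
  have lin: "bounded_linear (axis i :: complex \<Rightarrow> complex ^ 'n)" for i
    unfolding linear_conv_bounded_linear[symmetric]
    by (rule linearI) (auto simp: Finite_Cartesian_Product.vec_eq_iff axis_def)
  have "smooth_on S (\<lambda>x. \<Sum>i\<in>UNIV. axis i (f i x))"
    by (intro smooth_on_sum smooth_on_linear_compose[OF lin] assms)
  moreover have "(\<chi> i. c i) = (\<Sum>i\<in>UNIV. axis i (c i))" for c :: "'n \<Rightarrow> complex"
    by (simp add: Finite_Cartesian_Product.vec_eq_iff axis_def if_distrib cong: if_cong)
  ultimately show ?thesis by simp
qed

definition pencil :: "(complex ^ 'n::finite \<Rightarrow> complex) \<Rightarrow> nat \<Rightarrow> complex \<times> (complex ^ 'n) \<Rightarrow> complex"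
  where "pencil h k x = (1 - fst x) * h (snd x) + fst x * fermat k (snd x)"

lemma of_real_scale: "complex_of_real r *s z = r *\<^sub>R (z :: complex ^ 'n::finite)"
  by (simp add: Finite_Cartesian_Product.vec_eq_iff scaleR_conv_of_real[where 'a = complex])

text \<open>The dual vector field is the gradient \<open>(cnj (g i z))\<^sub>i\<close> of the member at \<open>t0\<close> divided by its squared norm \<open>S z\<close>.\<close>

lemma pencil_local_isotopy:
  fixes h :: "complex ^ 'n::finite \<Rightarrow> complex"
  assumes h: "homogeneous_polynomial k h" and k: "k > 2"
    and D: "\<And>i. homogeneous_polynomial (k - 1) (D i)"
    and h': "\<And>z. (h has_derivative (\<lambda>w. \<Sum>i\<in>UNIV. D i z * w $ i)) (at z)"
    and t0: "\<And>z. z \<noteq> 0 \<Longrightarrow> \<exists>i. (1 - t0) * D i z + t0 * (of_nat k * (z $ i) ^ (k - 1)) \<noteq> 0"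
  shows "\<exists>\<rho>>0. \<forall>a b. dist a t0 < \<rho> \<longrightarrow> dist b t0 < \<rho> \<longrightarrow>
    (\<exists>\<phi>. isotopy_end \<phi> \<and> (\<forall>z. pencil h k (b, \<phi> z) = pencil h k (a, z)))"
proof -
  define g where "g i z = (1 - t0) * D i z + t0 * (of_nat k * (z $ i) ^ (k - 1))" for i z
  define S where "S z = (\<Sum>i\<in>UNIV. g i z \<bullet> g i z)" for z
  define v where "v z = inverse (S z) *\<^sub>R (\<chi> i. cnj (g i z))" for z
  have o: "open (- {0 :: complex ^ 'n})" by (simp add: open_Compl)
  have smooth_g: "smooth_on (- {0}) (g i)" for i
    unfolding g_def[abs_def]
    by (intro smooth_on_add smooth_on_mult smooth_on_const smooth_on_power o
        smooth_on_subset[OF smooth_on_homogeneous_polynomial[OF D]]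
        smooth_on_bounded_linear[OF bounded_linear_component]) simp
  have S: "S z > 0" if z: "z \<noteq> 0" for z
  proof -
    obtain i where "g i z \<noteq> 0" using t0[OF z] by (auto simp: g_def)
    then show ?thesis unfolding S_def by (intro sum_pos2[of _ i]) auto
  qed
  have "smooth_on (- {0}) S"
    unfolding S_def[abs_def] by (intro smooth_on_sum smooth_on_inner smooth_g o)
  then have "smooth_on (- {0}) (\<lambda>z. inverse (S z))"
    by (intro smooth_on_inverse o) (use S in \<open>fastforce\<close>)
  moreover have "smooth_on (- {0}) (\<lambda>z. \<chi> i. cnj (g i z))"
    by (intro smooth_on_vec_lambda smooth_on_linear_compose[OF bounded_linear_cnj] o smooth_g)
  ultimately have smooth_v: "smooth_on (- {0}) v"
    unfolding v_def[abs_def] by (rule smooth_on_scaleR[OF o])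
  have g_scale: "g i (r *\<^sub>R z) = r ^ (k - 1) *\<^sub>R g i z" for i r z
    using homogeneous_polynomial_scale[OF D, of i "of_real r" z]
    by (simp add: g_def of_real_scale scaleR_conv_of_real[where 'a = complex] power_mult_distrib algebra_simps)
  have v_scale: "r ^ k *\<^sub>R v (r *\<^sub>R z) = r *\<^sub>R v z" if "r > 0" for r z
  proof -
    have "S (r *\<^sub>R z) = (r ^ (k - 1) * r ^ (k - 1)) * S z"
      by (simp add: S_def g_scale sum_distrib_left mult.assoc)
    moreover have "(\<chi> i. cnj (g i (r *\<^sub>R z))) = r ^ (k - 1) *\<^sub>R (\<chi> i. cnj (g i z))"
      by (simp add: g_scale Finite_Cartesian_Product.vec_eq_iff)
    moreover have "r ^ k = r * r ^ (k - 1)" using k by (simp add: power_eq_if)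
    ultimately show ?thesis using that by (simp add: v_def field_simps)
  qed
  have smooth: "smooth_on UNIV (pencil h k)"
    unfolding pencil_def[abs_def]
    by (intro smooth_on_add smooth_on_mult smooth_on_minus smooth_on_const smooth_on_fst
        smooth_on_compose[where f = snd and h = h and T = UNIV] smooth_on_snd
        smooth_on_compose[where f = snd and h = "fermat k" and T = UNIV]
        smooth_on_homogeneous_polynomial[OF h] smooth_on_homogeneous_polynomial[OF homogeneous_polynomial_fermat]
        open_UNIV subset_UNIV)
  have scale: "pencil h k (t, r *\<^sub>R z) = r ^ k *\<^sub>R pencil h k (t, z)" for r t z
    using homogeneous_polynomial_scale[OF h, of "of_real r" z]
      homogeneous_polynomial_scale[OF homogeneous_polynomial_fermat, of k "of_real r" z]
    by (simp add: pencil_def of_real_scale scaleR_conv_of_real[where 'a = complex] algebra_simps)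
  have deriv: "frechet_derivative (pencil h k) (at (t0, z)) (0, w) = (\<Sum>i\<in>UNIV. g i z * w $ i)" for z w
  proof -
    have "((\<lambda>z. (t0, z)) has_derivative (\<lambda>w. (0, w))) (at z)"
      by (intro has_derivative_Pair has_derivative_const has_derivative_ident)
    from has_derivative_compose[OF this smooth_on_has_derivative[OF smooth]]
    have "((\<lambda>z. pencil h k (t0, z)) has_derivative (\<lambda>w. frechet_derivative (pencil h k) (at (t0, z)) (0, w))) (at z)" by simp
    moreover have "((\<lambda>z. (1 - t0) * h z + t0 * fermat k z) has_derivative
        (\<lambda>w. (1 - t0) * (\<Sum>i\<in>UNIV. D i z * w $ i) + t0 * (\<Sum>i\<in>UNIV. of_nat k * (z $ i) ^ (k - 1) * w $ i))) (at z)"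
      by (intro has_derivative_add has_derivative_mult_right h' has_derivative_fermat)
    ultimately have "(\<lambda>w. frechet_derivative (pencil h k) (at (t0, z)) (0, w)) =
       (\<lambda>w. (1 - t0) * (\<Sum>i\<in>UNIV. D i z * w $ i) + t0 * (\<Sum>i\<in>UNIV. of_nat k * (z $ i) ^ (k - 1) * w $ i))"
      by (intro has_derivative_unique) (simp_all add: pencil_def)
    from fun_cong[OF this, of w] show ?thesis
      by (simp add: g_def sum_distrib_left sum.distrib[symmetric] algebra_simps)
  qed
  have v: "frechet_derivative (pencil h k) (at (t0, z)) (0, c *s v z) = c" if "z \<noteq> 0" for z c
  proof -
    have "g i z * cnj (g i z) = of_real (g i z \<bullet> g i z)" for i
      by (simp only: complex_norm_square[symmetric] power2_norm_eq_inner[symmetric])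
    then have "(\<Sum>i\<in>UNIV. g i z * (c *s v z) $ i) = (\<Sum>i\<in>UNIV. (c * of_real (inverse (S z))) * of_real (g i z \<bullet> g i z))"
      by (intro sum.cong) (simp_all add: v_def scaleR_conv_of_real[where 'a = complex] mult_ac)
    also have "\<dots> = c * of_real (inverse (S z) * S z)"
      by (simp add: S_def sum_distrib_left mult.assoc)
    also have "\<dots> = c" using S[OF that] by simp
    finally show ?thesis by (simp add: deriv)
  qed
  interpret homogeneous_family "pencil h k" k v t0
    by unfold_locales (use k smooth scale smooth_v v_scale v in auto)
  show ?thesis by (rule local_isotopy)
qed

text \<open>Being connected by an isotopy, in both directions, is a relation on the regular parameters with open
  classes, and these parameters form the complement of a finite set in the plane.\<close>

theorem isotopic_to_fermat:
  fixes h :: "complex ^ 'n::finite \<Rightarrow> complex"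
  assumes h: "homogeneous_polynomial k h" and k: "k > 2" and crit: "{z. critical_point h z} = {0}"
  shows "\<exists>\<phi>. isotopy_end \<phi> \<and> (\<forall>z. fermat k (\<phi> z) = h z)"
proof -
  obtain D where D: "\<And>i. homogeneous_polynomial (k - 1) (D i)"
    and h': "\<And>z. (h has_derivative (\<lambda>w. \<Sum>i\<in>UNIV. D i z * w $ i)) (at z)"
    using homogeneous_polynomial_partials[OF h] by blast
  define B where "B = {t. \<exists>z. z \<noteq> 0 \<and> (\<forall>i. (1 - t) * D i z + t * (of_nat k * (z $ i) ^ (k - 1)) = 0)}"
  define R where "R a b \<longleftrightarrow> (\<exists>\<phi>. isotopy_end \<phi> \<and> (\<forall>z. pencil h k (b, \<phi> z) = pencil h k (a, z)))" for a b
  have "finite B" unfolding B_def by (rule finite_singular_pencil[OF k D])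
  have R_trans: "R a c" if "R a b" "R b c" for a b c
  proof -
    obtain \<phi> \<psi> where "isotopy_end \<phi>" "\<And>z. pencil h k (b, \<phi> z) = pencil h k (a, z)"
      "isotopy_end \<psi>" "\<And>z. pencil h k (c, \<psi> z) = pencil h k (b, z)"
      using \<open>R a b\<close> \<open>R b c\<close> unfolding R_def by auto
    then show ?thesis unfolding R_def
      by (intro exI[of _ "\<psi> \<circ> \<phi>"]) (simp add: isotopy_end_compose)
  qed
  have nbhd: "\<exists>\<rho>>0. \<forall>a b. dist a t < \<rho> \<longrightarrow> dist b t < \<rho> \<longrightarrow> R a b" if "t \<in> - B" for t
    unfolding R_def by (rule pencil_local_isotopy[OF h k D h']) (use that in \<open>auto simp: B_def\<close>)
  have "0 \<notin> B"
  proof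
    assume "0 \<in> B"
    then obtain z where "z \<noteq> 0" "\<And>i. D i z = 0" by (auto simp: B_def)
    then have "critical_point h z" using h'[of z] by (simp add: critical_point_def)
    then show False using crit \<open>z \<noteq> 0\<close> by blast
  qed
  have "1 \<notin> B"
    using k by (auto simp: B_def Finite_Cartesian_Product.vec_eq_iff)
  have "connected (- B)"
    by (intro path_connected_imp_connected path_connected_complement_countable)
      (use \<open>finite B\<close> in \<open>auto intro: countable_finite\<close>)
  then have "R 0 1 \<and> R 1 0"
  proof (rule connected_equivalence_relation[where R = "\<lambda>a b. R a b \<and> R b a"])
    fix a assume "a \<in> - B"
    then obtain \<rho> where \<rho>: "\<rho> > 0" "\<And>b c. dist b a < \<rho> \<Longrightarrow> dist c a < \<rho> \<Longrightarrow> R b c" using nbhd by meson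
    have "openin (top_of_set (- B)) (- B \<inter> ball a \<rho>)" by (intro openin_open_Int open_ball)
    moreover have "\<forall>b\<in>- B \<inter> ball a \<rho>. R a b \<and> R b a" using \<rho> by (auto simp: dist_commute)
    ultimately show "\<exists>T. openin (top_of_set (- B)) T \<and> a \<in> T \<and> (\<forall>x\<in>T. R a x \<and> R x a)"
      using \<open>a \<in> - B\<close> \<rho>(1) by (intro exI[of _ "- B \<inter> ball a \<rho>"]) auto
  qed (use \<open>0 \<notin> B\<close> \<open>1 \<notin> B\<close> R_trans in auto)
  then show ?thesis unfolding R_def by (simp add: pencil_def)
qed

section \<open>Leaves\<close>

lemma homeomorphism_image_component:
  assumes hom: "homeomorphism S T f g" and C: "C \<in> components S"
  shows "f ` C \<in> components T"
proof -
  note h = hom[unfolded homeomorphism_def]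
  note C' = C[unfolded in_components_maximal]
  have conn: "connected (f ` C)"
    using h C' by (intro connected_continuous_image) (auto intro: continuous_on_subset)
  have max: "E = f ` C" if E: "E \<noteq> {}" "f ` C \<subseteq> E" "E \<subseteq> T" "connected E" for E
  proof -
    have "connected (g ` E)" using h E by (intro connected_continuous_image) (auto intro: continuous_on_subset)
    moreover have "C \<subseteq> g ` E"
    proof
      fix x assume "x \<in> C"
      then have "g (f x) = x" "f x \<in> E" using h C' E(2) by auto
      then show "x \<in> g ` E" by (metis imageI)
    qed
    moreover have "g ` E \<subseteq> S" using h E(3) by auto
    ultimately have "g ` E = C" using C' E(1) by auto
    then have "f ` C = f ` g ` E" by simp
    also have "\<dots> = (\<lambda>y. y) ` E"
      unfolding image_image by (rule image_cong) (use h E(3) in auto)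
    finally show ?thesis by simp
  qed
  have "C \<noteq> {}" "C \<subseteq> S" "f ` S = T" using h C' by simp_all
  then have sub: "f ` C \<noteq> {}" "f ` C \<subseteq> T" using image_mono[of C S f] by simp_all
  show ?thesis unfolding in_components_maximal
    by (intro conjI allI impI sub conn) (elim conjE, rule max)
qed

text \<open>Equal values go to equal values, so \<open>\<phi>\<close> maps each punctured fibre homeomorphically
  onto one of the other function; leaves are the components of these.\<close>

lemma image_leaves:
  assumes \<phi>: "isotopy_end \<phi>" and f: "\<And>z. f (\<phi> z) = h z"
  shows "(\<lambda>L. \<phi> ` L) ` leaves h = leaves f"
proof -
  obtain F where F: "isotopy F" "F 1 = \<phi>" using \<phi> unfolding isotopy_end_def by auto
  then obtain g where \<phi>0: "\<phi> 0 = 0" and g: "homeomorphism UNIV UNIV \<phi> g"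
    unfolding isotopy_def by force
  have gf: "g (\<phi> z) = z" "\<phi> (g z) = z" for z using g by (auto simp: homeomorphism_def)
  then have g0: "g 0 = 0" using \<phi>0 by metis
  have hom: "homeomorphism {z. z \<noteq> 0 \<and> h z = c} {z. z \<noteq> 0 \<and> f z = c} \<phi> g" for c
  proof (rule homeomorphismI)
    show "continuous_on {z. z \<noteq> 0 \<and> h z = c} \<phi>" "continuous_on {z. z \<noteq> 0 \<and> f z = c} g"
      using g by (auto simp: homeomorphism_def intro: continuous_on_subset)
    show "\<phi> ` {z. z \<noteq> 0 \<and> h z = c} \<subseteq> {z. z \<noteq> 0 \<and> f z = c}"
    proof (rule image_subsetI)
      fix z assume "z \<in> {z. z \<noteq> 0 \<and> h z = c}"
      then show "\<phi> z \<in> {z. z \<noteq> 0 \<and> f z = c}" using gf(1)[of z] g0 f[of z] by auto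
    qed
    show "g ` {z. z \<noteq> 0 \<and> f z = c} \<subseteq> {z. z \<noteq> 0 \<and> h z = c}"
    proof (rule image_subsetI)
      fix z assume "z \<in> {z. z \<noteq> 0 \<and> f z = c}"
      then show "g z \<in> {z. z \<noteq> 0 \<and> h z = c}" using gf(2)[of z] \<phi>0 f[of "g z"] by auto
    qed
  qed (simp_all only: gf)
  have 1: "\<phi> ` L \<in> leaves f" if "L \<in> leaves h" for L
    using that homeomorphism_image_component[OF hom] by (auto simp: leaves_def)
  have 2: "g ` L \<in> leaves h" if "L \<in> leaves f" for L
    using that homeomorphism_image_component[OF homeomorphism_symD[OF hom]] by (auto simp: leaves_def)
  have 3: "L = \<phi> ` g ` L" for L by (simp add: image_image gf)
  show ?thesis
  proof (intro equalityI subsetI)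
    fix L assume "L \<in> leaves f"
    from imageI[OF 2[OF this], of "\<lambda>L. \<phi> ` L"] show "L \<in> (\<lambda>L. \<phi> ` L) ` leaves h" using 3[of L] by simp
  qed (use 1 in auto)
qed

section \<open>Slice charts\<close>

lemma diffeomorphism_sym: "diffeomorphism S T f g \<Longrightarrow> diffeomorphism T S g f"
  by (simp add: diffeomorphism_def homeomorphism_symD)

lemma diffeomorphism_apply:
  assumes "diffeomorphism S T f g" "x \<in> S" shows "f x \<in> T" "g (f x) = x"
proof -
  have h: "homeomorphism S T f g" using assms(1) by (simp add: diffeomorphism_def)
  show "g (f x) = x" by (rule homeomorphism_apply1[OF h assms(2)])
  show "f x \<in> T" using homeomorphism_image1[OF h] assms(2) by blast
qed

lemma diffeomorphism_restrict:
  assumes d: "diffeomorphism S T f g" and "open S'" "S' \<subseteq> S"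
  shows "diffeomorphism S' (f ` S') f g"
proof -
  have h: "homeomorphism S T f g" "open S" "open T" "smooth_on S f" "smooth_on T g"
    using d by (simp_all add: diffeomorphism_def)
  have sub: "f ` S' \<subseteq> T" using diffeomorphism_apply(1)[OF d] assms(3) by blast
  have "f ` S' = T \<inter> g -` S'"
  proof (intro equalityI subsetI)
    fix y assume "y \<in> f ` S'"
    then obtain x where "x \<in> S'" "y = f x" by blast
    then show "y \<in> T \<inter> g -` S'" using diffeomorphism_apply[OF d, of x] assms(3) by auto
  next
    fix y assume y: "y \<in> T \<inter> g -` S'"
    then have "y = f (g y)" using diffeomorphism_apply(2)[OF diffeomorphism_sym[OF d], of y] by simp
    then show "y \<in> f ` S'" using y by blast
  qed
  then have "open (f ` S')"
    using continuous_open_preimage[OF smooth_on_continuous[OF h(5)] h(3) \<open>open S'\<close>] by simp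
  moreover have "homeomorphism S' (f ` S') f g" by (rule homeomorphism_of_subsets[OF h(1) assms(3)]) (use sub in auto)
  ultimately show ?thesis
    using assms(2) smooth_on_subset[OF h(4) assms(3)] smooth_on_subset[OF h(5) sub] by (simp add: diffeomorphism_def)
qed

lemma diffeomorphism_derivative:
  fixes f g :: "'a::euclidean_space \<Rightarrow> 'a"
  assumes d: "diffeomorphism S T f g" and x: "x \<in> S"
  shows "frechet_derivative g (at (f x)) (frechet_derivative f (at x) w) = w"
proof -
  have "smooth_on S f" "smooth_on T g" "open S" using d by (simp_all add: diffeomorphism_def)
  have "((\<lambda>x. g (f x)) has_derivative (\<lambda>w. frechet_derivative g (at (f x)) (frechet_derivative f (at x) w))) (at x)"
    by (rule has_derivative_compose[OF smooth_on_has_derivative[OF \<open>smooth_on S f\<close> x]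
          smooth_on_has_derivative[OF \<open>smooth_on T g\<close> diffeomorphism_apply(1)[OF d x]]])
  moreover have "((\<lambda>x. g (f x)) has_derivative (\<lambda>w. w)) (at x)"
    by (rule has_derivative_transform_within_open[OF has_derivative_ident \<open>open S\<close> x])
      (simp add: diffeomorphism_apply(2)[OF d])
  ultimately have "(\<lambda>w. frechet_derivative g (at (f x)) (frechet_derivative f (at x) w)) = (\<lambda>w. w)"
    by (rule has_derivative_unique)
  then show ?thesis by (rule fun_cong)
qed

text \<open>The domain of the chart is first shrunk to its part inside \<open>S\<close>; this does not change its intersection with \<open>L\<close>.\<close>

lemma slice_chart_image:
  assumes chart: "slice_chart L p \<Phi> \<Psi> V" and "L \<subseteq> S" "p \<in> S" and \<phi>: "diffeomorphism S T \<phi> \<psi>"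
  shows "slice_chart (\<phi> ` L) (\<phi> p) (\<Phi> \<circ> \<psi>) (\<phi> \<circ> \<Psi>) V"
proof -
  obtain U W where V: "subspace V" and d: "diffeomorphism U W \<Phi> \<Psi>" and p: "p \<in> U" "\<Phi> p = 0"
    and im: "\<Phi> ` (L \<inter> U) = V \<inter> W"
    using chart unfolding slice_chart_def by (elim conjE exE)
  let ?U = "U \<inter> S"
  have o: "open ?U" using d \<phi> by (auto simp: diffeomorphism_def)
  have d1: "diffeomorphism (\<phi> ` ?U) ?U \<psi> \<phi>"
    by (rule diffeomorphism_sym[OF diffeomorphism_restrict[OF \<phi> o]]) simp
  have d2: "diffeomorphism ?U (\<Phi> ` ?U) \<Phi> \<Psi>" by (rule diffeomorphism_restrict[OF d o]) simp
  have sub: "?U \<subseteq> U" "?U \<subseteq> S" by auto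
  have psi: "\<psi> (\<phi> x) = x" if "x \<in> S" for x by (rule diffeomorphism_apply(2)[OF \<phi> that])
  have "\<phi> ` L \<inter> \<phi> ` ?U = \<phi> ` (L \<inter> U)"
  proof (intro equalityI subsetI)
    fix y assume "y \<in> \<phi> ` L \<inter> \<phi> ` ?U"
    then obtain x x' where x: "x \<in> L" "y = \<phi> x" and x': "x' \<in> U" "x' \<in> S" "y = \<phi> x'" by blast
    have "x = x'" using psi[of x] psi[of x'] x x' \<open>L \<subseteq> S\<close> by auto
    then show "y \<in> \<phi> ` (L \<inter> U)" using x x' by blast
  next
    fix y assume "y \<in> \<phi> ` (L \<inter> U)"
    then show "y \<in> \<phi> ` L \<inter> \<phi> ` ?U" using \<open>L \<subseteq> S\<close> by auto
  qed
  then have "(\<Phi> \<circ> \<psi>) ` (\<phi> ` L \<inter> \<phi> ` ?U) = (\<lambda>x. \<Phi> (\<psi> (\<phi> x))) ` (L \<inter> U)" by (simp add: image_image)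
  also have "\<dots> = \<Phi> ` (L \<inter> U)" by (rule image_cong) (use psi \<open>L \<subseteq> S\<close> in auto)
  also have "\<dots> = V \<inter> \<Phi> ` ?U"
  proof (intro equalityI subsetI)
    fix y assume y: "y \<in> \<Phi> ` (L \<inter> U)"
    then have "y \<in> V" using im by blast
    moreover have "y \<in> \<Phi> ` ?U" using y \<open>L \<subseteq> S\<close> by auto
    ultimately show "y \<in> V \<inter> \<Phi> ` ?U" by simp
  next
    fix y assume y: "y \<in> V \<inter> \<Phi> ` ?U"
    then obtain x where x: "x \<in> U" "y = \<Phi> x" by blast
    then have "y \<in> V \<inter> W" using y diffeomorphism_apply(1)[OF d x(1)] by simp
    then show "y \<in> \<Phi> ` (L \<inter> U)" using im by simp
  qed
  finally have "(\<Phi> \<circ> \<psi>) ` (\<phi> ` L \<inter> \<phi> ` ?U) = V \<inter> \<Phi> ` ?U" .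
  moreover have "\<phi> p \<in> \<phi> ` ?U" "(\<Phi> \<circ> \<psi>) (\<phi> p) = 0" using p \<open>p \<in> S\<close> psi by auto
  ultimately show ?thesis
    using V diffeomorphism_compose[OF d1 d2] unfolding slice_chart_def by blast
qed

lemma slice_chart_center:
  assumes "slice_chart L p \<Phi> \<Psi> V"
  obtains U W where "subspace V" "diffeomorphism U W \<Phi> \<Psi>" "p \<in> U" "0 \<in> W" "\<Phi> p = 0" "\<Psi> 0 = p"
    "open U" "open W" "smooth_on U \<Phi>" "smooth_on W \<Psi>" "\<Phi> ` (L \<inter> U) = V \<inter> W"
proof -
  obtain U W where *: "subspace V" "diffeomorphism U W \<Phi> \<Psi>" "p \<in> U" "\<Phi> p = 0" "\<Phi> ` (L \<inter> U) = V \<inter> W"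
    using assms unfolding slice_chart_def by (elim conjE exE)
  have "0 \<in> W" "\<Psi> 0 = p" using diffeomorphism_apply[OF *(2,3)] *(4) by simp_all
  moreover have "open U" "open W" "smooth_on U \<Phi>" "smooth_on W \<Psi>" using *(2) by (simp_all add: diffeomorphism_def)
  ultimately show thesis using * by (intro that)
qed

lemma slice_chart_points:
  assumes d: "diffeomorphism U W \<Phi> \<Psi>" and im: "\<Phi> ` (L \<inter> U) = V \<inter> W" and "y \<in> V" "y \<in> W"
  shows "\<Psi> y \<in> L"
proof -
  have "y \<in> \<Phi> ` (L \<inter> U)" using im assms by simp
  then obtain x where "x \<in> L" "x \<in> U" "y = \<Phi> x" by blast
  then show ?thesis using diffeomorphism_apply(2)[OF d] by simp
qed

lemma has_derivative_line:
  assumes "(f has_derivative f') (at y)"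
  shows "((\<lambda>t::real. f (y + t *\<^sub>R w)) has_vector_derivative f' w) (at 0)"
proof -
  have "((\<lambda>t. y + t *\<^sub>R w) has_derivative (\<lambda>t. 0 + t *\<^sub>R w)) (at (0::real))"
    by (intro has_derivative_add has_derivative_const has_derivative_scaleR_left has_derivative_ident)
  from has_derivative_compose[OF this, of f f'] assms
  have "((\<lambda>t::real. f (y + t *\<^sub>R w)) has_derivative (\<lambda>t. f' (t *\<^sub>R w))) (at 0)" by simp
  then show ?thesis
    using linear_cmul[OF has_derivative_linear[OF assms]] by (simp add: has_vector_derivative_def)
qed

lemma vector_derivative_quotient:
  assumes "(f has_vector_derivative v) (at x)"
  shows "((\<lambda>t. (f (x + t) - f x) /\<^sub>R t) \<longlongrightarrow> v) (at 0)"
proof -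
  have "((\<lambda>t. norm (f (x + t) - f x - t *\<^sub>R v) / norm t) \<longlongrightarrow> 0) (at 0)"
    using assms by (simp add: has_vector_derivative_def has_derivative_at)
  moreover have "\<forall>\<^sub>F t in at 0. norm (f (x + t) - f x - t *\<^sub>R v) / norm t = norm ((f (x + t) - f x) /\<^sub>R t - v)"
  proof -
    have "norm (f (x + t) - f x - t *\<^sub>R v) / norm t = norm ((f (x + t) - f x) /\<^sub>R t - v)" if "t \<noteq> 0" for t
    proof -
      have "(f (x + t) - f x) /\<^sub>R t - v = (f (x + t) - f x - t *\<^sub>R v) /\<^sub>R t"
        using that by (simp add: scaleR_diff_right)
      then show ?thesis by (simp add: divide_inverse)
    qed
    then show ?thesis by (auto simp: eventually_at_filter)
  qed
  ultimately have "((\<lambda>t. norm ((f (x + t) - f x) /\<^sub>R t - v)) \<longlongrightarrow> 0) (at 0)"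
    by (rule Lim_transform_eventually)
  from tendsto_norm_zero_cancel[OF this] show ?thesis by (simp add: LIM_zero_iff)
qed

lemma eventually_line_in_open:
  fixes y w :: "'a::real_normed_vector"
  assumes "open W" "y \<in> W" shows "\<forall>\<^sub>F t::real in at 0. y + t *\<^sub>R w \<in> W"
proof -
  have "((\<lambda>t::real. y + t *\<^sub>R w) \<longlongrightarrow> y + 0 *\<^sub>R w) (at 0)"
    by (intro tendsto_add tendsto_const tendsto_scaleR tendsto_ident_at)
  then show ?thesis by (rule topological_tendstoD) (use assms in simp_all)
qed

text \<open>A slice chart sees the tangent space of its submanifold as a set of velocities of curves, and this
  description does not mention the chart.\<close>

lemma slice_chart_tangent_subset:
  fixes L :: "'a::euclidean_space set"
  assumes c0: "slice_chart L p \<Phi>0 \<Psi>0 V0" and c: "slice_chart L p \<Phi> \<Psi> V" and w: "w \<in> V0"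
  shows "\<exists>v\<in>V. frechet_derivative \<Psi> (at 0) v = frechet_derivative \<Psi>0 (at 0) w"
proof -
  obtain U0 W0 where 0: "subspace V0" "diffeomorphism U0 W0 \<Phi>0 \<Psi>0" "p \<in> U0" "0 \<in> W0" "\<Phi>0 p = 0" "\<Psi>0 0 = p"
    "open U0" "open W0" "smooth_on U0 \<Phi>0" "smooth_on W0 \<Psi>0" "\<Phi>0 ` (L \<inter> U0) = V0 \<inter> W0"
    by (rule slice_chart_center[OF c0])
  obtain U W where 1: "subspace V" "diffeomorphism U W \<Phi> \<Psi>" "p \<in> U" "0 \<in> W" "\<Phi> p = 0" "\<Psi> 0 = p"
    "open U" "open W" "smooth_on U \<Phi>" "smooth_on W \<Psi>" "\<Phi> ` (L \<inter> U) = V \<inter> W"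
    by (rule slice_chart_center[OF c])
  let ?T0 = "frechet_derivative \<Psi>0 (at 0)" and ?T' = "frechet_derivative \<Phi> (at p)"
  define v where "v = ?T' (?T0 w)"
  have d0: "(\<Psi>0 has_derivative ?T0) (at 0)" by (rule smooth_on_has_derivative[OF 0(10,4)])
  have d1: "(\<Phi> has_derivative ?T') (at (\<Psi>0 0))" unfolding 0(6) by (rule smooth_on_has_derivative[OF 1(9,3)])
  let ?f = "\<lambda>t::real. \<Phi> (\<Psi>0 (0 + t *\<^sub>R w))"
  have "(?f has_vector_derivative v) (at 0)"
    using has_derivative_line[OF has_derivative_compose[OF d0 d1], of w] by (simp add: v_def)
  from vector_derivative_quotient[OF this] have lim: "((\<lambda>t. (?f (0 + t) - ?f 0) /\<^sub>R t) \<longlongrightarrow> v) (at 0)" .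
  have near: "\<forall>\<^sub>F t in at (0::real). \<Psi>0 (0 + t *\<^sub>R w) \<in> L \<inter> U"
  proof -
    have o: "open (W0 \<inter> \<Psi>0 -` U)"
      using continuous_open_preimage[OF smooth_on_continuous[OF 0(10)] 0(8) 1(7)] by simp
    have "0 \<in> W0 \<inter> \<Psi>0 -` U" using 0(4,6) 1(3) by simp
    from eventually_line_in_open[OF o this, of w] show ?thesis
    proof eventually_elim
      case (elim t)
      have "0 + t *\<^sub>R w \<in> V0" using w 0(1) by (simp add: subspace_scale)
      then show ?case using elim slice_chart_points[OF 0(2,11)] by simp
    qed
  qed
  have "\<forall>\<^sub>F t in at (0::real). (?f (0 + t) - ?f 0) /\<^sub>R t \<in> V"
    using near
  proof eventually_elim
    case (elim t)
    then have "?f (0 + t) \<in> V \<inter> W" unfolding 1(11)[symmetric] by auto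
    then show ?case using 1(1) by (simp add: 0(6) 1(5) subspace_scale)
  qed
  then have "v \<in> V"
    by (intro Lim_in_closed_set[OF closed_subspace[OF 1(1)] _ _ lim]) auto
  moreover have "frechet_derivative \<Psi> (at 0) v = ?T0 w"
    using diffeomorphism_derivative[OF 1(2,3), of "?T0 w"] by (simp add: v_def 1(5))
  ultimately show ?thesis by blast
qed

text \<open>Lines through \<open>y\<close> in a direction of \<open>V\<close> stay in \<open>V \<inter> W\<close> for a short time.\<close>

lemma has_derivative_zero_along_subspace:
  assumes der: "(f has_derivative f') (at y)" and "subspace V" "open W" and y: "y \<in> V" "y \<in> W" and w: "w \<in> V"
    and const: "\<And>x. x \<in> V \<Longrightarrow> x \<in> W \<Longrightarrow> f x = c"
  shows "f' w = 0"
proof -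
  have "\<forall>\<^sub>F t in at (0::real). f (y + t *\<^sub>R w) = c"
    using eventually_line_in_open[OF \<open>open W\<close> y(2), of w]
  proof eventually_elim
    case (elim t)
    then show ?case using const \<open>subspace V\<close> y(1) w by (simp add: subspace_add subspace_scale)
  qed
  moreover have "f (y + 0 *\<^sub>R w) = c" using const y by simp
  ultimately have "((\<lambda>t::real. f (y + t *\<^sub>R w)) has_vector_derivative 0) (at 0)"
    unfolding has_vector_derivative_def
    by (intro has_derivative_transform_eventually[OF has_derivative_const[of c], THEN has_derivative_eq_rhs])
      (auto simp: eq_commute)
  from vector_derivative_unique_at[OF has_derivative_line[OF der] this] show ?thesis .
qed

text \<open>A slice chart of \<open>L\<close> composed with \<open>\<psi>\<close> is a slice chart of \<open>\<phi> ` L\<close>, in which \<open>q\<close> has the same coordinate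
  expression as \<open>q \<circ> \<phi>\<close> in the original chart. Non-degeneracy is assumed in every chart in which the point
  is critical, so Hessians in different charts are never compared.\<close>

lemma morse_function_on_pullback:
  fixes \<phi> :: "'a::euclidean_space \<Rightarrow> 'a"
  assumes \<phi>: "diffeomorphism S T \<phi> \<psi>" and "L \<subseteq> S" and emb: "embedded_submanifold (\<phi> ` L)" and q: "smooth_on T q"
    and nd: "\<And>p \<Phi> \<Psi> V v. p \<in> \<phi> ` L \<Longrightarrow> slice_chart (\<phi> ` L) p \<Phi> \<Psi> V \<Longrightarrow> critical_in_chart q \<Psi> V \<Longrightarrow>
        v \<in> V \<Longrightarrow> (\<And>w. w \<in> V \<Longrightarrow> hessian (q \<circ> \<Psi>) 0 v w = 0) \<Longrightarrow> v = 0"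
  shows "morse_function_on L (q \<circ> \<phi>)"
proof -
  have psi: "\<psi> (\<phi> x) = x" if "x \<in> S" for x by (rule diffeomorphism_apply(2)[OF \<phi> that])
  have im: "\<phi> ` L \<subseteq> T" using diffeomorphism_apply(1)[OF \<phi>] \<open>L \<subseteq> S\<close> by blast
  have LL: "\<psi> ` \<phi> ` L = L"
  proof -
    have "\<psi> ` \<phi> ` L = (\<lambda>x. x) ` L"
      unfolding image_image by (rule image_cong) (use psi \<open>L \<subseteq> S\<close> in auto)
    then show ?thesis by simp
  qed
  have "\<exists>\<Phi> \<Psi> V. slice_chart L p \<Phi> \<Psi> V" if p: "p \<in> L" for p
  proof -
    obtain \<Phi> \<Psi> V where "slice_chart (\<phi> ` L) (\<phi> p) \<Phi> \<Psi> V"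
      using emb p unfolding embedded_submanifold_def by blast
    from slice_chart_image[OF this im _ diffeomorphism_sym[OF \<phi>]]
    have "slice_chart L (\<psi> (\<phi> p)) (\<Phi> \<circ> \<phi>) (\<psi> \<circ> \<Psi>) V"
      using p im unfolding LL by blast
    then show ?thesis by (intro exI) (use psi[of p] p \<open>L \<subseteq> S\<close> in auto)
  qed
  then have "embedded_submanifold L" by (simp add: embedded_submanifold_def)
  moreover have "\<exists>S. open S \<and> L \<subseteq> S \<and> smooth_on S (q \<circ> \<phi>)"
  proof (intro exI conjI)
    show "open S" "L \<subseteq> S" using \<phi> \<open>L \<subseteq> S\<close> by (simp_all add: diffeomorphism_def)
    have "smooth_on S (\<lambda>x. q (\<phi> x))"
      by (rule smooth_on_compose[OF _ _ _ _ q])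
        (use \<phi> diffeomorphism_apply(1)[OF \<phi>] in \<open>auto simp: diffeomorphism_def\<close>)
    then show "smooth_on S (q \<circ> \<phi>)" by (simp add: o_def)
  qed
  moreover have "nondegenerate_critical_point_on L (q \<circ> \<phi>) p" if crit: "critical_point_on L (q \<circ> \<phi>) p" for p
  proof -
    obtain \<Phi> \<Psi> V where p: "p \<in> L" and ch: "slice_chart L p \<Phi> \<Psi> V" and cr: "critical_in_chart (q \<circ> \<phi>) \<Psi> V"
      using crit unfolding critical_point_on_def by (elim conjE exE)
    have ch': "slice_chart (\<phi> ` L) (\<phi> p) (\<Phi> \<circ> \<psi>) (\<phi> \<circ> \<Psi>) V"
      by (rule slice_chart_image[OF ch \<open>L \<subseteq> S\<close> _ \<phi>]) (use p \<open>L \<subseteq> S\<close> in auto)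
    have cr': "critical_in_chart q (\<phi> \<circ> \<Psi>) V" using cr by (simp add: critical_in_chart_def o_assoc)
    have "\<forall>v\<in>V. (\<forall>w\<in>V. hessian ((q \<circ> \<phi>) \<circ> \<Psi>) 0 v w = 0) \<longrightarrow> v = 0"
      using nd[OF imageI[OF p] ch' cr'] by (simp add: o_assoc)
    with p ch cr show ?thesis unfolding nondegenerate_critical_point_on_def by (intro conjI exI)
  qed
  ultimately show ?thesis by (simp add: morse_function_on_def)
qed


text \<open>With \<open>A\<close> the derivative of \<open>H\<close> at \<open>p\<close> and \<open>R\<close> a right inverse of \<open>A\<close>, the chart is
  \<open>\<Phi> z = (z - p) + R (H z - c - A (z - p))\<close>. It is tangent to the identity at \<open>p\<close>, and \<open>A (\<Phi> z) = H z - c\<close>, so it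
  maps the fibre into the kernel of \<open>A\<close>. Taking a ball for its image makes the part of the
  fibre in its domain connected, and therefore contained in the component \<open>L\<close>.\<close>

lemma level_set_slice_chart:
  fixes H :: "'a::euclidean_space \<Rightarrow> 'b::euclidean_space"
  assumes H: "smooth_on UNIV H" and L: "L \<in> components {z. z \<noteq> 0 \<and> H z = c}" and p: "p \<in> L"
    and R: "linear R" and AR: "\<And>s. frechet_derivative H (at p) (R s) = s"
  shows "\<exists>\<Phi> \<Psi>. slice_chart L p \<Phi> \<Psi> {w. frechet_derivative H (at p) w = 0} \<and>
    (\<forall>w. frechet_derivative \<Psi> (at 0) w = w)"
proof -
  let ?M = "{z. z \<noteq> 0 \<and> H z = c}"
  define A where "A = frechet_derivative H (at p)"
  define \<Phi> where "\<Phi> z = (z - p) + R (H z - c - A (z - p))" for z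
  have dH: "(H has_derivative A) (at p)" unfolding A_def by (rule smooth_on_has_derivative[OF H]) simp
  have linA: "linear A" by (rule has_derivative_linear[OF dH])
  have blA: "bounded_linear A" and blR: "bounded_linear R" using linA R by (simp_all add: linear_conv_bounded_linear)
  have LM: "L \<subseteq> ?M" using L by (rule in_components_subset)
  then have p': "p \<noteq> 0" "H p = c" using p by auto
  have o: "open (- {0 :: 'a})" by (simp add: open_Compl)
  have sz: "smooth_on (- {0}) (\<lambda>z. z - p)"
    by (intro smooth_on_minus o smooth_on_const smooth_on_bounded_linear[OF bounded_linear_ident])
  have sH: "smooth_on (- {0}) H" by (rule smooth_on_subset[OF H]) simp
  have "smooth_on (- {0}) (\<lambda>z. H z - c - A (z - p))"
    by (intro smooth_on_minus o smooth_on_const sH smooth_on_linear_compose[OF blA o sz])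
  from smooth_on_add[OF o sz smooth_on_linear_compose[OF blR o this]]
  have s\<Phi>: "smooth_on (- {0}) \<Phi>" by (simp add: \<Phi>_def[abs_def])
  have "(\<Phi> has_derivative (\<lambda>w. (w - 0) + R (A w - 0 - A (w - 0)))) (at p)"
    unfolding \<Phi>_def[abs_def]
    by (intro has_derivative_add has_derivative_diff has_derivative_ident has_derivative_const
        bounded_linear.has_derivative[OF blR] bounded_linear.has_derivative[OF blA] dH)
  then have d\<Phi>: "(\<Phi> has_derivative (\<lambda>w. w)) (at p)" by (simp add: linear_0[OF R])
  have fd: "frechet_derivative \<Phi> (at p) = (\<lambda>w. w)" using frechet_derivative_at[OF d\<Phi>] by simp
  have inj: "inj (frechet_derivative \<Phi> (at p))" unfolding fd by (simp add: inj_def)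
  obtain U0 V0 g where U0: "p \<in> U0" "U0 \<subseteq> - {0}" "diffeomorphism U0 V0 \<Phi> g"
  proof (rule smooth_inverse_function[OF o s\<Phi> _ inj])
    show "p \<in> - {0}" using p'(1) by simp
  qed (rule that)
  have \<Phi>p: "\<Phi> p = 0" by (simp add: \<Phi>_def p' linear_0[OF R] linear_0[OF linA])
  have "open V0" "0 \<in> V0" "g 0 = p"
    using U0(3) diffeomorphism_apply[OF U0(3,1)] by (simp_all add: diffeomorphism_def \<Phi>p)
  then obtain e where e: "e > 0" "ball 0 e \<subseteq> V0" using open_contains_ball by blast
  define W where "W = ball (0 :: 'a) e"
  have d: "diffeomorphism (g ` W) W \<Phi> g"
    by (rule diffeomorphism_sym[OF diffeomorphism_restrict[OF diffeomorphism_sym[OF U0(3)]]])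
      (use e in \<open>simp_all add: W_def\<close>)
  have "A (R s) = s" for s using AR by (simp add: A_def)
  then have A\<Phi>: "A (\<Phi> z) = H z - c" for z by (simp add: \<Phi>_def linear_add[OF linA])
  let ?V = "{w. A w = 0}"
  have V: "subspace ?V" 
    by (simp add: subspace_def linear_0[OF linA] linear_add[OF linA] linear_cmul[OF linA])
  have pU: "p \<in> g ` W" using e \<open>g 0 = p\<close> by (force simp: W_def)
  have \<Phi>g: "\<Phi> (g y) = y" if "y \<in> W" for y by (rule diffeomorphism_apply(2)[OF diffeomorphism_sym[OF d] that])
  have gM: "g ` (?V \<inter> W) \<subseteq> ?M"
  proof (rule image_subsetI)
    fix y assume y: "y \<in> ?V \<inter> W"
    then have "y \<in> V0" using e by (auto simp: W_def)
    then have "g y \<in> U0" by (rule diffeomorphism_apply(1)[OF diffeomorphism_sym[OF U0(3)]])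
    then have "g y \<noteq> 0" using U0(2) by auto
    moreover have "H (g y) = c" using A\<Phi>[of "g y"] \<Phi>g[of y] y by simp
    ultimately show "g y \<in> ?M" by simp
  qed
  have "convex (?V \<inter> W)"
    unfolding W_def by (intro convex_Int subspace_imp_convex[OF V] convex_ball)
  moreover have "continuous_on (?V \<inter> W) g"
    using d by (auto simp: diffeomorphism_def intro: continuous_on_subset[OF smooth_on_continuous])
  ultimately have conn: "connected (g ` (?V \<inter> W))"
    by (intro connected_continuous_image convex_connected)
  have "p \<in> g ` (?V \<inter> W)"
    using e \<open>g 0 = p\<close> linear_0[OF linA] by (intro image_eqI[of _ _ 0]) (simp_all add: W_def)
  then have gL: "g ` (?V \<inter> W) \<subseteq> L"
    using components_maximal[OF L conn gM] p by blast
  have "\<Phi> ` (L \<inter> g ` W) = ?V \<inter> W"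
  proof (intro equalityI subsetI)
    fix y assume "y \<in> \<Phi> ` (L \<inter> g ` W)"
    then obtain z where z: "z \<in> L" "z \<in> g ` W" "y = \<Phi> z" by blast
    have "A y = 0" using A\<Phi>[of z] z LM by auto
    moreover have "y \<in> W" using diffeomorphism_apply(1)[OF d z(2)] z(3) by simp
    ultimately show "y \<in> ?V \<inter> W" by simp
  next
    fix y assume y: "y \<in> ?V \<inter> W"
    then have "g y \<in> L \<inter> g ` W" using gL by blast
    then show "y \<in> \<Phi> ` (L \<inter> g ` W)" using \<Phi>g[of y] y by (intro image_eqI[of _ _ "g y"]) simp_all
  qed
  then have "slice_chart L p \<Phi> g ?V"
    unfolding slice_chart_def using V d pU \<Phi>p by (intro conjI exI[of _ "g ` W"] exI[of _ W])
  moreover have "frechet_derivative g (at 0) w = w" for w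
    using diffeomorphism_derivative[OF d pU, of w] by (simp add: fd \<Phi>p)
  ultimately show ?thesis unfolding A_def by (intro exI[of _ \<Phi>] exI[of _ g] conjI allI)
qed

lemma slice_chart_punctured:
  fixes p :: "'a::euclidean_space"
  assumes "p \<noteq> 0"
  shows "slice_chart (- {0}) p (\<lambda>z. z - p) (\<lambda>y. y + p) UNIV"
proof -
  have s: "smooth_on UNIV (\<lambda>z. z - p)" "smooth_on UNIV (\<lambda>z. z + p)"
    by (intro smooth_on_minus smooth_on_add open_UNIV smooth_on_const smooth_on_bounded_linear[OF bounded_linear_ident])+
  have "homeomorphism UNIV UNIV (\<lambda>z. z - p) (\<lambda>y. y + p)"
    by (intro homeomorphismI smooth_on_continuous s) auto
  then have "diffeomorphism UNIV UNIV (\<lambda>z. z - p) (\<lambda>y. y + p)" using s by (simp add: diffeomorphism_def)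
  from diffeomorphism_restrict[OF this, of "- {0}"]
  have "diffeomorphism (- {0}) ((\<lambda>z. z - p) ` (- {0})) (\<lambda>z. z - p) (\<lambda>y. y + p)" by (simp add: open_Compl)
  then show ?thesis
    unfolding slice_chart_def using assms
    by (intro conjI exI[of _ "- {0}"] exI[of _ "(\<lambda>z. z - p) ` (- {0})"]) simp_all
qed

section \<open>The distance function on the leaves of the Fermat polynomial\<close>

lemma has_derivative_quadQ: "(quadQ has_derivative (\<lambda>w. Re (\<Sum>i\<in>UNIV. 2 * cnj (z $ i) * w $ i))) (at z)"
proof -
  have "((\<lambda>z::complex^'a. \<Sum>i\<in>UNIV. z $ i \<bullet> z $ i) has_derivative (\<lambda>w. \<Sum>i\<in>UNIV. z $ i \<bullet> w $ i + w $ i \<bullet> z $ i)) (at z)"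
    by (intro has_derivative_sum has_derivative_inner bounded_linear_imp_has_derivative bounded_linear_component)
  moreover have "quadQ = (\<lambda>z::complex^'a. \<Sum>i\<in>UNIV. z $ i \<bullet> z $ i)"
    by (simp add: quadQ_def fun_eq_iff power2_norm_eq_inner)
  moreover have "z $ i \<bullet> w $ i + w $ i \<bullet> z $ i = Re (2 * cnj (z $ i) * w $ i)" for i w
    by (simp add: inner_complex_def)
  ultimately show ?thesis by simp
qed

lemma smooth_on_quadQ: "smooth_on UNIV quadQ"
proof -
  have "smooth_on UNIV (\<lambda>z::complex^'a. \<Sum>i\<in>UNIV. z $ i \<bullet> z $ i)"
    by (intro smooth_on_sum smooth_on_inner open_UNIV smooth_on_bounded_linear[OF bounded_linear_component])
  moreover have "quadQ = (\<lambda>z::complex^'a. \<Sum>i\<in>UNIV. z $ i \<bullet> z $ i)"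
    by (simp add: quadQ_def fun_eq_iff power2_norm_eq_inner)
  ultimately show ?thesis by simp
qed

lemma sum_axis: "(\<Sum>l\<in>UNIV. a l * axis i x $ l) = a i * (x :: complex)"
  by (simp add: axis_def if_distrib cong: if_cong)

text \<open>The kernel of \<open>a\<close> is a complex subspace, on which a complex linear functional with vanishing real part
  vanishes. The test vectors are the complex multiples of \<open>a\<^sub>j e\<^sub>i - a\<^sub>i e\<^sub>j\<close>.\<close>

lemma real_part_functional_multiple:
  fixes a b :: "'n::finite \<Rightarrow> complex"
  assumes "a j \<noteq> 0"
    and ker: "\<And>w :: complex ^ 'n. (\<Sum>l\<in>UNIV. a l * w $ l) = 0 \<Longrightarrow> Re (\<Sum>l\<in>UNIV. b l * w $ l) = 0"
  shows "b i = (b j / a j) * a i"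
proof -
  define d where "d = b i * a j - b j * a i"
  let ?w = "axis i (cnj d * a j) + axis j (- cnj d * a i) :: complex ^ 'n"
  have eq: "(\<Sum>l\<in>UNIV. f l * ?w $ l) = f i * (cnj d * a j) + f j * (- cnj d * a i)" for f
    by (simp only: vector_add_component distrib_left sum.distrib sum_axis)
  have "Re (b i * (cnj d * a j) + b j * (- cnj d * a i)) = 0"
    using ker[of ?w] unfolding eq by (simp add: mult_ac)
  moreover have "b i * (cnj d * a j) + b j * (- cnj d * a i) = d * cnj d" by (simp add: d_def algebra_simps)
  ultimately have "d = 0" by (simp add: complex_mult_cnj complex_eq_iff sum_power2_eq_zero_iff)
  then show ?thesis using assms(1) by (simp add: d_def field_simps)
qed

text \<open>The hypotheses say that \<open>p\<close> is critical for \<open>Q\<close> on its fibre, that \<open>\<xi>\<close> is tangent to the fibre, and that \<open>\<xi>\<close> lies in the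
  kernel of the Hessian of the Lagrange function, up to a multiple \<open>\<kappa>\<close> of the normal direction. Where \<open>p\<^sub>i = 0\<close>, the
  exponents \<open>k - 2\<close> and \<open>k - 1\<close> are positive and \<open>\<xi>\<^sub>i\<close> must vanish. Elsewhere put \<open>\<xi>\<^sub>i = x\<^sub>i p\<^sub>i\<close>: the number
  \<open>cnj x\<^sub>i - (k - 1) x\<^sub>i\<close> is the same for all these \<open>i\<close>, and \<open>x \<mapsto> cnj x - (k - 1) x\<close> is injective because \<open>k - 1 > 1\<close>, so
  all \<open>x\<^sub>i\<close> agree. Tangency gives \<open>x |p|\<^sup>2 = 0\<close>.\<close>

lemma fermat_hessian_kernel:
  fixes p \<xi> :: "complex ^ 'n::finite"
  assumes k: "k > 2" and "p \<noteq> 0" and p: "\<And>i. cnj (p $ i) = \<nu> * (p $ i) ^ (k - 1)"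
    and tan: "(\<Sum>i\<in>UNIV. (p $ i) ^ (k - 1) * \<xi> $ i) = 0"
    and hess: "\<And>i. 2 * cnj (\<xi> $ i) - 2 * \<nu> * (of_nat (k - 1) * \<xi> $ i * (p $ i) ^ (k - 2)) = \<kappa> * (p $ i) ^ (k - 1)"
  shows "\<xi> = 0"
proof -
  obtain j where j: "p $ j \<noteq> 0" using \<open>p \<noteq> 0\<close> by (auto simp: Finite_Cartesian_Product.vec_eq_iff)
  have \<nu>: "\<nu> \<noteq> 0" using p[of j] j by auto
  have k1: "k - 1 = Suc (k - 2)" using k by simp
  define x where "x i = \<xi> $ i / p $ i" for i
  have x: "cnj (x i) - of_nat (k - 1) * x i = \<kappa> / \<nu> / 2" if "p $ i \<noteq> 0" for i
  proof -
    have \<xi>: "\<xi> $ i = x i * p $ i" using that by (simp add: x_def)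
    have pp: "\<nu> * (p $ i) ^ (k - 2) * p $ i = cnj (p $ i)" unfolding p k1 by simp
    have "\<kappa> / \<nu> * cnj (p $ i) = \<kappa> * (p $ i) ^ (k - 1)" unfolding p using \<nu> by simp
    also have "\<dots> = 2 * cnj (\<xi> $ i) - 2 * \<nu> * (of_nat (k - 1) * \<xi> $ i * (p $ i) ^ (k - 2))" by (rule hess[symmetric])
    also have "\<dots> = 2 * (cnj (x i) * cnj (p $ i)) - 2 * of_nat (k - 1) * x i * (\<nu> * (p $ i) ^ (k - 2) * p $ i)"
      by (simp add: \<xi> mult_ac)
    also have "\<dots> = 2 * (cnj (x i) - of_nat (k - 1) * x i) * cnj (p $ i)" unfolding pp by (simp add: algebra_simps)
    finally have eq: "\<kappa> / \<nu> * cnj (p $ i) = 2 * (cnj (x i) - of_nat (k - 1) * x i) * cnj (p $ i)" .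
    have "cnj (p $ i) \<noteq> 0" using that by simp
    then have "\<kappa> / \<nu> = 2 * (cnj (x i) - of_nat (k - 1) * x i)" using eq mult_right_cancel by blast
    then show ?thesis by simp
  qed
  have same: "x i = x j" if "p $ i \<noteq> 0" for i
  proof -
    have "cnj (x i - x j) = of_nat (k - 1) * (x i - x j)"
      using x[OF that] x[OF j] by (simp add: algebra_simps)
    then have "cmod (cnj (x i - x j)) = cmod (of_nat (k - 1) * (x i - x j))" by (rule arg_cong)
    then have "cmod (x i - x j) = real (k - 1) * cmod (x i - x j)"
      unfolding complex_mod_cnj norm_mult norm_of_nat .
    then have "(real (k - 1) - 1) * cmod (x i - x j) = 0" by (simp add: algebra_simps)
    then show ?thesis using k by auto
  qed
  have \<xi>: "\<xi> $ i = x j * p $ i" for i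
  proof (cases "p $ i = 0")
    case True
    have 0: "(0::complex) ^ (k - 2) = 0" "(0::complex) ^ (k - 1) = 0" using k by simp_all
    show ?thesis using hess[of i] unfolding True 0 by simp
  next
    case False
    then have "\<xi> $ i = x i * p $ i" by (simp add: x_def)
    then show ?thesis unfolding same[OF False] .
  qed
  have "x j * (\<Sum>i\<in>UNIV. cnj (p $ i) * p $ i) = \<nu> * (\<Sum>i\<in>UNIV. (p $ i) ^ (k - 1) * \<xi> $ i)"
    unfolding sum_distrib_left by (intro sum.cong refl) (simp add: \<xi> p mult_ac)
  also have "\<dots> = 0" using tan by simp
  finally have 1: "x j * (\<Sum>i\<in>UNIV. cnj (p $ i) * p $ i) = 0" .
  have "(\<Sum>i\<in>UNIV. cnj (p $ i) * p $ i) = of_real (\<Sum>i\<in>UNIV. (cmod (p $ i))\<^sup>2)"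
    unfolding of_real_sum complex_norm_square by (simp add: mult.commute)
  moreover have "(\<Sum>i\<in>UNIV. (cmod (p $ i))\<^sup>2) > 0" by (rule sum_pos2[of _ j]) (use j in auto)
  ultimately have "(\<Sum>i\<in>UNIV. cnj (p $ i) * p $ i) \<noteq> 0" by (metis of_real_eq_0_iff less_irrefl)
  then have "x j = 0" using 1 by simp
  then show ?thesis by (simp add: Finite_Cartesian_Product.vec_eq_iff \<xi>)
qed


text \<open>The derivative \<open>X 0\<close> of the inverse chart maps \<open>V\<close> onto the kernel \<open>K\<close> of the
  derivative of the Fermat polynomial, whatever the chart, by comparison with the chart of \<open>level_set_slice_chart\<close>. In the chart, the derivative of
  \<open>Q\<close> along \<open>V \<inter> W\<close> is unchanged if a multiple of the derivative of the Fermat polynomial is subtracted, since the latter is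
  constant there. With the Lagrange multiplier as factor, the difference has coefficients \<open>\<theta> i\<close>
  that vanish at \<open>p\<close>, so second derivatives of the chart drop out of the Hessian, and what is left is
  the bilinear form with coefficients \<open>\<theta>' i\<close> on \<open>K\<close>.\<close>

lemma fermat_critical_point_nondegenerate:
  fixes L :: "(complex ^ 'n::finite) set"
  assumes k: "k > 2" and L: "L \<in> components {z. z \<noteq> 0 \<and> fermat k z = c}" and p: "p \<in> L"
    and ch: "slice_chart L p \<Phi> \<Psi> V" and crit: "critical_in_chart quadQ \<Psi> V"
    and v: "v \<in> V" and hess: "\<And>w. w \<in> V \<Longrightarrow> hessian (quadQ \<circ> \<Psi>) 0 v w = 0"
  shows "v = 0"
proof -
  obtain U W where c: "subspace V" "diffeomorphism U W \<Phi> \<Psi>" "p \<in> U" "0 \<in> W" "\<Phi> p = 0" "\<Psi> 0 = p"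
    "open U" "open W" "smooth_on U \<Phi>" "smooth_on W \<Psi>" "\<Phi> ` (L \<inter> U) = V \<inter> W"
    by (rule slice_chart_center[OF ch])
  have LM: "L \<subseteq> {z. z \<noteq> 0 \<and> fermat k z = c}" using L by (rule in_components_subset)
  then have "p \<noteq> 0" using p by auto
  then obtain j where j: "p $ j \<noteq> 0" by (auto simp: Finite_Cartesian_Product.vec_eq_iff)
  define a where "a i z = (z $ i) ^ (k - 1)" for i and z :: "complex ^ 'n"
  have aj: "a j p \<noteq> 0" using j by (simp add: a_def)
  have dF: "(fermat k has_derivative (\<lambda>w. of_nat k * (\<Sum>i\<in>UNIV. a i z * w $ i))) (at z)" for z :: "complex ^ 'n"
    using has_derivative_fermat[of k z] by (simp add: a_def sum_distrib_left mult.assoc)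
  have fF: "frechet_derivative (fermat k) (at z) = (\<lambda>w. of_nat k * (\<Sum>i\<in>UNIV. a i z * w $ i))" for z :: "complex ^ 'n"
    using frechet_derivative_at[OF dF] by simp
  define K where "K = {w :: complex ^ 'n. (\<Sum>i\<in>UNIV. a i p * w $ i) = 0}"
  have KF: "{w. frechet_derivative (fermat k) (at p) w = 0} = K"
    using k by (simp add: fF K_def)
  have "\<exists>\<Phi>0 \<Psi>0. slice_chart L p \<Phi>0 \<Psi>0 {w. frechet_derivative (fermat k) (at p) w = 0} \<and>
      (\<forall>w. frechet_derivative \<Psi>0 (at 0) w = w)"
  proof (rule level_set_slice_chart[OF smooth_on_homogeneous_polynomial[OF homogeneous_polynomial_fermat] L p])
    let ?R = "\<lambda>s. axis j (s / (of_nat k * a j p)) :: complex ^ 'n"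
    show "linear ?R"
      by (rule linearI) (simp_all add: Finite_Cartesian_Product.vec_eq_iff axis_def add_divide_distrib scaleR_conv_of_real[where 'a = complex])
    show "frechet_derivative (fermat k) (at p) (?R s) = s" for s
      unfolding fF sum_axis using k aj by simp
  qed
  then obtain \<Phi>0 \<Psi>0 where ch0: "slice_chart L p \<Phi>0 \<Psi>0 K" and id0: "\<And>w. frechet_derivative \<Psi>0 (at 0) w = w"
    unfolding KF by auto
  define X where "X y = frechet_derivative \<Psi> (at y)" for y
  have d\<Psi>: "(\<Psi> has_derivative X y) (at y)" if "y \<in> W" for y
    unfolding X_def by (rule smooth_on_has_derivative[OF c(10) that])
  have TK: "X 0 w \<in> K" if "w \<in> V" for w
    using slice_chart_tangent_subset[OF ch ch0 that] by (auto simp: X_def id0)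
  have KT: "\<exists>w\<in>V. X 0 w = \<eta>" if "\<eta> \<in> K" for \<eta>
    using slice_chart_tangent_subset[OF ch0 ch that] by (simp add: X_def id0)
  \<comment> \<open>\<open>2 \<nu> / k\<close> will be the Lagrange multiplier of \<open>Q\<close> on the fibre.\<close>
  have dQ: "((quadQ \<circ> \<Psi>) has_derivative (\<lambda>w. Re (\<Sum>i\<in>UNIV. 2 * cnj (\<Psi> y $ i) * X y w $ i))) (at y)" if "y \<in> W" for y
    using has_derivative_compose[OF d\<Psi>[OF that] has_derivative_quadQ] by (simp add: o_def)
  have fQ: "frechet_derivative (quadQ \<circ> \<Psi>) (at y) w = Re (\<Sum>i\<in>UNIV. 2 * cnj (\<Psi> y $ i) * X y w $ i)" if "y \<in> W" for y w
    using frechet_derivative_at[OF dQ[OF that]] by metis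
  define \<nu> where "\<nu> = cnj (p $ j) / a j p"
  have mult: "2 * cnj (p $ i) = (2 * cnj (p $ j) / a j p) * a i p" for i
  proof (rule real_part_functional_multiple[where a = "\<lambda>i. a i p" and b = "\<lambda>i. 2 * cnj (p $ i)", OF aj])
    fix w :: "complex ^ 'n" assume "(\<Sum>i\<in>UNIV. a i p * w $ i) = 0"
    then obtain u where u: "u \<in> V" "X 0 u = w" using KT[of w] by (auto simp: K_def)
    have "frechet_derivative (quadQ \<circ> \<Psi>) (at 0) u = 0" using crit u(1) by (simp add: critical_in_chart_def)
    then show "Re (\<Sum>i\<in>UNIV. 2 * cnj (p $ i) * w $ i) = 0" by (simp add: fQ[OF c(4)] u(2) c(6))
  qed
  have \<nu>: "cnj (p $ i) = \<nu> * a i p" for i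
  proof -
    have "2 * cnj (p $ i) = 2 * (\<nu> * a i p)" unfolding \<nu>_def using mult[of i] by simp
    then show ?thesis by simp
  qed
  define \<theta> where "\<theta> i z = 2 * cnj (z $ i) - 2 * \<nu> * a i z" for i z
  define \<theta>' where "\<theta>' i \<xi> = 2 * cnj (\<xi> $ i) - 2 * \<nu> * (of_nat (k - 1) * \<xi> $ i * (p $ i) ^ (k - 2))" for i and \<xi> :: "complex ^ 'n"
  have \<theta>p: "\<theta> i p = 0" for i by (simp add: \<theta>_def \<nu>)
  have k2: "k - 1 - 1 = k - 2" by simp
  have d\<theta>: "(\<theta> i has_derivative \<theta>' i) (at p)" for i
    unfolding \<theta>_def[abs_def] \<theta>'_def[abs_def] a_def k2[symmetric]
    by (intro has_derivative_diff has_derivative_mult_right has_derivative_power bounded_linear.has_derivative[OF bounded_linear_cnj]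
        bounded_linear_imp_has_derivative bounded_linear_component)
  define m where "m w y = Re (\<Sum>i\<in>UNIV. \<theta> i (\<Psi> y) * X y w $ i)" for w y
  have dm: "(m w has_derivative (\<lambda>u. Re (\<Sum>i\<in>UNIV. \<theta>' i (X 0 u) * X 0 w $ i))) (at 0)" for w
  proof -
    let ?X' = "frechet_derivative (\<lambda>y. X y w) (at 0)"
    have 1: "((\<lambda>y. X y w) has_derivative ?X') (at 0)"
      unfolding X_def by (rule smooth_on_has_derivative[OF smooth_on_frechet[OF c(10)] c(4)])
    have 2: "((\<lambda>y. \<theta> i (\<Psi> y)) has_derivative (\<lambda>u. \<theta>' i (X 0 u))) (at 0)" for i
      by (rule has_derivative_compose[OF d\<Psi>[OF c(4)]]) (use d\<theta> in \<open>simp add: c(6)\<close>)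
    have "((\<lambda>y. Re (\<Sum>i\<in>UNIV. \<theta> i (\<Psi> y) * X y w $ i)) has_derivative
        (\<lambda>u. Re (\<Sum>i\<in>UNIV. \<theta> i (\<Psi> 0) * ?X' u $ i + \<theta>' i (X 0 u) * X 0 w $ i))) (at 0)"
      by (intro bounded_linear.has_derivative[OF bounded_linear_Re] has_derivative_sum has_derivative_mult 2
          bounded_linear.has_derivative[OF bounded_linear_component 1])
    then show ?thesis by (simp add: m_def[abs_def] c(6) \<theta>p)
  qed
  have hess_eq: "hessian (quadQ \<circ> \<Psi>) 0 v w = Re (\<Sum>i\<in>UNIV. \<theta>' i (X 0 v) * X 0 w $ i)" if w: "w \<in> V" for w
  proof -
    let ?q = "\<lambda>y. frechet_derivative (quadQ \<circ> \<Psi>) (at y) w"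
    have sq: "smooth_on W (quadQ \<circ> \<Psi>)"
      using smooth_on_compose[OF c(8) open_UNIV _ c(10) smooth_on_quadQ] by (simp add: o_def)
    have dq: "(?q has_derivative frechet_derivative ?q (at 0)) (at 0)"
      by (rule smooth_on_has_derivative[OF smooth_on_frechet[OF sq] c(4)])
    have zero: "?q y - m w y = 0" if y: "y \<in> V" "y \<in> W" for y
    proof -
      have "((\<lambda>y. fermat k (\<Psi> y)) has_derivative (\<lambda>w. of_nat k * (\<Sum>i\<in>UNIV. a i (\<Psi> y) * X y w $ i))) (at y)"
        by (rule has_derivative_compose[OF d\<Psi>[OF y(2)] dF])
      then have "of_nat k * (\<Sum>i\<in>UNIV. a i (\<Psi> y) * X y w $ i) = 0"
      proof (rule has_derivative_zero_along_subspace[OF _ c(1,8) y w])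
        show "fermat k (\<Psi> x) = c" if "x \<in> V" "x \<in> W" for x
          using slice_chart_points[OF c(2,11) that] LM by auto
      qed
      then have tan: "(\<Sum>i\<in>UNIV. a i (\<Psi> y) * X y w $ i) = 0" using k by simp
      have "(\<Sum>i\<in>UNIV. 2 * cnj (\<Psi> y $ i) * X y w $ i) - (\<Sum>i\<in>UNIV. \<theta> i (\<Psi> y) * X y w $ i)
          = 2 * \<nu> * (\<Sum>i\<in>UNIV. a i (\<Psi> y) * X y w $ i)"
        unfolding sum_distrib_left sum_subtractf[symmetric]
        by (intro sum.cong refl) (simp add: \<theta>_def algebra_simps)
      then have "(\<Sum>i\<in>UNIV. 2 * cnj (\<Psi> y $ i) * X y w $ i) = (\<Sum>i\<in>UNIV. \<theta> i (\<Psi> y) * X y w $ i)"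
        by (simp add: tan)
      then show ?thesis unfolding fQ[OF y(2)] m_def by simp
    qed
    have "frechet_derivative ?q (at 0) v - Re (\<Sum>i\<in>UNIV. \<theta>' i (X 0 v) * X 0 w $ i) = 0"
      by (rule has_derivative_zero_along_subspace[OF has_derivative_diff[OF dq dm] c(1,8) _ c(4) v zero])
        (use c(1) in \<open>simp_all add: subspace_0\<close>)
    then show ?thesis by (simp add: hessian_def)
  qed
  define \<kappa> where "\<kappa> = \<theta>' j (X 0 v) / a j p"
  have \<kappa>: "\<theta>' i (X 0 v) = \<kappa> * a i p" for i
    unfolding \<kappa>_def
  proof (rule real_part_functional_multiple[where a = "\<lambda>i. a i p" and b = "\<lambda>i. \<theta>' i (X 0 v)", OF aj])
    fix w :: "complex ^ 'n" assume "(\<Sum>i\<in>UNIV. a i p * w $ i) = 0"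
    then obtain u where u: "u \<in> V" "X 0 u = w" using KT[of w] by (auto simp: K_def)
    show "Re (\<Sum>i\<in>UNIV. \<theta>' i (X 0 v) * w $ i) = 0"
      using hess[OF u(1)] hess_eq[OF u(1)] by (simp add: u(2))
  qed
  have "X 0 v = 0"
  proof (rule fermat_hessian_kernel[OF k \<open>p \<noteq> 0\<close>])
    show "cnj (p $ i) = \<nu> * p $ i ^ (k - 1)" for i using \<nu>[of i] by (simp add: a_def)
    show "(\<Sum>i\<in>UNIV. p $ i ^ (k - 1) * X 0 v $ i) = 0" using TK[OF v] by (simp add: K_def a_def)
    show "2 * cnj (X 0 v $ i) - 2 * \<nu> * (of_nat (k - 1) * X 0 v $ i * p $ i ^ (k - 2)) = \<kappa> * p $ i ^ (k - 1)" for i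
      using \<kappa>[of i] by (simp add: \<theta>'_def a_def)
  qed
  moreover have "frechet_derivative \<Phi> (at p) (X 0 v) = v"
    using diffeomorphism_derivative[OF diffeomorphism_sym[OF c(2)] c(4), of v] by (simp add: X_def c(6))
  moreover have "linear (frechet_derivative \<Phi> (at p))"
    by (rule has_derivative_linear[OF smooth_on_has_derivative[OF c(9,3)]])
  ultimately show "v = 0" using linear_0 by fastforce
qed

lemma fermat_leaf_embedded:
  fixes L :: "(complex ^ 'n::finite) set"
  assumes "k > 0" and L: "L \<in> components {z. z \<noteq> 0 \<and> fermat k z = c}"
  shows "embedded_submanifold L"
  unfolding embedded_submanifold_def
proof
  fix p assume p: "p \<in> L"
  then have "p \<noteq> 0" using in_components_subset[OF L] by auto
  then obtain j where j: "p $ j \<noteq> 0" by (auto simp: Finite_Cartesian_Product.vec_eq_iff)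
  let ?R = "\<lambda>s. axis j (s / (of_nat k * (p $ j) ^ (k - 1))) :: complex ^ 'n"
  have "linear ?R"
    by (rule linearI) (simp_all add: Finite_Cartesian_Product.vec_eq_iff axis_def add_divide_distrib scaleR_conv_of_real[where 'a = complex])
  moreover have "frechet_derivative (fermat k) (at p) (?R s) = s" for s
    unfolding frechet_derivative_at[OF has_derivative_fermat, symmetric] sum_axis using j \<open>k > 0\<close> by simp
  ultimately show "\<exists>\<Phi> \<Psi> V. slice_chart L p \<Phi> \<Psi> V"
    using level_set_slice_chart[OF smooth_on_homogeneous_polynomial[OF homogeneous_polynomial_fermat] L p] by blast
qed

theorem corollary6p8:
  fixes h :: "complex ^ 'n::finite \<Rightarrow> complex" and k :: nat
  assumes "CARD('n) \<ge> 2" and "k > 2"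
    and "homogeneous_polynomial k h"
    and "{z. critical_point h z} = {0}"
  shows "isotopic_foliations (leaves h) (leaves (fermat k)) \<and>
    (\<exists>g. isotopic_function g quadQ \<and> morse_function_on (- {0}) g \<and>
         carries_morse_structure (leaves h) g)"
proof -
  obtain \<phi> where \<phi>: "isotopy_end \<phi>" and level: "\<And>z. fermat k (\<phi> z) = h z"
    using isotopic_to_fermat[OF assms(3,2,4)] by auto
  have leaves: "(\<lambda>L. \<phi> ` L) ` leaves h = leaves (fermat k)" by (rule image_leaves[where f = "fermat k"]) (rule \<phi>, rule level)
  obtain F where "isotopy F" "F 1 = \<phi>" using \<phi> unfolding isotopy_end_def by auto
  then obtain \<psi> where d: "diffeomorphism (- {0}) (- {0}) \<phi> \<psi>"
    using isotopy_homeomorphism[of F 1] by auto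
  have sQ: "smooth_on (- {0}) quadQ" by (rule smooth_on_subset[OF smooth_on_quadQ]) simp
  have punctured: "\<phi> ` (- {0}) = - {0}" using d by (simp add: diffeomorphism_def homeomorphism_def)
  have "morse_function_on (- {0}) (quadQ \<circ> \<phi>)"
  proof (rule morse_function_on_pullback[OF d subset_refl _ sQ], unfold punctured)
    show "embedded_submanifold (- {0 :: complex ^ 'n})"
      unfolding embedded_submanifold_def using slice_chart_punctured by blast
    fix p :: "complex ^ 'n" and \<Phi> \<Psi> V and v :: "complex ^ 'n"
    assume p: "p \<in> - {0}" and ch: "slice_chart (- {0}) p \<Phi> \<Psi> V" and crit: "critical_in_chart quadQ \<Psi> V"
    \<comment> \<open>There is no such \<open>p\<close>: the derivative of \<open>Q\<close> at \<open>p\<close> in the direction \<open>p\<close> is \<open>2 Q (p)\<close>.\<close>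
    obtain U W where c: "subspace V" "diffeomorphism U W \<Phi> \<Psi>" "p \<in> U" "0 \<in> W" "\<Phi> p = 0" "\<Psi> 0 = p"
      "open U" "open W" "smooth_on U \<Phi>" "smooth_on W \<Psi>" "\<Phi> ` (- {0} \<inter> U) = V \<inter> W"
      by (rule slice_chart_center[OF ch])
    have ch0: "slice_chart (- {0}) p (\<lambda>z. z - p) (\<lambda>y. y + p) UNIV" using p by (intro slice_chart_punctured) simp
    have "((\<lambda>y. y + p) has_derivative (\<lambda>w. w)) (at 0)"
      using has_derivative_add[OF has_derivative_ident has_derivative_const] by fastforce
    then have "frechet_derivative (\<lambda>y. y + p) (at 0) = (\<lambda>w. w)" using frechet_derivative_at by metis
    then obtain w where w: "w \<in> V" "frechet_derivative \<Psi> (at 0) w = p"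
      using slice_chart_tangent_subset[OF ch0 ch UNIV_I, of p] by auto
    have "((\<lambda>y. quadQ (\<Psi> y)) has_derivative (\<lambda>w. Re (\<Sum>i\<in>UNIV. 2 * cnj (\<Psi> 0 $ i) * frechet_derivative \<Psi> (at 0) w $ i))) (at 0)"
      by (rule has_derivative_compose[OF smooth_on_has_derivative[OF c(10,4)] has_derivative_quadQ])
    from fun_cong[OF frechet_derivative_at[OF this], of w]
    have "frechet_derivative (quadQ \<circ> \<Psi>) (at 0) w = Re (\<Sum>i\<in>UNIV. 2 * cnj (p $ i) * p $ i)"
      unfolding o_def c(6) w(2) by (rule sym)
    also have "\<dots> = (\<Sum>i\<in>UNIV. 2 * (cmod (p $ i))\<^sup>2)"
      unfolding Re_sum by (intro sum.cong refl) (simp only: cmod_power2, simp add: power2_eq_square algebra_simps)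
    also have "\<dots> = 2 * (\<Sum>i\<in>UNIV. (cmod (p $ i))\<^sup>2)" by (rule sum_distrib_left[symmetric])
    finally have "2 * (\<Sum>i\<in>UNIV. (cmod (p $ i))\<^sup>2) = 0"
      using crit w(1) by (simp add: critical_in_chart_def)
    then have "p = 0" by (simp add: sum_nonneg_eq_0_iff Finite_Cartesian_Product.vec_eq_iff)
    then show "v = 0" using p by simp
  qed
  moreover have "carries_morse_structure (leaves h) (quadQ \<circ> \<phi>)"
    unfolding carries_morse_structure_def
  proof
    fix L assume L: "L \<in> leaves h"
    then have "L \<subseteq> - {0}" by (auto simp: leaves_def dest: in_components_subset)
    have "\<phi> ` L \<in> leaves (fermat k)" using L leaves by blast
    then obtain c where c: "\<phi> ` L \<in> components {z. z \<noteq> 0 \<and> fermat k z = c}" by (auto simp: leaves_def)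
    show "morse_function_on L (quadQ \<circ> \<phi>)"
    proof (rule morse_function_on_pullback[OF d \<open>L \<subseteq> - {0}\<close> _ sQ])
      show "embedded_submanifold (\<phi> ` L)" by (rule fermat_leaf_embedded[OF _ c]) (use assms(2) in simp)
    qed (rule fermat_critical_point_nondegenerate[OF assms(2) c])
  qed
  moreover have "isotopic_function (quadQ \<circ> \<phi>) quadQ" using \<phi> unfolding isotopic_function_def by blast
  moreover have "isotopic_foliations (leaves h) (leaves (fermat k))"
    using \<phi> leaves unfolding isotopic_foliations_def by blast
  ultimately show ?thesis by blast
qed

end
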